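(* Let $\mathcal{A}$ and $\mathcal{B}$ be $C^*$-categories and let $F:\mathrm{Hilb}\text{-}\mathcal{A}\rightarrow\mathrm{Hilb}\text{-}\mathcal{B}$ be any unital strong $C^*$-functor. Let $E:=F\circ\iota_{\mathcal{A}}:\mathcal{A}\to\mathrm{Hilb}\text{-}\mathcal{B}$ be the composition of $F$ with the Yoneda embedding $\iota_{\mathcal{A}}:\mathcal{A}\rightarrow\mathrm{Hilb}\text{-}\mathcal{A}$. Then there exists a natural unitary isomorphism of functors $\psi:-\bar{\otimes}_{\mathcal{A}}E\xrightarrow{\cong}F$.
   Context: Conventions: a "category" need not have identities (semicategory); a "unital category" has identities; "functors" need not preserve identities, "unital functors" do. A $C^*$-category is a category $\mathcal{A}$ whose hom-sets are complex Banach spaces, with bilinear composition satisfying $\|fg\|\le\|f\|\|g\|$, and with a conjugate-linear involution $*:\mathcal{A}(x,y)\to\mathcal{A}(y,x)$ (contravariant, identity on objects, $f^{**}=f$) such that for every $a\in\mathcal{A}(x,y)$ one has $\|a^*a\|=\|a\|^2$ and the spectrum of $a^*a$ in the minimal unitization of $\mathcal{A}(x,x)$ lies in $[0,\infty)$. A $C^*$-functor is a $\mathbb{C}$-linear functor preserving involutions. A unitary is a morphism $u$ with $u^*u$ and $uu^*$ identities. A right Hilbert $\mathcal{A}$-module is a $\mathbb{C}$-linear functor $E:\mathcal{A}^{op}\to\mathrm{Vect}_{\mathbb{C}}$ (write $e\cdot a:=E(a)(e)\in E(w)$ for $e\in E(x)$, $a\in\mathcal{A}(w,x)$) with sesquilinear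 maps $\langle-,-\rangle:E(y)\times E(x)\to\mathcal{A}(x,y)$ (linear in the second, conjugate-linear in the first argument) such that $\langle e,f\rangle=\langle f,e\rangle^*$, $\langle e,f\rangle\circ g=\langle e,f\cdot g\rangle$, $\langle e,e\rangle$ is positive, $\langle e,e\rangle=0$ only if $e=0$, and each $E(x)$ is complete in the norm $\|e\|=\|\langle e,e\rangle\|^{1/2}$. A bounded adjointable operator $T:E\to F$ is a natural transformation with $\|T\|:=\sup\{\|T(e)\|:x\in\mathrm{Ob}\,\mathcal{A},e\in E(x),\|e\|=1\}<\infty$ having an adjoint $T^*:F\to E$ with $\langle Te,f\rangle=\langle e,T^*f\rangle$; $\mathcal{L}(E,F)$ is the space of these. $\mathrm{Hilb}\text{-}\mathcal{A}$ is the unital $C^*$-category of right Hilbert $\mathcal{A}$-modules and bounded adjointable operators. For $x\in\mathrm{Ob}\,\mathcal{A}$ the representable module $h_x$ is $h_x(y)=\mathcal{A}(y,x)$ with action by composition and $\langle a,b\rangle=a^*b$; the Yoneda embedding $\iota_{\mathcal{A}}:\mathcal{A}\to\mathrm{Hilb}\text{-}\mathcal{A}$ sends $x\mapsto h_x$ and a morphism $a$ to postcomposition with $a$. Strong topology: a net $T_\lambda\in\mathcal{L}(E,F)$ converges strongly to $T$ if $\|T_\lambda(e)-T(e)\|\to0$ and $\|T_\lambda^*(f)-T^*(f)\|\to0$ for all $x\in\mathrm{Ob}\,\mathcal{A}$, $e\in E(x)$, $f\in F(x)$. A $C^*$-functor between categories of Hilbert modules is called strong if it is continuous for the strong topologies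 on norm-bounded subsets of hom-spaces. A right Hilbert $\mathcal{A}$-$\mathcal{B}$ bimodule is a $C^*$-functor $E:\mathcal{A}\to\mathrm{Hilb}\text{-}\mathcal{B}$; write $a\cdot e:=E(a)(e)$. For a right Hilbert $\mathcal{A}$-module $M$, the tensor product $M\bar{\otimes}_{\mathcal{A}}E$ is the right Hilbert $\mathcal{B}$-module whose value at $z\in\mathrm{Ob}\,\mathcal{B}$ is the completion of $\bigoplus_{x\in\mathrm{Ob}\,\mathcal{A}}M(x)\otimes_{\mathbb{C}}E(x)(z)$ modulo the relations $m\cdot a\otimes e\sim m\otimes a\cdot e$, with respect to the inner products determined by $\langle m\otimes e,m'\otimes e'\rangle=\langle e,\langle m,m'\rangle\cdot e'\rangle$, with action $(m\otimes e)\cdot b=m\otimes(e\cdot b)$. On operators, $-\bar{\otimes}_{\mathcal{A}}E$ sends $T$ to the extension of $m\otimes e\mapsto T(m)\otimes e$. *)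

theory Defs
  imports
    "HOL-Analysis.Analysis"
    "HOL-Algebra.Module"
    "HOL-Library.Poly_Mapping"
    "HOL-Library.Nonpos_Ints"
begin

section \<open>Complex vector spaces with explicit carriers\<close>

text \<open>
  Complex vector spaces are modules, in the sense of HOL-Algebra, over the field of complex numbers.
  The ring fields \<open>mult\<close> and \<open>one\<close> which that record type carries along play no role for modules;
  they are left \<open>undefined\<close> in all constructions below.
\<close>

definition complex_field :: "complex ring" where
  "complex_field = \<lparr>carrier = UNIV, mult = (*), one = 1, zero = 0, add = (+)\<rparr>"

lemma cring_complex_field: "cring complex_field"
proof (rule cringI)
  show "abelian_group complex_field"
  proof (rule abelian_groupI)
    fix x assume "x \<in> carrier complex_field"
    show "\<exists>y\<in>carrier complex_field. y \<oplus>\<^bsub>complex_field\<^esub> x = \<zero>\<^bsub>complex_field\<^esub>"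
      by (rule bexI[of _ "- x"]) (auto simp: complex_field_def)
  qed (auto simp: complex_field_def)
  show "comm_monoid complex_field"
    by (rule comm_monoidI) (auto simp: complex_field_def)
qed (auto simp: complex_field_def algebra_simps)

type_synonym 'a cspace = "(complex, 'a) module"

abbreviation complex_space :: "(complex, 'a, 'x) module_scheme \<Rightarrow> bool" where
  "complex_space V \<equiv> module complex_field V"

definition linear_on ::
  "(complex, 'a, 'x) module_scheme \<Rightarrow> (complex, 'b, 'y) module_scheme \<Rightarrow> ('a \<Rightarrow> 'b) \<Rightarrow> bool" where
  "linear_on V W f \<longleftrightarrow>
     f \<in> carrier V \<rightarrow> carrier W \<and>
     (\<forall>u\<in>carrier V. \<forall>v\<in>carrier V. f (u \<oplus>\<^bsub>V\<^esub> v) = f u \<oplus>\<^bsub>W\<^esub> f v) \<and>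
     (\<forall>k. \<forall>v\<in>carrier V. f (k \<odot>\<^bsub>V\<^esub> v) = k \<odot>\<^bsub>W\<^esub> f v)"

definition conj_linear_on ::
  "(complex, 'a, 'x) module_scheme \<Rightarrow> (complex, 'b, 'y) module_scheme \<Rightarrow> ('a \<Rightarrow> 'b) \<Rightarrow> bool" where
  "conj_linear_on V W f \<longleftrightarrow>
     f \<in> carrier V \<rightarrow> carrier W \<and>
     (\<forall>u\<in>carrier V. \<forall>v\<in>carrier V. f (u \<oplus>\<^bsub>V\<^esub> v) = f u \<oplus>\<^bsub>W\<^esub> f v) \<and>
     (\<forall>k. \<forall>v\<in>carrier V. f (k \<odot>\<^bsub>V\<^esub> v) = cnj k \<odot>\<^bsub>W\<^esub> f v)"

definition cauchy_in :: "(complex, 'a, 'x) module_scheme \<Rightarrow> ('a \<Rightarrow> real) \<Rightarrow> (nat \<Rightarrow> 'a) \<Rightarrow> bool" where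
  "cauchy_in V N s \<longleftrightarrow>
     (\<forall>n. s n \<in> carrier V) \<and>
     (\<forall>\<epsilon>>0. \<exists>K. \<forall>m\<ge>K. \<forall>n\<ge>K. N (s m \<ominus>\<^bsub>V\<^esub> s n) < \<epsilon>)"

definition complete_in :: "(complex, 'a, 'x) module_scheme \<Rightarrow> ('a \<Rightarrow> real) \<Rightarrow> bool" where
  "complete_in V N \<longleftrightarrow>
     (\<forall>s. cauchy_in V N s \<longrightarrow> (\<exists>l\<in>carrier V. (\<lambda>n. N (s n \<ominus>\<^bsub>V\<^esub> l)) \<longlonglongrightarrow> 0))"

record 'a normed_cspace = "(complex, 'a) module" +
  nrm :: "'a \<Rightarrow> real"

definition banach_cspace :: "('a, 'x) normed_cspace_scheme \<Rightarrow> bool" where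
  "banach_cspace V \<longleftrightarrow>
     complex_space V \<and>
     (\<forall>v\<in>carrier V. 0 \<le> nrm V v \<and> (nrm V v = 0 \<longleftrightarrow> v = \<zero>\<^bsub>V\<^esub>)) \<and>
     (\<forall>u\<in>carrier V. \<forall>v\<in>carrier V. nrm V (u \<oplus>\<^bsub>V\<^esub> v) \<le> nrm V u + nrm V v) \<and>
     (\<forall>k. \<forall>v\<in>carrier V. nrm V (k \<odot>\<^bsub>V\<^esub> v) = cmod k * nrm V v) \<and>
     complete_in V (nrm V)"


section \<open>C*-categories\<close>

text \<open>
  \<open>Hom C x y\<close> is the space of morphisms from \<open>x\<close> to \<open>y\<close>. All operations are indexed by the objects
  involved, so hom-sets need not be disjoint: for \<open>f\<close> from \<open>x\<close> to \<open>y\<close> and \<open>g\<close> from \<open>y\<close> to \<open>z\<close>,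
  \<open>Cmp C x y z g f\<close> is the composite \<open>g \<circ> f\<close>, and \<open>Star C x y f\<close>, from \<open>y\<close> to \<open>x\<close>, is \<open>f\<^sup>*\<close>.
\<close>

record ('o, 'm) star_cat =
  Obj :: "'o set"
  Hom :: "'o \<Rightarrow> 'o \<Rightarrow> 'm normed_cspace"
  Cmp :: "'o \<Rightarrow> 'o \<Rightarrow> 'o \<Rightarrow> 'm \<Rightarrow> 'm \<Rightarrow> 'm"
  Star :: "'o \<Rightarrow> 'o \<Rightarrow> 'm \<Rightarrow> 'm"

abbreviation arr :: "('o, 'm) star_cat \<Rightarrow> 'o \<Rightarrow> 'o \<Rightarrow> 'm set" where
  "arr C x y \<equiv> carrier (Hom C x y)"

definition endo_unit :: "('o, 'm) star_cat \<Rightarrow> 'o \<Rightarrow> 'm \<Rightarrow> bool" where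
  "endo_unit C x u \<longleftrightarrow> u \<in> arr C x x \<and> (\<forall>a\<in>arr C x x. Cmp C x x x u a = a \<and> Cmp C x x x a u = a)"

definition endo_ring :: "('o, 'm) star_cat \<Rightarrow> 'o \<Rightarrow> 'm ring" where
  "endo_ring C x =
     \<lparr>carrier = arr C x x, mult = Cmp C x x x, one = (THE u. endo_unit C x u),
      zero = \<zero>\<^bsub>Hom C x x\<^esub>, add = add (Hom C x x)\<rparr>"

text \<open>The algebra obtained by adjoining a unit; \<open>(a, k)\<close> stands for \<open>a + k 1\<close>.\<close>

definition endo_unitization :: "('o, 'm) star_cat \<Rightarrow> 'o \<Rightarrow> ('m \<times> complex) ring" where
  "endo_unitization C x =
     (let V = Hom C x x in
      \<lparr>carrier = carrier V \<times> UNIV,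
       mult = (\<lambda>(a, k) (b, l). (Cmp C x x x a b \<oplus>\<^bsub>V\<^esub> (l \<odot>\<^bsub>V\<^esub> a) \<oplus>\<^bsub>V\<^esub> (k \<odot>\<^bsub>V\<^esub> b), k * l)),
       one = (\<zero>\<^bsub>V\<^esub>, 1),
       zero = (\<zero>\<^bsub>V\<^esub>, 0),
       add = (\<lambda>(a, k) (b, l). (a \<oplus>\<^bsub>V\<^esub> b, k + l))\<rparr>)"

text \<open>
  Spectrum in the minimal unitization, which is the endomorphism algebra itself if that is unital
  and has a unit adjoined otherwise.
\<close>

definition spectrum :: "('o, 'm) star_cat \<Rightarrow> 'o \<Rightarrow> 'm \<Rightarrow> complex set" where
  "spectrum C x a =
     (if \<exists>u. endo_unit C x u
      then {k. a \<ominus>\<^bsub>Hom C x x\<^esub> (k \<odot>\<^bsub>Hom C x x\<^esub> \<one>\<^bsub>endo_ring C x\<^esub>) \<notin> Units (endo_ring C x)}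
      else {k. (a, - k) \<notin> Units (endo_unitization C x)})"

definition positive :: "('o, 'm) star_cat \<Rightarrow> 'o \<Rightarrow> 'm \<Rightarrow> bool" where
  "positive C x a \<longleftrightarrow> a \<in> arr C x x \<and> Star C x x a = a \<and> spectrum C x a \<subseteq> \<real>\<^sub>\<ge>\<^sub>0"

locale cstar_category =
  fixes C :: "('o, 'm) star_cat"
  assumes banach:
      "\<And>x y. \<lbrakk>x \<in> Obj C; y \<in> Obj C\<rbrakk> \<Longrightarrow> banach_cspace (Hom C x y)"
    and cmp_assoc:
      "\<And>w x y z f g h. \<lbrakk>w \<in> Obj C; x \<in> Obj C; y \<in> Obj C; z \<in> Obj C;
          f \<in> arr C w x; g \<in> arr C x y; h \<in> arr C y z\<rbrakk>
        \<Longrightarrow> Cmp C w x z (Cmp C x y z h g) f = Cmp C w y z h (Cmp C w x y g f)"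
    and cmp_linear_right:
      "\<And>x y z g. \<lbrakk>x \<in> Obj C; y \<in> Obj C; z \<in> Obj C; g \<in> arr C y z\<rbrakk>
        \<Longrightarrow> linear_on (Hom C x y) (Hom C x z) (\<lambda>f. Cmp C x y z g f)"
    and cmp_linear_left:
      "\<And>x y z f. \<lbrakk>x \<in> Obj C; y \<in> Obj C; z \<in> Obj C; f \<in> arr C x y\<rbrakk>
        \<Longrightarrow> linear_on (Hom C y z) (Hom C x z) (\<lambda>g. Cmp C x y z g f)"
    and nrm_cmp:
      "\<And>x y z f g. \<lbrakk>x \<in> Obj C; y \<in> Obj C; z \<in> Obj C; f \<in> arr C x y; g \<in> arr C y z\<rbrakk>
        \<Longrightarrow> nrm (Hom C x z) (Cmp C x y z g f) \<le> nrm (Hom C y z) g * nrm (Hom C x y) f"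
    and star_conj_linear:
      "\<And>x y. \<lbrakk>x \<in> Obj C; y \<in> Obj C\<rbrakk> \<Longrightarrow> conj_linear_on (Hom C x y) (Hom C y x) (Star C x y)"
    and star_star:
      "\<And>x y f. \<lbrakk>x \<in> Obj C; y \<in> Obj C; f \<in> arr C x y\<rbrakk> \<Longrightarrow> Star C y x (Star C x y f) = f"
    and star_cmp:
      "\<And>x y z f g. \<lbrakk>x \<in> Obj C; y \<in> Obj C; z \<in> Obj C; f \<in> arr C x y; g \<in> arr C y z\<rbrakk>
        \<Longrightarrow> Star C x z (Cmp C x y z g f) = Cmp C z y x (Star C x y f) (Star C y z g)"
    and cstar_identity:
      "\<And>x y a. \<lbrakk>x \<in> Obj C; y \<in> Obj C; a \<in> arr C x y\<rbrakk>
        \<Longrightarrow> nrm (Hom C x x) (Cmp C x y x (Star C x y a) a) = (nrm (Hom C x y) a)\<^sup>2"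
    and spectrum_star_cmp:
      "\<And>x y a. \<lbrakk>x \<in> Obj C; y \<in> Obj C; a \<in> arr C x y\<rbrakk>
        \<Longrightarrow> spectrum C x (Cmp C x y x (Star C x y a) a) \<subseteq> \<real>\<^sub>\<ge>\<^sub>0"

definition is_identity :: "('o, 'm) star_cat \<Rightarrow> 'o \<Rightarrow> 'm \<Rightarrow> bool" where
  "is_identity C x u \<longleftrightarrow>
     u \<in> arr C x x \<and>
     (\<forall>y\<in>Obj C. (\<forall>f\<in>arr C y x. Cmp C y x x u f = f) \<and> (\<forall>f\<in>arr C x y. Cmp C x x y f u = f))"

record ('o, 'm, 'p, 'n) cfunctor =
  fob :: "'o \<Rightarrow> 'p"
  far :: "'o \<Rightarrow> 'o \<Rightarrow> 'm \<Rightarrow> 'n"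

definition cstar_functor ::
  "('o, 'm) star_cat \<Rightarrow> ('p, 'n) star_cat \<Rightarrow> ('o, 'm, 'p, 'n) cfunctor \<Rightarrow> bool" where
  "cstar_functor C D F \<longleftrightarrow>
     (\<forall>x\<in>Obj C. fob F x \<in> Obj D) \<and>
     (\<forall>x\<in>Obj C. \<forall>y\<in>Obj C. linear_on (Hom C x y) (Hom D (fob F x) (fob F y)) (far F x y)) \<and>
     (\<forall>x\<in>Obj C. \<forall>y\<in>Obj C. \<forall>z\<in>Obj C. \<forall>f\<in>arr C x y. \<forall>g\<in>arr C y z.
        far F x z (Cmp C x y z g f) =
        Cmp D (fob F x) (fob F y) (fob F z) (far F y z g) (far F x y f)) \<and>
     (\<forall>x\<in>Obj C. \<forall>y\<in>Obj C. \<forall>f\<in>arr C x y.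
        far F y x (Star C x y f) = Star D (fob F x) (fob F y) (far F x y f))"

definition preserves_identities ::
  "('o, 'm) star_cat \<Rightarrow> ('p, 'n) star_cat \<Rightarrow> ('o, 'm, 'p, 'n) cfunctor \<Rightarrow> bool" where
  "preserves_identities C D F \<longleftrightarrow>
     (\<forall>x\<in>Obj C. \<forall>u. is_identity C x u \<longrightarrow> is_identity D (fob F x) (far F x x u))"

definition functor_comp ::
  "('p, 'n, 'q, 'k) cfunctor \<Rightarrow> ('o, 'm, 'p, 'n) cfunctor \<Rightarrow> ('o, 'm, 'q, 'k) cfunctor" where
  "functor_comp G F = \<lparr>fob = (\<lambda>x. fob G (fob F x)),
                far = (\<lambda>x y f. far G (fob F x) (fob F y) (far F x y f))\<rparr>"


section \<open>Hilbert modules\<close>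

text \<open>
  \<open>Val E x\<close> is the vector space \<open>E(x)\<close>; for \<open>e \<in> E(x)\<close> and \<open>a\<close> from \<open>w\<close> to \<open>x\<close>, \<open>act E w x e a\<close>
  is \<open>e \<cdot> a \<in> E(w)\<close>; for \<open>e \<in> E(y)\<close> and \<open>f \<in> E(x)\<close>, \<open>inn E y x e f\<close>, from \<open>x\<close> to \<open>y\<close>, is their
  inner product.
\<close>

record ('o, 'm, 'e) hmod =
  Val :: "'o \<Rightarrow> 'e cspace"
  act :: "'o \<Rightarrow> 'o \<Rightarrow> 'e \<Rightarrow> 'm \<Rightarrow> 'e"
  inn :: "'o \<Rightarrow> 'o \<Rightarrow> 'e \<Rightarrow> 'e \<Rightarrow> 'm"

abbreviation elts :: "('o, 'm, 'e) hmod \<Rightarrow> 'o \<Rightarrow> 'e set" where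
  "elts E x \<equiv> carrier (Val E x)"

definition mnorm :: "('o, 'm) star_cat \<Rightarrow> ('o, 'm, 'e) hmod \<Rightarrow> 'o \<Rightarrow> 'e \<Rightarrow> real" where
  "mnorm A E x e = sqrt (nrm (Hom A x x) (inn E x x e e))"

locale hilbert_module =
  fixes A :: "('o, 'm) star_cat" and E :: "('o, 'm, 'e) hmod"
  assumes val_space:
      "\<And>x. x \<in> Obj A \<Longrightarrow> complex_space (Val E x)"
    and act_linear_left:
      "\<And>w x a. \<lbrakk>w \<in> Obj A; x \<in> Obj A; a \<in> arr A w x\<rbrakk>
        \<Longrightarrow> linear_on (Val E x) (Val E w) (\<lambda>e. act E w x e a)"
    and act_linear_right:
      "\<And>w x e. \<lbrakk>w \<in> Obj A; x \<in> Obj A; e \<in> elts E x\<rbrakk>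
        \<Longrightarrow> linear_on (Hom A w x) (Val E w) (\<lambda>a. act E w x e a)"
    and act_cmp:
      "\<And>v w x e a b. \<lbrakk>v \<in> Obj A; w \<in> Obj A; x \<in> Obj A; e \<in> elts E x; a \<in> arr A w x; b \<in> arr A v w\<rbrakk>
        \<Longrightarrow> act E v x e (Cmp A v w x a b) = act E v w (act E w x e a) b"
    and inn_linear_right:
      "\<And>x y e. \<lbrakk>x \<in> Obj A; y \<in> Obj A; e \<in> elts E y\<rbrakk>
        \<Longrightarrow> linear_on (Val E x) (Hom A x y) (\<lambda>f. inn E y x e f)"
    and inn_conj_linear_left:
      "\<And>x y f. \<lbrakk>x \<in> Obj A; y \<in> Obj A; f \<in> elts E x\<rbrakk>
        \<Longrightarrow> conj_linear_on (Val E y) (Hom A x y) (\<lambda>e. inn E y x e f)"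
    and inn_star:
      "\<And>x y e f. \<lbrakk>x \<in> Obj A; y \<in> Obj A; e \<in> elts E y; f \<in> elts E x\<rbrakk>
        \<Longrightarrow> inn E y x e f = Star A y x (inn E x y f e)"
    and inn_act:
      "\<And>w x y e f g. \<lbrakk>w \<in> Obj A; x \<in> Obj A; y \<in> Obj A; e \<in> elts E y; f \<in> elts E x; g \<in> arr A w x\<rbrakk>
        \<Longrightarrow> Cmp A w x y (inn E y x e f) g = inn E y w e (act E w x f g)"
    and inn_positive:
      "\<And>x e. \<lbrakk>x \<in> Obj A; e \<in> elts E x\<rbrakk> \<Longrightarrow> positive A x (inn E x x e e)"
    and inn_definite:
      "\<And>x e. \<lbrakk>x \<in> Obj A; e \<in> elts E x; inn E x x e e = \<zero>\<^bsub>Hom A x x\<^esub>\<rbrakk> \<Longrightarrow> e = \<zero>\<^bsub>Val E x\<^esub>"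
    and complete:
      "\<And>x. x \<in> Obj A \<Longrightarrow> complete_in (Val E x) (mnorm A E x)"

text \<open>
  Operators are families of functions indexed by the objects of \<open>A\<close>. They are extensional, i.e.
  \<open>undefined\<close> outside the carriers, so that equality of operators is equality as natural
  transformations. Source and target module may have different element types.
\<close>

definition natural_transf ::
  "('o, 'm) star_cat \<Rightarrow> ('o, 'm, 'e) hmod \<Rightarrow> ('o, 'm, 'f) hmod \<Rightarrow> ('o \<Rightarrow> 'e \<Rightarrow> 'f) \<Rightarrow> bool" where
  "natural_transf A E F T \<longleftrightarrow>
     T \<in> (\<Pi>\<^sub>E x\<in>Obj A. elts E x \<rightarrow>\<^sub>E elts F x) \<and>
     (\<forall>x\<in>Obj A. linear_on (Val E x) (Val F x) (T x)) \<and>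
     (\<forall>w\<in>Obj A. \<forall>x\<in>Obj A. \<forall>e\<in>elts E x. \<forall>a\<in>arr A w x.
        T w (act E w x e a) = act F w x (T x e) a)"

definition is_adjoint ::
  "('o, 'm) star_cat \<Rightarrow> ('o, 'm, 'e) hmod \<Rightarrow> ('o, 'm, 'f) hmod
    \<Rightarrow> ('o \<Rightarrow> 'e \<Rightarrow> 'f) \<Rightarrow> ('o \<Rightarrow> 'f \<Rightarrow> 'e) \<Rightarrow> bool" where
  "is_adjoint A E F T S \<longleftrightarrow>
     natural_transf A F E S \<and>
     (\<forall>x\<in>Obj A. \<forall>y\<in>Obj A. \<forall>e\<in>elts E y. \<forall>f\<in>elts F x. inn F y x (T y e) f = inn E y x e (S x f))"

definition adjoint ::
  "('o, 'm) star_cat \<Rightarrow> ('o, 'm, 'e) hmod \<Rightarrow> ('o, 'm, 'f) hmod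
    \<Rightarrow> ('o \<Rightarrow> 'e \<Rightarrow> 'f) \<Rightarrow> ('o \<Rightarrow> 'f \<Rightarrow> 'e)" where
  "adjoint A E F T = (THE S. is_adjoint A E F T S)"

definition unit_sphere_norms ::
  "('o, 'm) star_cat \<Rightarrow> ('o, 'm, 'e) hmod \<Rightarrow> ('o, 'm, 'f) hmod \<Rightarrow> ('o \<Rightarrow> 'e \<Rightarrow> 'f) \<Rightarrow> real set" where
  "unit_sphere_norms A E F T =
     {mnorm A F x (T x e) | x e. x \<in> Obj A \<and> e \<in> elts E x \<and> mnorm A E x e = 1}"

text \<open>Inserting \<open>0\<close> makes the supremum over the empty set (if \<open>E\<close> is the zero module) equal to \<open>0\<close>.\<close>

definition opnorm ::
  "('o, 'm) star_cat \<Rightarrow> ('o, 'm, 'e) hmod \<Rightarrow> ('o, 'm, 'f) hmod \<Rightarrow> ('o \<Rightarrow> 'e \<Rightarrow> 'f) \<Rightarrow> real" where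
  "opnorm A E F T = Sup (insert 0 (unit_sphere_norms A E F T))"

definition operators ::
  "('o, 'm) star_cat \<Rightarrow> ('o, 'm, 'e) hmod \<Rightarrow> ('o, 'm, 'f) hmod \<Rightarrow> ('o \<Rightarrow> 'e \<Rightarrow> 'f) set" where
  "operators A E F =
     {T. natural_transf A E F T \<and> bdd_above (unit_sphere_norms A E F T) \<and> (\<exists>S. is_adjoint A E F T S)}"

definition operator_space ::
  "('o, 'm) star_cat \<Rightarrow> ('o, 'm, 'e) hmod \<Rightarrow> ('o, 'm, 'f) hmod \<Rightarrow> ('o \<Rightarrow> 'e \<Rightarrow> 'f) normed_cspace" where
  "operator_space A E F =
     \<lparr>carrier = operators A E F, mult = undefined, one = undefined,
      zero = (\<lambda>x\<in>Obj A. \<lambda>e\<in>elts E x. \<zero>\<^bsub>Val F x\<^esub>),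
      add = (\<lambda>S T. \<lambda>x\<in>Obj A. \<lambda>e\<in>elts E x. S x e \<oplus>\<^bsub>Val F x\<^esub> T x e),
      smult = (\<lambda>k T. \<lambda>x\<in>Obj A. \<lambda>e\<in>elts E x. k \<odot>\<^bsub>Val F x\<^esub> T x e),
      nrm = opnorm A E F\<rparr>"

definition op_id :: "('o, 'm) star_cat \<Rightarrow> ('o, 'm, 'e) hmod \<Rightarrow> ('o \<Rightarrow> 'e \<Rightarrow> 'e)" where
  "op_id A E = (\<lambda>x\<in>Obj A. \<lambda>e\<in>elts E x. e)"

definition op_comp ::
  "('o, 'm) star_cat \<Rightarrow> ('o, 'm, 'e) hmod \<Rightarrow> ('o \<Rightarrow> 'f \<Rightarrow> 'g) \<Rightarrow> ('o \<Rightarrow> 'e \<Rightarrow> 'f) \<Rightarrow> ('o \<Rightarrow> 'e \<Rightarrow> 'g)" where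
  "op_comp A E S T = (\<lambda>x\<in>Obj A. \<lambda>e\<in>elts E x. S x (T x e))"

text \<open>
  The category of those Hilbert modules over \<open>A\<close> whose elements lie in the type \<open>'e\<close>, which thus
  plays the role of a universe.
\<close>

definition Hilb :: "('o, 'm) star_cat \<Rightarrow> (('o, 'm, 'e) hmod, 'o \<Rightarrow> 'e \<Rightarrow> 'e) star_cat" where
  "Hilb A =
     \<lparr>Obj = {E. hilbert_module A E},
      Hom = operator_space A,
      Cmp = (\<lambda>E F G S T. op_comp A E S T),
      Star = adjoint A\<rparr>"

definition unitary_op ::
  "('o, 'm) star_cat \<Rightarrow> ('o, 'm, 'e) hmod \<Rightarrow> ('o, 'm, 'f) hmod \<Rightarrow> ('o \<Rightarrow> 'e \<Rightarrow> 'f) \<Rightarrow> bool" where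
  "unitary_op A E F U \<longleftrightarrow>
     U \<in> operators A E F \<and>
     op_comp A E (adjoint A E F U) U = op_id A E \<and>
     op_comp A F U (adjoint A E F U) = op_id A F"


section \<open>The Yoneda embedding\<close>

definition representable :: "('o, 'm) star_cat \<Rightarrow> 'o \<Rightarrow> ('o, 'm, 'm) hmod" where
  "representable A x =
     \<lparr>Val = (\<lambda>y. module.truncate (Hom A y x)),
      act = (\<lambda>w y b a. Cmp A w y x b a),
      inn = (\<lambda>z y a b. Cmp A y x z (Star A z x a) b)\<rparr>"

text \<open>
  A module is renamed along an injection \<open>j\<close> of its element type into another one. This places the
  representable modules, whose elements are morphisms of \<open>A\<close>, in a given universe.
\<close>

definition rename_space :: "('e \<Rightarrow> 'u) \<Rightarrow> 'e cspace \<Rightarrow> 'u cspace" where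
  "rename_space j V =
     \<lparr>carrier = j ` carrier V, mult = undefined, one = undefined, zero = j \<zero>\<^bsub>V\<^esub>,
      add = (\<lambda>u v. j (inv_into UNIV j u \<oplus>\<^bsub>V\<^esub> inv_into UNIV j v)),
      smult = (\<lambda>k v. j (k \<odot>\<^bsub>V\<^esub> inv_into UNIV j v))\<rparr>"

definition rename_module :: "('e \<Rightarrow> 'u) \<Rightarrow> ('o, 'm, 'e) hmod \<Rightarrow> ('o, 'm, 'u) hmod" where
  "rename_module j E =
     \<lparr>Val = (\<lambda>x. rename_space j (Val E x)),
      act = (\<lambda>w x e a. j (act E w x (inv_into UNIV j e) a)),
      inn = (\<lambda>y x e f. inn E y x (inv_into UNIV j e) (inv_into UNIV j f))\<rparr>"

definition yoneda ::
  "('m \<Rightarrow> 'u) \<Rightarrow> ('o, 'm) star_cat \<Rightarrow> ('o, 'm, ('o, 'm, 'u) hmod, 'o \<Rightarrow> 'u \<Rightarrow> 'u) cfunctor" where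
  "yoneda j A =
     \<lparr>fob = (\<lambda>x. rename_module j (representable A x)),
      far = (\<lambda>x y a. \<lambda>z\<in>Obj A. \<lambda>e\<in>j ` arr A z x. j (Cmp A z x y a (inv_into UNIV j e)))\<rparr>"


section \<open>Strong functors\<close>

text \<open>Convergence of a net \<open>f\<close> along a filter \<open>\<Phi>\<close> on its index type.\<close>

definition strong_tendsto ::
  "('o, 'm) star_cat \<Rightarrow> ('o, 'm, 'e) hmod \<Rightarrow> ('o, 'm, 'f) hmod
    \<Rightarrow> ('i \<Rightarrow> 'o \<Rightarrow> 'e \<Rightarrow> 'f) \<Rightarrow> ('o \<Rightarrow> 'e \<Rightarrow> 'f) \<Rightarrow> 'i filter \<Rightarrow> bool" where
  "strong_tendsto A E F f T \<Phi> \<longleftrightarrow>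
     (\<forall>x\<in>Obj A. \<forall>e\<in>elts E x.
        ((\<lambda>i. mnorm A F x (f i x e \<ominus>\<^bsub>Val F x\<^esub> T x e)) \<longlongrightarrow> 0) \<Phi>) \<and>
     (\<forall>x\<in>Obj A. \<forall>e\<in>elts F x.
        ((\<lambda>i. mnorm A E x (adjoint A E F (f i) x e \<ominus>\<^bsub>Val E x\<^esub> adjoint A E F T x e)) \<longlongrightarrow> 0) \<Phi>)"

text \<open>
  A net in \<open>K\<close> induces a filter on the type of operators which contains \<open>K\<close>, namely the image of the
  eventuality filter on its index set. Hence quantifying over the filters \<open>\<Phi> \<le> principal K\<close> amounts to
  quantifying over all nets in \<open>K\<close>.
\<close>

definition strong_functor ::
  "('o, 'm) star_cat \<Rightarrow> ('p, 'n) star_cat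
    \<Rightarrow> (('o, 'm, 'u) hmod, 'o \<Rightarrow> 'u \<Rightarrow> 'u, ('p, 'n, 'v) hmod, 'p \<Rightarrow> 'v \<Rightarrow> 'v) cfunctor \<Rightarrow> bool" where
  "strong_functor A B F \<longleftrightarrow>
     (\<forall>M\<in>Obj (Hilb A). \<forall>N\<in>Obj (Hilb A). \<forall>K. K \<subseteq> operators A M N \<and> (\<exists>c. \<forall>T\<in>K. opnorm A M N T \<le> c) \<longrightarrow>
        (\<forall>T\<in>K. \<forall>\<Phi>. \<Phi> \<le> principal K \<and> strong_tendsto A M N (\<lambda>S. S) T \<Phi> \<longrightarrow>
           strong_tendsto B (fob F M) (fob F N) (far F M N) (far F M N T) \<Phi>))"


section \<open>Tensor product with a bimodule\<close>

subsection \<open>Algebraic tensor product\<close>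

text \<open>
  A right Hilbert \<open>A\<close>-\<open>B\<close> bimodule is a C*-functor \<open>E\<close> from \<open>A\<close> to \<open>Hilb B\<close>. The algebraic tensor
  product at \<open>z\<close> is the free vector space on the triples \<open>(x, m, e)\<close>, which stand for \<open>m \<otimes> e\<close> in the
  summand of index \<open>x\<close>, modulo the span of the bilinearity and balancing relations.
\<close>

type_synonym ('o, 'm, 'p, 'n, 'v) bimodule = "('o, 'm, ('p, 'n, 'v) hmod, 'p \<Rightarrow> 'v \<Rightarrow> 'v) cfunctor"

type_synonym ('o, 'u, 'v) formal = "('o \<times> 'u \<times> 'v) \<Rightarrow>\<^sub>0 complex"

definition fscale :: "complex \<Rightarrow> ('t \<Rightarrow>\<^sub>0 complex) \<Rightarrow> ('t \<Rightarrow>\<^sub>0 complex)" where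
  "fscale k c = Poly_Mapping.map ((*) k) c"

abbreviation pure :: "'o \<Rightarrow> 'u \<Rightarrow> 'v \<Rightarrow> ('o, 'u, 'v) formal" where
  "pure x m e \<equiv> Poly_Mapping.single (x, m, e) 1"

definition formal_tensors ::
  "('o, 'm) star_cat \<Rightarrow> ('o, 'm, 'u) hmod \<Rightarrow> ('o, 'm, 'p, 'n, 'v) bimodule \<Rightarrow> 'p
    \<Rightarrow> ('o, 'u, 'v) formal set" where
  "formal_tensors A M E z =
     {c. Poly_Mapping.keys c \<subseteq> {(x, m, e). x \<in> Obj A \<and> m \<in> elts M x \<and> e \<in> elts (fob E x) z}}"

definition basic_relations ::
  "('o, 'm) star_cat \<Rightarrow> ('o, 'm, 'u) hmod \<Rightarrow> ('o, 'm, 'p, 'n, 'v) bimodule \<Rightarrow> 'p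
    \<Rightarrow> ('o, 'u, 'v) formal set" where
  "basic_relations A M E z =
     {pure x (m \<oplus>\<^bsub>Val M x\<^esub> m') e - pure x m e - pure x m' e | x m m' e.
        x \<in> Obj A \<and> m \<in> elts M x \<and> m' \<in> elts M x \<and> e \<in> elts (fob E x) z}
   \<union> {pure x m (e \<oplus>\<^bsub>Val (fob E x) z\<^esub> e') - pure x m e - pure x m e' | x m e e'.
        x \<in> Obj A \<and> m \<in> elts M x \<and> e \<in> elts (fob E x) z \<and> e' \<in> elts (fob E x) z}
   \<union> {pure x (k \<odot>\<^bsub>Val M x\<^esub> m) e - fscale k (pure x m e) | x k m e.
        x \<in> Obj A \<and> m \<in> elts M x \<and> e \<in> elts (fob E x) z}
   \<union> {pure x m (k \<odot>\<^bsub>Val (fob E x) z\<^esub> e) - fscale k (pure x m e) | x k m e.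
        x \<in> Obj A \<and> m \<in> elts M x \<and> e \<in> elts (fob E x) z}
   \<union> {pure w (act M w x m a) e - pure x m (far E w x a z e) | w x m a e.
        w \<in> Obj A \<and> x \<in> Obj A \<and> m \<in> elts M x \<and> a \<in> arr A w x \<and> e \<in> elts (fob E w) z}"

definition tensor_relations ::
  "('o, 'm) star_cat \<Rightarrow> ('o, 'm, 'u) hmod \<Rightarrow> ('o, 'm, 'p, 'n, 'v) bimodule \<Rightarrow> 'p
    \<Rightarrow> ('o, 'u, 'v) formal set" where
  "tensor_relations A M E z =
     {\<Sum>r\<in>Q. fscale (k r) r | Q k. finite Q \<and> Q \<subseteq> basic_relations A M E z}"

definition tclass ::
  "('o, 'm) star_cat \<Rightarrow> ('o, 'm, 'u) hmod \<Rightarrow> ('o, 'm, 'p, 'n, 'v) bimodule \<Rightarrow> 'p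
    \<Rightarrow> ('o, 'u, 'v) formal \<Rightarrow> ('o, 'u, 'v) formal set" where
  "tclass A M E z c = {d \<in> formal_tensors A M E z. d - c \<in> tensor_relations A M E z}"

definition rep :: "'a set \<Rightarrow> 'a" where
  "rep X = (SOME c. c \<in> X)"

definition formal_act ::
  "('o, 'm, 'p, 'n, 'v) bimodule \<Rightarrow> 'p \<Rightarrow> 'p \<Rightarrow> ('o, 'u, 'v) formal \<Rightarrow> 'n \<Rightarrow> ('o, 'u, 'v) formal" where
  "formal_act E z' z c b =
     (\<Sum>(x, m, e)\<in>Poly_Mapping.keys c.
        fscale (Poly_Mapping.lookup c (x, m, e)) (pure x m (act (fob E x) z' z e b)))"

text \<open>
  The sesquilinear extension of \<open>\<langle>m \<otimes> e, m' \<otimes> e'\<rangle> = \<langle>e, \<langle>m, m'\<rangle> \<cdot> e'\<rangle>\<close>, where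
  \<open>\<langle>m, m'\<rangle>\<close>, from \<open>x'\<close> to \<open>x\<close>, acts from \<open>E(x')\<close> to \<open>E(x)\<close>.
\<close>

definition formal_inn ::
  "('p, 'n) star_cat \<Rightarrow> ('o, 'm, 'u) hmod \<Rightarrow> ('o, 'm, 'p, 'n, 'v) bimodule \<Rightarrow> 'p \<Rightarrow> 'p
    \<Rightarrow> ('o, 'u, 'v) formal \<Rightarrow> ('o, 'u, 'v) formal \<Rightarrow> 'n" where
  "formal_inn B M E z' z c d =
     finsum (Hom B z z')
       (\<lambda>((x, m, e), (x', m', e')).
          (cnj (Poly_Mapping.lookup c (x, m, e)) * Poly_Mapping.lookup d (x', m', e'))
            \<odot>\<^bsub>Hom B z z'\<^esub> inn (fob E x) z' z e (far E x' x (inn M x x' m m') z e'))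
       (Poly_Mapping.keys c \<times> Poly_Mapping.keys d)"

definition alg_tensor ::
  "('o, 'm) star_cat \<Rightarrow> ('p, 'n) star_cat \<Rightarrow> ('o, 'm, 'u) hmod \<Rightarrow> ('o, 'm, 'p, 'n, 'v) bimodule
    \<Rightarrow> ('p, 'n, ('o, 'u, 'v) formal set) hmod" where
  "alg_tensor A B M E =
     \<lparr>Val = (\<lambda>z.
        \<lparr>carrier = tclass A M E z ` formal_tensors A M E z, mult = undefined, one = undefined,
         zero = tclass A M E z 0,
         add = (\<lambda>X Y. tclass A M E z (rep X + rep Y)),
         smult = (\<lambda>k X. tclass A M E z (fscale k (rep X)))\<rparr>),
      act = (\<lambda>z' z X b. tclass A M E z' (formal_act E z' z (rep X) b)),
      inn = (\<lambda>z' z X Y. formal_inn B M E z' z (rep X) (rep Y))\<rparr>"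

definition alg_tensor_op ::
  "('o, 'm) star_cat \<Rightarrow> ('o, 'm, 'u) hmod \<Rightarrow> ('o, 'm, 'p, 'n, 'v) bimodule
    \<Rightarrow> ('o \<Rightarrow> 'u \<Rightarrow> 'u) \<Rightarrow> 'p \<Rightarrow> ('o, 'u, 'v) formal set \<Rightarrow> ('o, 'u, 'v) formal set" where
  "alg_tensor_op A N E T z X =
     tclass A N E z
       (\<Sum>(x, m, e)\<in>Poly_Mapping.keys (rep X).
          fscale (Poly_Mapping.lookup (rep X) (x, m, e)) (pure x (T x m) e))"

subsection \<open>Completion\<close>

text \<open>
  The completion of \<open>P\<close>, which is like a Hilbert module except that its inner product may be degenerate
  and its values need not be complete: Cauchy sequences modulo null sequences.
\<close>

definition cclass ::
  "('p, 'n) star_cat \<Rightarrow> ('p, 'n, 'e) hmod \<Rightarrow> 'p \<Rightarrow> (nat \<Rightarrow> 'e) \<Rightarrow> (nat \<Rightarrow> 'e) set" where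
  "cclass B P z s =
     {t. cauchy_in (Val P z) (mnorm B P z) t \<and> (\<lambda>n. mnorm B P z (t n \<ominus>\<^bsub>Val P z\<^esub> s n)) \<longlonglongrightarrow> 0}"

definition lim_in :: "('a, 'x) normed_cspace_scheme \<Rightarrow> (nat \<Rightarrow> 'a) \<Rightarrow> 'a" where
  "lim_in V s = (THE l. l \<in> carrier V \<and> (\<lambda>n. nrm V (s n \<ominus>\<^bsub>V\<^esub> l)) \<longlonglongrightarrow> 0)"

definition completion ::
  "('p, 'n) star_cat \<Rightarrow> ('p, 'n, 'e) hmod \<Rightarrow> ('p, 'n, (nat \<Rightarrow> 'e) set) hmod" where
  "completion B P =
     \<lparr>Val = (\<lambda>z.
        \<lparr>carrier = cclass B P z ` {s. cauchy_in (Val P z) (mnorm B P z) s},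
         mult = undefined, one = undefined,
         zero = cclass B P z (\<lambda>n. \<zero>\<^bsub>Val P z\<^esub>),
         add = (\<lambda>X Y. cclass B P z (\<lambda>n. rep X n \<oplus>\<^bsub>Val P z\<^esub> rep Y n)),
         smult = (\<lambda>k X. cclass B P z (\<lambda>n. k \<odot>\<^bsub>Val P z\<^esub> rep X n))\<rparr>),
      act = (\<lambda>z' z X b. cclass B P z' (\<lambda>n. act P z' z (rep X n) b)),
      inn = (\<lambda>z' z X Y. lim_in (Hom B z z') (\<lambda>n. inn P z' z (rep X n) (rep Y n)))\<rparr>"

subsection \<open>The tensor product functor\<close>

type_synonym ('o, 'u, 'v) tensor_elt = "(nat \<Rightarrow> ('o, 'u, 'v) formal set) set"

definition tensor ::
  "('o, 'm) star_cat \<Rightarrow> ('p, 'n) star_cat \<Rightarrow> ('o, 'm, 'u) hmod \<Rightarrow> ('o, 'm, 'p, 'n, 'v) bimodule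
    \<Rightarrow> ('p, 'n, ('o, 'u, 'v) tensor_elt) hmod" where
  "tensor A B M E = completion B (alg_tensor A B M E)"

definition tensor_op ::
  "('o, 'm) star_cat \<Rightarrow> ('p, 'n) star_cat \<Rightarrow> ('o, 'm, 'p, 'n, 'v) bimodule
    \<Rightarrow> ('o, 'm, 'u) hmod \<Rightarrow> ('o, 'm, 'u) hmod \<Rightarrow> ('o \<Rightarrow> 'u \<Rightarrow> 'u)
    \<Rightarrow> ('p \<Rightarrow> ('o, 'u, 'v) tensor_elt \<Rightarrow> ('o, 'u, 'v) tensor_elt)" where
  "tensor_op A B E M N T =
     (\<lambda>z\<in>Obj B. \<lambda>X\<in>elts (tensor A B M E) z.
        cclass B (alg_tensor A B N E) z (\<lambda>n. alg_tensor_op A N E T z (rep X n)))"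

definition tensor_functor ::
  "('o, 'm) star_cat \<Rightarrow> ('p, 'n) star_cat \<Rightarrow> ('o, 'm, 'p, 'n, 'v) bimodule
    \<Rightarrow> (('o, 'm, 'u) hmod, 'o \<Rightarrow> 'u \<Rightarrow> 'u,
        ('p, 'n, ('o, 'u, 'v) tensor_elt) hmod,
        'p \<Rightarrow> ('o, 'u, 'v) tensor_elt \<Rightarrow> ('o, 'u, 'v) tensor_elt) cfunctor" where
  "tensor_functor A B E = \<lparr>fob = (\<lambda>M. tensor A B M E), far = tensor_op A B E\<rparr>"

text \<open>
  The functors \<open>G\<close> and \<open>F\<close> may take values in different universes of Hilbert modules over \<open>B\<close>.
\<close>

definition natural_unitary_iso ::
  "('o, 'm) star_cat \<Rightarrow> ('p, 'n) star_cat
    \<Rightarrow> ('o, 'm, ('p, 'n, 'e) hmod, 'p \<Rightarrow> 'e \<Rightarrow> 'e) cfunctor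
    \<Rightarrow> ('o, 'm, ('p, 'n, 'f) hmod, 'p \<Rightarrow> 'f \<Rightarrow> 'f) cfunctor
    \<Rightarrow> ('o \<Rightarrow> 'p \<Rightarrow> 'e \<Rightarrow> 'f) \<Rightarrow> bool" where
  "natural_unitary_iso C B G F \<psi> \<longleftrightarrow>
     cstar_functor C (Hilb B) G \<and>
     cstar_functor C (Hilb B) F \<and>
     (\<forall>x\<in>Obj C. unitary_op B (fob G x) (fob F x) (\<psi> x)) \<and>
     (\<forall>x\<in>Obj C. \<forall>y\<in>Obj C. \<forall>a\<in>arr C x y.
        op_comp B (fob G x) (\<psi> y) (far G x y a) = op_comp B (fob G x) (far F x y a) (\<psi> x))"

end

theory Submission
  imports Defs "HOL-Computational_Algebra.Polynomial"
begin

text \<open>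
  An element \<open>m\<close> of \<open>M(x)\<close> gives an operator \<open>\<theta>\<^sub>m\<close> from the representable module of \<open>x\<close> to \<open>M\<close>,
  and \<open>m \<otimes> e \<mapsto> F(\<theta>\<^sub>m)(e)\<close> preserves inner products because \<open>\<theta>\<^sub>m\<^sup>* \<theta>\<^sub>n\<close> is the image of
  \<open>\<langle>m, n\<rangle>\<close> under the Yoneda embedding. Hence the tensor product is isometric to the closure of
  the image of this map in \<open>F(M)\<close>, and in particular its inner product is positive. The image is dense:
  \<open>(1 + c \<theta>\<^sub>m \<theta>\<^sub>m\<^sup>*)\<^sup>-\<^sup>1\<close> is a self-adjoint contraction which sends \<open>m\<close> to an element of norm
  at most \<open>c\<^sup>-\<^sup>1\<^sup>/\<^sup>2\<close> and differs from 1 by an operator \<open>\<theta>\<^sub>n \<theta>\<^sub>m\<^sup>*\<close>; products of such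
  contractions form a bounded net \<open>v\<close> with \<open>v \<rightarrow> 0\<close> strongly, so \<open>F(v) \<rightarrow> 0\<close> strongly, while
  \<open>f - F(v) f\<close> always lies in the image.

  The only order theory of C*-algebras needed is \<open>\<parallel>p\<parallel> \<le> \<parallel>p + q\<parallel>\<close> for positive \<open>p\<close> and \<open>q\<close>. It is
  derived from the definition of positivity by the spectrum through the C*-seminorms
  \<open>f \<mapsto> \<parallel>f(p)\<parallel>\<close> on polynomials.
\<close>

section \<open>C*-seminorms on polynomials\<close>

text \<open>The obstacle is that strong continuity is only available on bounded sets. Finite sums of
  operators \<open>\<theta>_n \<theta>_m*\<close> may approximate the identity pointwise, but
  without a common bound \<open>F\<close> need not carry the approximation over. Resolvents are
  contractive by construction. Products of them replace one resolvent of a sum: an element once made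
  small stays small under further contractions, so elements can be treated one at a time. The
  categories need not have identities, so 1 is missing both in endomorphism algebras and in
  representable modules. Inverses therefore appear as quasi-inverses, and norms as those of
  multiplication operators. Positivity is only a condition on a spectrum. Its use is confined to a
  single norm inequality, at the price of constants 2 and 6 in the triangle and Cauchy-Schwarz
  inequalities. These are harmless, since they enter only questions of convergence and boundedness;
  exact isometry comes from equality of inner products. The Hilbert module axioms of the completed
  tensor product are not verified on tensors but pulled back along the bijection with the module
  that \<open>F\<close> assigns.\<close>

definition real_poly :: "complex poly \<Rightarrow> bool" where
  "real_poly f \<longleftrightarrow> map_poly cnj f = f"

lemma map_poly_cnj_simps [simp]:
  "map_poly cnj (f + g) = map_poly cnj f + map_poly cnj g"
  "map_poly cnj (f - g) = map_poly cnj f - map_poly cnj g"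
  "map_poly cnj (f * g) = map_poly cnj f * map_poly cnj g"
  "map_poly cnj (Polynomial.smult c f) = Polynomial.smult (cnj c) (map_poly cnj f)"
  "map_poly cnj 1 = 1"
  "map_poly cnj 0 = 0"
  "map_poly cnj (pCons c f) = pCons (cnj c) (map_poly cnj f)"
  "map_poly cnj (map_poly cnj f) = f"
proof -
  show add: "map_poly cnj (f + g) = map_poly cnj f + map_poly cnj g" for f g
    by (rule poly_eqI) (simp add: coeff_map_poly)
  show "map_poly cnj (f - g) = map_poly cnj f - map_poly cnj g"
    by (rule poly_eqI) (simp add: coeff_map_poly)
  show smult: "map_poly cnj (Polynomial.smult c f) = Polynomial.smult (cnj c) (map_poly cnj f)" for c f
    by (rule poly_eqI) (simp add: coeff_map_poly)
  show pC: "map_poly cnj (pCons c f) = pCons (cnj c) (map_poly cnj f)" for c f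
    by (rule poly_eqI) (simp add: coeff_map_poly coeff_pCons split: nat.split)
  show "map_poly cnj (f * g) = map_poly cnj f * map_poly cnj g"
    by (induction f rule: pCons_induct) (simp_all add: add smult pC)
  show "map_poly cnj 1 = 1" by (rule poly_eqI) (simp add: coeff_map_poly)
  show "map_poly cnj (map_poly cnj f) = f"
    by (rule poly_eqI) (simp add: coeff_map_poly)
qed simp

lemma real_poly_simps [simp]:
  "real_poly 1"
  "real_poly f \<Longrightarrow> real_poly g \<Longrightarrow> real_poly (f + g)"
  "real_poly f \<Longrightarrow> real_poly g \<Longrightarrow> real_poly (f - g)"
  "real_poly f \<Longrightarrow> real_poly g \<Longrightarrow> real_poly (f * g)"
  "real_poly f \<Longrightarrow> real_poly (Polynomial.smult (complex_of_real r) f)"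
  "real_poly [:complex_of_real r, complex_of_real s:]"
  by (simp_all add: real_poly_def)

lemma real_poly_power [simp]: "real_poly f \<Longrightarrow> real_poly (f ^ n)"
  by (induction n) simp_all

lemma real_poly_prod [simp]: "(\<And>j. j \<in> J \<Longrightarrow> real_poly (f j)) \<Longrightarrow> real_poly (\<Prod>j\<in>J. f j)"
  by (induction J rule: infinite_finite_induct) simp_all

text \<open>The involution is conjugation of coefficients because the variable stands for a
  self-adjoint element. \<open>N_star\<close> is one half of the C*-identity; the other half follows
  from \<open>N_mult\<close> and \<open>N_cnj\<close>. \<open>N 1\<close> may be 0, as it is over a
  zero endomorphism algebra.\<close>

locale poly_cstar_seminorm =
  fixes N :: "complex poly \<Rightarrow> real"
  assumes N_nonneg: "0 \<le> N f"
    and N_add: "N (f + g) \<le> N f + N g"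
    and N_mult: "N (f * g) \<le> N f * N g"
    and N_smult: "N (Polynomial.smult c f) = cmod c * N f"
    and N_star: "(N f)\<^sup>2 \<le> N (map_poly cnj f * f)"
    and N_one: "N 1 \<le> 1"
begin

lemma N_minus: "N (- f) = N f"
  using N_smult[of "-1" f] by simp

lemma N_diff: "N (f - g) \<le> N f + N g"
  using N_add[of f "- g"] N_minus[of g] by simp

lemma N_cnj_le: "N f \<le> N (map_poly cnj f)"
proof (cases "N f = 0")
  case False
  have "N f * N f \<le> N (map_poly cnj f) * N f"
    using N_star[of f] N_mult[of "map_poly cnj f" f] by (simp add: power2_eq_square)
  then show ?thesis using False N_nonneg[of f] by simp
qed (simp add: N_nonneg)

lemma N_cnj: "N (map_poly cnj f) = N f"
  using N_cnj_le[of f] N_cnj_le[of "map_poly cnj f"] by simp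

lemma N_square: "real_poly f \<Longrightarrow> N (f * f) = (N f)\<^sup>2"
  using N_star[of f] N_mult[of f f] by (simp add: real_poly_def power2_eq_square)

text \<open>The C*-identity controls squares of self-adjoint elements only, hence the powers of two
  as exponents.\<close>

lemma N_power2_power: "real_poly h \<Longrightarrow> N h = 1 \<Longrightarrow> N (h ^ (2 ^ m)) = 1"
  by (induction m) (simp_all add: N_square power_add mult_2)

text \<open>\<open>k\<close> is the imaginary part of \<open>s + \<i> k\<close>, whose squared modulus is \<open>s\<^sup>2 + k\<^sup>2\<close>.\<close>

lemma N_sum_squares:
  assumes "real_poly s" "real_poly k"
  shows "(N k)\<^sup>2 \<le> N (s * s + k * k)"
proof -
  define g where "g = s + Polynomial.smult \<i> k"
  have cg: "map_poly cnj g = s - Polynomial.smult \<i> k"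
    using assms by (simp add: g_def real_poly_def)
  have mult: "map_poly cnj g * g = s * s + k * k"
    unfolding cg by (simp add: g_def algebra_simps)
  have "Polynomial.smult (2 * \<i>) k = g - map_poly cnj g"
    unfolding cg by (simp add: g_def flip: smult_add_left)
  then have "2 * N k \<le> 2 * N g"
    using N_smult[of "2 * \<i>" k] N_diff[of g "map_poly cnj g"] N_cnj[of g] by (simp add: norm_mult)
  then have "(N k)\<^sup>2 \<le> (N g)\<^sup>2"
    using N_nonneg by (intro power_mono) auto
  also have "\<dots> \<le> N (map_poly cnj g * g)" by (rule N_star)
  finally show ?thesis unfolding mult .
qed

text \<open>(1 - e^2)^2 + (2 e)^2 = (1 + e^2)^2, multiplied by x^2. \<open>N_sum_squares\<close>
  discards the first square and \<open>N_square\<close> takes the root on the right. This replaces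
  the scalar inequality 2 e \<le> 1 + e^2.\<close>

lemma N_arith_geo:
  assumes "real_poly x" "real_poly e"
  shows "2 * N (x * e) \<le> N (x * (1 + e * e))"
proof -
  have "(2 * N (x * e))\<^sup>2 = (N (Polynomial.smult 2 (x * e)))\<^sup>2"
    by (simp add: N_smult)
  also have "\<dots> \<le> N ((x * (1 - e * e)) * (x * (1 - e * e)) + Polynomial.smult 2 (x * e) * Polynomial.smult 2 (x * e))"
  proof (rule N_sum_squares)
    have "real_poly (Polynomial.smult (complex_of_real 2) (x * e))"
      using assms by (intro real_poly_simps) auto
    then show "real_poly (Polynomial.smult 2 (x * e))" by simp
  qed (use assms in auto)
  also have "(x * (1 - e * e)) * (x * (1 - e * e)) + Polynomial.smult 2 (x * e) * Polynomial.smult 2 (x * e)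
      = (x * (1 + e * e)) * (x * (1 + e * e))"
  proof -
    have s: "Polynomial.smult 2 f = f + f" for f :: "complex poly"
      using smult_add_left[of 1 1 f] by simp
    show ?thesis unfolding s by (simp add: algebra_simps)
  qed
  also have "N \<dots> = (N (x * (1 + e * e)))\<^sup>2"
    using assms by (intro N_square) auto
  finally show ?thesis
    using N_nonneg power2_le_imp_le by blast
qed

section \<open>Doubling products and the norm as spectral radius\<close>

definition sq_prod :: "complex poly \<Rightarrow> nat \<Rightarrow> complex poly" where
  "sq_prod h m = (\<Prod>j<m. 1 + h ^ (2 ^ Suc j))"

lemma sq_prod_telescope: "(1 - h * h) * sq_prod h m = 1 - h ^ (2 ^ Suc m)"
proof (induction m)
  case (Suc m)
  have "(1 - h * h) * sq_prod h (Suc m) = ((1 - h * h) * sq_prod h m) * (1 + h ^ (2 ^ Suc m))"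
    by (simp add: sq_prod_def algebra_simps)
  also have "\<dots> = 1 - h ^ (2 ^ Suc m) * h ^ (2 ^ Suc m)"
    unfolding Suc by (simp add: algebra_simps)
  finally show ?case by (simp add: power_add mult_2)
qed (simp add: sq_prod_def power2_eq_square)

text \<open>Every factor is 1 + e e with \<open>e = h ^ (2 ^ j)\<close>, so
  \<open>N_arith_geo\<close> trades it for 2 e; the exponents 1 + 2 + 4 + ... add up to 2^m - 1. The
  multiplier \<open>x\<close> is general because the induction step absorbs e into it.\<close>

lemma N_sq_prod_ge:
  assumes "real_poly x" "real_poly h"
  shows "2 ^ m * N (x * h ^ (2 ^ m - 1)) \<le> N (x * sq_prod h m)"
  using assms(1)
proof (induction m arbitrary: x)
  case (Suc m)
  define e where "e = h ^ (2 ^ m)"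
  have ee: "h ^ (2 ^ Suc m) = e * e"
    by (simp add: e_def power_add mult_2)
  have "2 ^ Suc m * N (x * h ^ (2 ^ Suc m - 1)) = 2 * (2 ^ m * N ((x * e) * h ^ (2 ^ m - 1)))"
  proof -
    have "(2::nat) ^ Suc m - 1 = 2 ^ m + (2 ^ m - 1)" by simp
    then have "x * h ^ (2 ^ Suc m - 1) = (x * e) * h ^ (2 ^ m - 1)"
      by (simp only: e_def power_add mult.assoc)
    then show ?thesis by (simp only: power_Suc mult.assoc)
  qed
  also have "\<dots> \<le> 2 * N ((x * e) * sq_prod h m)"
    using Suc.IH[of "x * e"] Suc.prems assms(2) by (simp add: e_def)
  also have "(x * e) * sq_prod h m = (x * sq_prod h m) * e" by simp
  also have "2 * N ((x * sq_prod h m) * e) \<le> N ((x * sq_prod h m) * (1 + e * e))"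
    using Suc.prems assms(2) by (intro N_arith_geo) (auto simp: e_def sq_prod_def)
  also have "(x * sq_prod h m) * (1 + e * e) = x * sq_prod h (Suc m)"
    by (simp add: sq_prod_def ee[symmetric] mult.assoc)
  finally show ?case .
qed (simp add: sq_prod_def)

text \<open>
  This says that the spectral radius of a self-adjoint element equals its norm: if \<open>1 - h\<^sup>2\<close> were
  invertible up to an error smaller than 1, the products \<open>\<Prod>j<m. 1 + h^(2^(j+1))\<close>, which
  telescope when multiplied by \<open>1 - h\<^sup>2\<close>, would be bounded; but their norm is at least \<open>2^m\<close>.
\<close>

lemma not_approx_invertible:
  assumes h: "real_poly h" "N h = 1" and K: "0 \<le> K" and \<epsilon>: "\<epsilon> < 1"
    and bound: "\<And>f. N f \<le> K * N ((1 - h * h) * f) + \<epsilon> * N f"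
  shows False
proof -
  have lower: "2 ^ m \<le> N (sq_prod h m)" for m
  proof -
    \<comment> \<open>The exponent 2^m - 1 left by \<open>N_sq_prod_ge\<close> is one short of the
      power whose norm is known; multiplication by \<open>h\<close>, of norm 1, bridges the
      gap.\<close>
    have "1 = N (h ^ (2 ^ m - 1) * h)"
      using N_power2_power[OF h, of m] power_minus_mult[of "2 ^ m" h] by simp
    also have "\<dots> \<le> N (h ^ (2 ^ m - 1))"
      using N_mult[of "h ^ (2 ^ m - 1)" h] h by simp
    finally have "2 ^ m \<le> 2 ^ m * N (1 * h ^ (2 ^ m - 1))" by simp
    also have "\<dots> \<le> N (1 * sq_prod h m)" by (rule N_sq_prod_ge) (use h in auto)
    finally show ?thesis by simp
  qed
  have upper: "(1 - \<epsilon>) * N (sq_prod h m) \<le> K * 2" for m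
  proof -
    have "N ((1 - h * h) * sq_prod h m) \<le> 2"
      unfolding sq_prod_telescope using N_diff[of 1 "h ^ (2 ^ Suc m)"] N_power2_power[OF h, of "Suc m"] N_one
      by simp
    then have "K * N ((1 - h * h) * sq_prod h m) \<le> K * 2"
      using K by (rule mult_left_mono)
    then show ?thesis using bound[of "sq_prod h m"] by (simp add: algebra_simps)
  qed
  obtain m where m: "K * 2 / (1 - \<epsilon>) < 2 ^ m"
    using real_arch_pow[of 2 "K * 2 / (1 - \<epsilon>)"] by auto
  have "N (sq_prod h m) \<le> K * 2 / (1 - \<epsilon>)"
    using upper[of m] \<epsilon> by (simp add: field_simps)
  with m lower[of m] show False by linarith
qed

lemma one_minus_square:
  fixes n :: complex
  assumes "n \<noteq> 0"
  shows "Polynomial.smult (n\<^sup>2) (1 - Polynomial.smult (1/n) h * Polynomial.smult (1/n) h) = ([:n:] - h) * ([:n:] + h)"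
  \<comment> \<open>Polynomials over an infinite field agree once all their values do.\<close>
  by (subst poly_eq_poly_eq_iff[symmetric], rule ext)
     (use assms in \<open>simp add: field_simps power2_eq_square\<close>)

text \<open>The two factors of n^2 - g^2 enter differently. The factor \<open>a\<close> is bounded
  below by assumption. The factor \<open>b\<close> is a scalar minus something smaller and would be
  inverted by a Neumann series, for which polynomials lack completeness; its defect is carried along
  as the error \<open>N y / r\<close> that \<open>not_approx_invertible\<close> tolerates.\<close>

lemma no_spectral_gap:
  assumes g: "real_poly g" and n: "0 < N g" and K: "0 \<le> K" "\<And>f. N f \<le> K * N (a * f)"
    and ab: "a * b = ([:complex_of_real (N g):] - g) * ([:complex_of_real (N g):] + g)"
    and b: "b = [:complex_of_real r:] - y" and y: "N y < r"
  shows False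
proof -
  let ?n = "complex_of_real (N g)"
  define h where "h = Polynomial.smult (1 / ?n) g"
  have r: "0 < r" using y N_nonneg[of y] by simp
  have "real_poly (Polynomial.smult (complex_of_real (1 / N g)) g)"
    using g by (rule real_poly_simps)
  then have h: "real_poly h" by (simp add: h_def)
  show False
  \<comment> \<open>Both constants come from r f = b f + y f: the first term is bounded through a b
    f = n^2 (1 - h^2) f, and the second is the error.\<close>
  proof (rule not_approx_invertible[OF h, of "K * (N g)\<^sup>2 / r" "N y / r"])
    show "N h = 1" using n by (simp add: h_def N_smult norm_divide)
    show "0 \<le> K * (N g)\<^sup>2 / r" "N y / r < 1" using K r y by simp_all
    fix f
    have "a * (b * f) = Polynomial.smult (?n\<^sup>2) ((1 - h * h) * f)"
      using one_minus_square[of ?n g] n by (simp add: h_def ab mult.assoc[symmetric] flip: mult_smult_left)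
    then have 1: "N (a * (b * f)) = (N g)\<^sup>2 * N ((1 - h * h) * f)"
      by (simp add: N_smult norm_power)
    have "Polynomial.smult (complex_of_real r) f = b * f + y * f"
      by (simp add: b algebra_simps)
    then have "r * N f \<le> N (b * f) + N (y * f)"
      using N_smult[of "complex_of_real r" f] N_add[of "b * f" "y * f"] r by simp
    also have "\<dots> \<le> K * ((N g)\<^sup>2 * N ((1 - h * h) * f)) + N y * N f"
      using K(2)[of "b * f"] N_mult[of y f] unfolding 1 by linarith
    finally have "N f \<le> (K * ((N g)\<^sup>2 * N ((1 - h * h) * f)) + N y * N f) / r"
      using r by (simp add: pos_le_divide_eq mult.commute)
    then show "N f \<le> K * (N g)\<^sup>2 / r * N ((1 - h * h) * f) + N y / r * N f"
      by (simp add: add_divide_distrib)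
  qed
qed

text \<open>
  The assumption \<open>inv\<close> makes the variable behave like an element with nonnegative spectrum.
\<close>

context
  assumes inv: "\<And>s. 0 < s \<Longrightarrow> \<exists>K\<ge>0. \<forall>f. N f \<le> K * N ([:complex_of_real s, 1:] * f)"
begin

text \<open>Let X be the variable, g = t - X and n = \<open>N g\<close>, and suppose n > t. Then n -
  g = (n - t) + X is bounded below by \<open>inv\<close>, while n + g = (n + t) - X is a scalar
  minus something of norm at most t, so \<open>no_spectral_gap\<close> applies.\<close>

lemma N_shift_le:
  assumes t: "N [:0, 1:] \<le> t"
  shows "N [:complex_of_real t, -1:] \<le> t"
proof (rule ccontr)
  define g where "g = [:complex_of_real t, -1:]"
  assume "\<not> N [:complex_of_real t, -1:] \<le> t"
  then have nt: "N g > t" by (simp add: g_def)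
  have n0: "0 < N g" using nt t N_nonneg[of "[:0,1:]"] by linarith
  obtain K where K: "0 \<le> K" "\<And>f. N f \<le> K * N ([:complex_of_real (N g - t), 1:] * f)"
    using inv[of "N g - t"] nt by auto
  show False
  proof (rule no_spectral_gap[of g K _ "[:complex_of_real (N g + t), -1:]" "N g + t" "[:0, 1:]", OF _ n0 K])
    have "real_poly [:complex_of_real t, complex_of_real (- 1):]" by (rule real_poly_simps)
    then show "real_poly g" by (simp add: g_def)
    show "[:complex_of_real (N g - t), 1:] * [:complex_of_real (N g + t), - 1:]
        = ([:complex_of_real (N g):] - g) * ([:complex_of_real (N g):] + g)"
      by (simp add: g_def algebra_simps)
  qed (use t n0 in auto)
qed

text \<open>Here g is the variable X and n = \<open>N g\<close>. The factor n + X is bounded below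
  by \<open>inv\<close>; if the claim failed, n - X = (n + T) - (T + X) would be a scalar minus
  something smaller.\<close>

lemma N_shift_ge:
  assumes n0: "N [:0, 1:] > 0" and T: "0 \<le> T"
  shows "N [:0, 1:] + T \<le> N [:complex_of_real T, 1:]"
proof (rule ccontr)
  let ?X = "[:0, 1:] :: complex poly"
  assume "\<not> N ?X + T \<le> N [:complex_of_real T, 1:]"
  then have y: "N [:complex_of_real T, 1:] < N ?X + T" by simp
  obtain K where K: "0 \<le> K" "\<And>f. N f \<le> K * N ([:complex_of_real (N ?X), 1:] * f)"
    using inv[OF n0] by auto
  show False
  proof (rule no_spectral_gap[OF _ n0 K _ _ y])
    have "real_poly [:complex_of_real 0, complex_of_real 1:]" by (rule real_poly_simps)
    then show "real_poly ?X" by simp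
  qed auto
qed

end

end

section \<open>Vector spaces with explicit carriers\<close>

lemma complex_field_simps [simp]:
  "carrier complex_field = UNIV" "a \<otimes>\<^bsub>complex_field\<^esub> b = a * b" "\<one>\<^bsub>complex_field\<^esub> = 1"
  "\<zero>\<^bsub>complex_field\<^esub> = 0" "a \<oplus>\<^bsub>complex_field\<^esub> b = a + b"
  by (simp_all add: complex_field_def)

lemma complex_field_uminus [simp]: "\<ominus>\<^bsub>complex_field\<^esub> a = - a"
proof -
  interpret cring complex_field by (rule cring_complex_field)
  show ?thesis by (rule minus_equality) auto
qed

context
  fixes V :: "(complex, 'a, 'x) module_scheme"
  assumes V: "complex_space V"
begin

interpretation module complex_field V by (rule V)

lemma cs_closed [simp, intro]:
  "\<zero>\<^bsub>V\<^esub> \<in> carrier V"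
  "u \<in> carrier V \<Longrightarrow> v \<in> carrier V \<Longrightarrow> u \<oplus>\<^bsub>V\<^esub> v \<in> carrier V"
  "u \<in> carrier V \<Longrightarrow> v \<in> carrier V \<Longrightarrow> u \<ominus>\<^bsub>V\<^esub> v \<in> carrier V"
  "u \<in> carrier V \<Longrightarrow> \<ominus>\<^bsub>V\<^esub> u \<in> carrier V"
  "u \<in> carrier V \<Longrightarrow> k \<odot>\<^bsub>V\<^esub> u \<in> carrier V"
  by auto

lemma cs_smult:
  "u \<in> carrier V \<Longrightarrow> v \<in> carrier V \<Longrightarrow> k \<odot>\<^bsub>V\<^esub> (u \<oplus>\<^bsub>V\<^esub> v) = k \<odot>\<^bsub>V\<^esub> u \<oplus>\<^bsub>V\<^esub> k \<odot>\<^bsub>V\<^esub> v"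
  "u \<in> carrier V \<Longrightarrow> (k + l) \<odot>\<^bsub>V\<^esub> u = k \<odot>\<^bsub>V\<^esub> u \<oplus>\<^bsub>V\<^esub> l \<odot>\<^bsub>V\<^esub> u"
  "u \<in> carrier V \<Longrightarrow> (k * l) \<odot>\<^bsub>V\<^esub> u = k \<odot>\<^bsub>V\<^esub> (l \<odot>\<^bsub>V\<^esub> u)"
  "u \<in> carrier V \<Longrightarrow> 1 \<odot>\<^bsub>V\<^esub> u = u"
  "u \<in> carrier V \<Longrightarrow> 0 \<odot>\<^bsub>V\<^esub> u = \<zero>\<^bsub>V\<^esub>"
  "k \<odot>\<^bsub>V\<^esub> \<zero>\<^bsub>V\<^esub> = \<zero>\<^bsub>V\<^esub>"
  using smult_r_distr[of k u v] smult_l_distr[of k l u] smult_assoc1[of k l u] smult_one[of u]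
    smult_l_null[of u] smult_r_null[of k]
  by simp_all

lemma cs_uminus: "u \<in> carrier V \<Longrightarrow> \<ominus>\<^bsub>V\<^esub> u = (-1) \<odot>\<^bsub>V\<^esub> u"
  using smult_l_minus[of 1 u] smult_one[of u] by simp

lemma cs_minus: "u \<in> carrier V \<Longrightarrow> v \<in> carrier V \<Longrightarrow> u \<ominus>\<^bsub>V\<^esub> v = u \<oplus>\<^bsub>V\<^esub> (-1) \<odot>\<^bsub>V\<^esub> v"
  by (simp add: a_minus_def cs_uminus)

lemma cs_minus_eq_zero: "u \<in> carrier V \<Longrightarrow> v \<in> carrier V \<Longrightarrow> u \<ominus>\<^bsub>V\<^esub> v = \<zero>\<^bsub>V\<^esub> \<longleftrightarrow> u = v"
  using add.inv_solve_right'[of "\<zero>\<^bsub>V\<^esub>" u v] by (auto simp: a_minus_def r_neg a_inv_def)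

end

subsection \<open>Evaluation of formal linear combinations\<close>

text \<open>The linear map on the free space over \<open>'t\<close> that extends
  \<open>g\<close>.\<close>

definition ev :: "(complex, 'a, 'x) module_scheme \<Rightarrow> ('t \<Rightarrow> 'a) \<Rightarrow> ('t \<Rightarrow>\<^sub>0 complex) \<Rightarrow> 'a" where
  "ev V g c = finsum V (\<lambda>t. Poly_Mapping.lookup c t \<odot>\<^bsub>V\<^esub> g t) (Poly_Mapping.keys c)"

lemma lookup_fscale [simp]: "Poly_Mapping.lookup (fscale k c) t = k * Poly_Mapping.lookup c t"
  by (simp add: fscale_def Poly_Mapping.map.rep_eq when_def)

lemma keys_fscale: "Poly_Mapping.keys (fscale k c) \<subseteq> Poly_Mapping.keys c"
  by (auto simp: in_keys_iff)

lemma fscale_simps: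
  "fscale k (c + d) = fscale k c + fscale k d"
  "fscale k (c - d) = fscale k c - fscale k d"
  "fscale (k + l) c = fscale k c + fscale l c"
  "fscale (k * l) c = fscale k (fscale l c)"
  "fscale 1 c = c" "fscale 0 c = 0" "fscale k 0 = 0" "fscale (-1) c = - c"
  "fscale k (Poly_Mapping.single t l) = Poly_Mapping.single t (k * l)"
  by (auto intro!: poly_mapping_eqI simp: lookup_add lookup_minus algebra_simps lookup_single when_def)

lemma vector_space_fscale: "vector_space (fscale :: complex \<Rightarrow> ('t \<Rightarrow>\<^sub>0 complex) \<Rightarrow> _)"
  by unfold_locales (simp_all add: fscale_simps)

context
  fixes V :: "(complex, 'a, 'x) module_scheme" and g :: "'t \<Rightarrow> 'a" and S :: "'t set"
  assumes V: "complex_space V" and g: "g \<in> S \<rightarrow> carrier V"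
begin

interpretation module complex_field V by (rule V)

lemma ev_superset:
  assumes "finite K" "Poly_Mapping.keys c \<subseteq> K" "K \<subseteq> S"
  shows "ev V g c = finsum V (\<lambda>t. Poly_Mapping.lookup c t \<odot>\<^bsub>V\<^esub> g t) K"
  unfolding ev_def
proof (rule add.finprod_mono_neutral_cong_left)
  show "(\<lambda>t. Poly_Mapping.lookup c t \<odot>\<^bsub>V\<^esub> g t) \<in> K \<rightarrow> carrier V"
    using V g assms by (auto simp: Pi_iff subset_iff)
  show "\<And>i. i \<in> K - Poly_Mapping.keys c \<Longrightarrow> Poly_Mapping.lookup c i \<odot>\<^bsub>V\<^esub> g i = \<zero>\<^bsub>V\<^esub>"
    using V g assms by (auto simp: in_keys_iff cs_smult Pi_iff subset_iff)
qed (use assms in auto)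

lemma ev_closed [simp]: "Poly_Mapping.keys c \<subseteq> S \<Longrightarrow> ev V g c \<in> carrier V"
  unfolding ev_def using V g by (intro finsum_closed) (auto simp: Pi_iff subset_iff)

lemma ev_zero [simp]: "ev V g 0 = \<zero>\<^bsub>V\<^esub>"
  by (simp add: ev_def)

lemma ev_single: "t \<in> S \<Longrightarrow> ev V g (Poly_Mapping.single t k) = k \<odot>\<^bsub>V\<^esub> g t"
  using V g by (cases "k = 0") (auto simp: ev_def cs_smult Pi_iff)

lemma ev_add:
  assumes "Poly_Mapping.keys c \<subseteq> S" "Poly_Mapping.keys d \<subseteq> S"
  shows "ev V g (c + d) = ev V g c \<oplus>\<^bsub>V\<^esub> ev V g d"
proof -
  let ?K = "Poly_Mapping.keys c \<union> Poly_Mapping.keys d"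
  have K: "finite ?K" "?K \<subseteq> S" "Poly_Mapping.keys (c + d) \<subseteq> ?K"
    using assms Poly_Mapping.keys_add[of c d] by auto
  have "ev V g (c + d) = finsum V (\<lambda>t. Poly_Mapping.lookup c t \<odot>\<^bsub>V\<^esub> g t \<oplus>\<^bsub>V\<^esub> Poly_Mapping.lookup d t \<odot>\<^bsub>V\<^esub> g t) ?K"
    unfolding ev_superset[OF K(1,3,2)] using V g K(2)
    by (intro finsum_cong') (auto simp: lookup_add cs_smult Pi_iff subset_iff)
  also have "\<dots> = ev V g c \<oplus>\<^bsub>V\<^esub> ev V g d"
    using K(1,2) V g by (subst (1 2) ev_superset[of ?K]) (auto intro!: finsum_addf simp: Pi_iff subset_iff)
  finally show ?thesis .
qed

lemma ev_fscale:
  assumes "Poly_Mapping.keys c \<subseteq> S"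
  shows "ev V g (fscale k c) = k \<odot>\<^bsub>V\<^esub> ev V g c"
proof -
  have "ev V g (fscale k c) = finsum V (\<lambda>t. Poly_Mapping.lookup (fscale k c) t \<odot>\<^bsub>V\<^esub> g t) (Poly_Mapping.keys c)"
    using assms by (intro ev_superset) (auto simp: keys_fscale)
  also have "\<dots> = finsum V (\<lambda>t. k \<odot>\<^bsub>V\<^esub> (Poly_Mapping.lookup c t \<odot>\<^bsub>V\<^esub> g t)) (Poly_Mapping.keys c)"
    using V g assms by (intro finsum_cong') (auto simp: cs_smult Pi_iff subset_iff)
  also have "\<dots> = k \<odot>\<^bsub>V\<^esub> ev V g c"
    unfolding ev_def using V g assms by (intro finsum_smult_ldistr[symmetric]) (auto simp: Pi_iff subset_iff)
  finally show ?thesis .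
qed

lemma ev_diff:
  assumes "Poly_Mapping.keys c \<subseteq> S" "Poly_Mapping.keys d \<subseteq> S"
  shows "ev V g (c - d) = ev V g c \<ominus>\<^bsub>V\<^esub> ev V g d"
proof -
  have "ev V g (c + fscale (-1) d) = ev V g c \<ominus>\<^bsub>V\<^esub> ev V g d"
    using assms keys_fscale[of "-1" d]
    by (subst ev_add) (auto simp: ev_fscale cs_minus[OF V])
  then show ?thesis by (simp add: fscale_simps)
qed

end

subsection \<open>Separating functionals\<close>

definition functional_on :: "(complex, 'a, 'x) module_scheme \<Rightarrow> ('a \<Rightarrow> complex) \<Rightarrow> bool" where
  "functional_on V \<phi> \<longleftrightarrow>
     (\<forall>u\<in>carrier V. \<forall>v\<in>carrier V. \<phi> (u \<oplus>\<^bsub>V\<^esub> v) = \<phi> u + \<phi> v) \<and>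
     (\<forall>k. \<forall>v\<in>carrier V. \<phi> (k \<odot>\<^bsub>V\<^esub> v) = k * \<phi> v)"

lemma functional_simps:
  assumes "functional_on V \<phi>" "complex_space V"
  shows "u \<in> carrier V \<Longrightarrow> v \<in> carrier V \<Longrightarrow> \<phi> (u \<oplus>\<^bsub>V\<^esub> v) = \<phi> u + \<phi> v"
    and "v \<in> carrier V \<Longrightarrow> \<phi> (k \<odot>\<^bsub>V\<^esub> v) = k * \<phi> v"
    and "u \<in> carrier V \<Longrightarrow> v \<in> carrier V \<Longrightarrow> \<phi> (u \<ominus>\<^bsub>V\<^esub> v) = \<phi> u - \<phi> v"
    and "u \<in> carrier V \<Longrightarrow> \<phi> (\<ominus>\<^bsub>V\<^esub> u) = - \<phi> u"
    and "\<phi> \<zero>\<^bsub>V\<^esub> = 0"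
proof -
  show *: "\<phi> (u \<oplus>\<^bsub>V\<^esub> v) = \<phi> u + \<phi> v" if "u \<in> carrier V" "v \<in> carrier V" for u v
    using assms that by (simp add: functional_on_def)
  show **: "\<phi> (k \<odot>\<^bsub>V\<^esub> v) = k * \<phi> v" if "v \<in> carrier V" for k v
    using assms that by (simp add: functional_on_def)
  show "\<phi> (u \<ominus>\<^bsub>V\<^esub> v) = \<phi> u - \<phi> v" if "u \<in> carrier V" "v \<in> carrier V" for u v
    using that assms(2) by (simp add: cs_minus * **)
  show "\<phi> (\<ominus>\<^bsub>V\<^esub> u) = - \<phi> u" if "u \<in> carrier V" for u
    using that assms(2) by (simp add: cs_uminus **)
  show "\<phi> \<zero>\<^bsub>V\<^esub> = 0"
    using **[of "\<zero>\<^bsub>V\<^esub>" 0] assms(2) by (simp add: cs_smult)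
qed

text \<open>
  Linear functionals separate points, so an identity between linear combinations in a carrier can be
  checked on complex numbers.
\<close>

lemma vec_eqI:
  assumes V: "complex_space V" and X: "X \<in> carrier V" and Y: "Y \<in> carrier V"
    and eq: "\<And>\<phi>. functional_on V \<phi> \<Longrightarrow> \<phi> X = \<phi> Y"
  shows "X = Y"
proof (rule ccontr)
  assume "X \<noteq> Y"
  define v where "v = X \<ominus>\<^bsub>V\<^esub> Y"
  have v: "v \<in> carrier V" "v \<noteq> \<zero>\<^bsub>V\<^esub>"
    using X Y V \<open>X \<noteq> Y\<close> by (auto simp: v_def cs_minus_eq_zero)
  \<comment> \<open>The carrier is a set in a type without vector space structure, so bases are
    taken in the free space on that type; \<open>R\<close> below is the kernel of evaluation on
    combinations of carrier elements.\<close>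
  interpret W: vector_space "fscale :: complex \<Rightarrow> ('a \<Rightarrow>\<^sub>0 complex) \<Rightarrow> _" by (rule vector_space_fscale)
  interpret C: vector_space "(*) :: complex \<Rightarrow> complex \<Rightarrow> complex"
    by unfold_locales (simp_all add: algebra_simps)
  interpret WC: vector_space_pair "fscale :: complex \<Rightarrow> ('a \<Rightarrow>\<^sub>0 complex) \<Rightarrow> _" "(*) :: complex \<Rightarrow> complex \<Rightarrow> complex" ..
  have id: "(\<lambda>u. u) \<in> carrier V \<rightarrow> carrier V" by simp
  note E = ev_add[OF V id] ev_fscale[OF V id] ev_diff[OF V id] ev_single[OF V id]
  define R where "R = {c. Poly_Mapping.keys c \<subseteq> carrier V \<and> ev V (\<lambda>u. u) c = \<zero>\<^bsub>V\<^esub>}"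
  have R: "W.subspace R"
  proof (rule W.subspaceI)
    show "0 \<in> R" by (simp add: R_def ev_zero[OF V id])
    show "c + d \<in> R" if "c \<in> R" "d \<in> R" for c d
      using that V Poly_Mapping.keys_add[of c d] abelian_groupE(5)[of V]
      by (auto simp: R_def E module_def)
    show "fscale k c \<in> R" if "c \<in> R" for k c
      using that V keys_fscale[of k c] by (auto simp: R_def E cs_smult)
  qed
  obtain B where B: "B \<subseteq> R" "W.independent B" "R \<subseteq> W.span B"
    by (rule W.maximal_independent_subset)
  have spanB: "W.span B = R"
    using B(1,3) W.span_minimal[OF B(1) R] by auto
  define s where "s = Poly_Mapping.single v (1::complex)"
  have "ev V (\<lambda>u. u) s = v" using v V by (simp add: s_def E cs_smult)
  then have "s \<notin> R" using v by (simp add: R_def)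
  \<comment> \<open>As \<open>v\<close> is nonzero, \<open>s\<close> lies outside \<open>R\<close>,
    so a linear map may be prescribed as 1 at \<open>s\<close> and 0 on a basis of
    \<open>R\<close>.\<close>
  then have "W.independent (insert s B)"
    using B(2) by (intro W.independent_insertI) (simp_all add: spanB)
  then obtain h where h: "Vector_Spaces.linear fscale (*) h" "\<forall>x\<in>insert s B. h x = (if x = s then 1 else 0)"
    using WC.linear_independent_extend[of "insert s B" "\<lambda>x. if x = s then 1 else 0"] by auto
  interpret h: Vector_Spaces.linear "fscale :: complex \<Rightarrow> ('a \<Rightarrow>\<^sub>0 complex) \<Rightarrow> _" "(*)" h by (rule h(1))
  have "s \<notin> B" using B(1) \<open>s \<notin> R\<close> by auto
  then have "h b = 0" if "b \<in> B" for b
    using h(2) that by auto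
  then have hR: "h c = 0" if "c \<in> R" for c
    using that h.eq_0_on_span[of B c] unfolding spanB by auto
  \<comment> \<open>Vanishing of \<open>h\<close> on \<open>R\<close> is what makes
    \<open>\<phi>\<close> additive and homogeneous on the carrier: the formal differences in
    question evaluate to zero.\<close>
  define \<phi> where "\<phi> = (\<lambda>u. h (Poly_Mapping.single u 1))"
  have "functional_on V \<phi>"
    unfolding functional_on_def
  proof (intro conjI ballI allI)
    fix u w assume uw: "u \<in> carrier V" "w \<in> carrier V"
    have "Poly_Mapping.single (u \<oplus>\<^bsub>V\<^esub> w) 1 - (Poly_Mapping.single u 1 + Poly_Mapping.single w 1) \<in> R"
    proof -
      have k: "Poly_Mapping.keys (Poly_Mapping.single u 1 + Poly_Mapping.single w (1::complex)) \<subseteq> carrier V"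
        using Poly_Mapping.keys_add[of "Poly_Mapping.single u (1::complex)" "Poly_Mapping.single w 1"] uw
        by auto
      then have "Poly_Mapping.keys (Poly_Mapping.single (u \<oplus>\<^bsub>V\<^esub> w) 1 - (Poly_Mapping.single u 1 + Poly_Mapping.single w (1::complex))) \<subseteq> carrier V"
        using Poly_Mapping.keys_diff[of "Poly_Mapping.single (u \<oplus>\<^bsub>V\<^esub> w) (1::complex)" "Poly_Mapping.single u 1 + Poly_Mapping.single w 1"] uw V
        by auto
      then show ?thesis
        using uw V k by (simp add: R_def E cs_smult cs_minus_eq_zero)
    qed
    from hR[OF this] show "\<phi> (u \<oplus>\<^bsub>V\<^esub> w) = \<phi> u + \<phi> w"
      by (simp add: \<phi>_def h.diff h.add)
  next
    fix k u assume u: "u \<in> carrier V"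
    have "Poly_Mapping.single (k \<odot>\<^bsub>V\<^esub> u) 1 - Poly_Mapping.single u k \<in> R"
    proof -
      have "Poly_Mapping.keys (Poly_Mapping.single (k \<odot>\<^bsub>V\<^esub> u) 1 - Poly_Mapping.single u k) \<subseteq> carrier V"
        using Poly_Mapping.keys_diff[of "Poly_Mapping.single (k \<odot>\<^bsub>V\<^esub> u) (1::complex)" "Poly_Mapping.single u k"] u V
        by (auto split: if_splits)
      then show ?thesis
        using u V by (simp add: R_def E cs_smult cs_minus_eq_zero)
    qed
    from hR[OF this] have "\<phi> (k \<odot>\<^bsub>V\<^esub> u) = h (fscale k (Poly_Mapping.single u 1))"
      by (simp add: \<phi>_def h.diff fscale_simps)
    then show "\<phi> (k \<odot>\<^bsub>V\<^esub> u) = k * \<phi> u" by (simp add: \<phi>_def h.scale)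
  qed
  moreover from this have "\<phi> v = 0"
    using eq[of \<phi>] X Y V by (simp add: v_def functional_simps)
  moreover have "\<phi> v = 1" using h(2) by (simp add: \<phi>_def s_def)
  ultimately show False by simp
qed

lemma linear_onD:
  assumes "linear_on V W f"
  shows "v \<in> carrier V \<Longrightarrow> f v \<in> carrier W"
    and "u \<in> carrier V \<Longrightarrow> v \<in> carrier V \<Longrightarrow> f (u \<oplus>\<^bsub>V\<^esub> v) = f u \<oplus>\<^bsub>W\<^esub> f v"
    and "v \<in> carrier V \<Longrightarrow> f (k \<odot>\<^bsub>V\<^esub> v) = k \<odot>\<^bsub>W\<^esub> f v"
  using assms by (auto simp: linear_on_def)

lemma conj_linear_onD:
  assumes "conj_linear_on V W f"
  shows "v \<in> carrier V \<Longrightarrow> f v \<in> carrier W"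
    and "u \<in> carrier V \<Longrightarrow> v \<in> carrier V \<Longrightarrow> f (u \<oplus>\<^bsub>V\<^esub> v) = f u \<oplus>\<^bsub>W\<^esub> f v"
    and "v \<in> carrier V \<Longrightarrow> f (k \<odot>\<^bsub>V\<^esub> v) = cnj k \<odot>\<^bsub>W\<^esub> f v"
  using assms by (auto simp: conj_linear_on_def)

lemma linear_on_zero:
  "complex_space V \<Longrightarrow> complex_space W \<Longrightarrow> linear_on V W f \<Longrightarrow> f \<zero>\<^bsub>V\<^esub> = \<zero>\<^bsub>W\<^esub>"
  using linear_onD(3)[of V W f "\<zero>\<^bsub>V\<^esub>" 0] by (simp add: cs_smult linear_onD(1))

lemma linear_on_minus:
  assumes "complex_space V" "complex_space W" "linear_on V W f" "u \<in> carrier V" "v \<in> carrier V"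
  shows "f (u \<ominus>\<^bsub>V\<^esub> v) = f u \<ominus>\<^bsub>W\<^esub> f v"
  using assms by (simp add: cs_minus linear_onD)

lemma conj_linear_on_zero:
  "complex_space V \<Longrightarrow> complex_space W \<Longrightarrow> conj_linear_on V W f \<Longrightarrow> f \<zero>\<^bsub>V\<^esub> = \<zero>\<^bsub>W\<^esub>"
  using conj_linear_onD(3)[of V W f "\<zero>\<^bsub>V\<^esub>" 0] by (simp add: cs_smult conj_linear_onD(1))

lemma conj_linear_on_minus:
  assumes "complex_space V" "complex_space W" "conj_linear_on V W f" "u \<in> carrier V" "v \<in> carrier V"
  shows "f (u \<ominus>\<^bsub>V\<^esub> v) = f u \<ominus>\<^bsub>W\<^esub> f v"
  using assms by (simp add: cs_minus conj_linear_onD)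

lemma functional_linear:
  "functional_on W \<phi> \<Longrightarrow> linear_on V W f \<Longrightarrow> functional_on V (\<lambda>v. \<phi> (f v))"
  by (auto simp: functional_on_def linear_on_def Pi_iff)

section \<open>C*-categories\<close>

lemma banach_cspaceD:
  assumes "banach_cspace V"
  shows "complex_space V" "complete_in V (nrm V)"
    and "v \<in> carrier V \<Longrightarrow> 0 \<le> nrm V v"
    and "v \<in> carrier V \<Longrightarrow> nrm V v = 0 \<longleftrightarrow> v = \<zero>\<^bsub>V\<^esub>"
    and "u \<in> carrier V \<Longrightarrow> v \<in> carrier V \<Longrightarrow> nrm V (u \<oplus>\<^bsub>V\<^esub> v) \<le> nrm V u + nrm V v"
    and "v \<in> carrier V \<Longrightarrow> nrm V (k \<odot>\<^bsub>V\<^esub> v) = cmod k * nrm V v"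
  using assms by (auto simp: banach_cspace_def)

lemma nrm_minus_le:
  "banach_cspace V \<Longrightarrow> u \<in> carrier V \<Longrightarrow> v \<in> carrier V \<Longrightarrow> nrm V (u \<ominus>\<^bsub>V\<^esub> v) \<le> nrm V u + nrm V v"
  using banach_cspaceD(5)[of V u "(-1) \<odot>\<^bsub>V\<^esub> v"] banach_cspaceD(1)[of V] banach_cspaceD(6)[of V v "-1"]
  by (simp add: cs_minus)

lemma nrm_zero: "banach_cspace V \<Longrightarrow> nrm V \<zero>\<^bsub>V\<^esub> = 0"
  using banach_cspaceD(1,4)[of V] by simp

context cstar_category
begin

lemma hom_space [simp, intro]: "x \<in> Obj C \<Longrightarrow> y \<in> Obj C \<Longrightarrow> complex_space (Hom C x y)"
  by (rule banach_cspaceD(1)[OF banach])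

lemma cmp_closed [simp, intro]:
  "x \<in> Obj C \<Longrightarrow> y \<in> Obj C \<Longrightarrow> z \<in> Obj C \<Longrightarrow> g \<in> arr C y z \<Longrightarrow> f \<in> arr C x y \<Longrightarrow> Cmp C x y z g f \<in> arr C x z"
  using cmp_linear_right[of x y z g] by (auto dest: linear_onD)

lemma star_closed [simp, intro]:
  "x \<in> Obj C \<Longrightarrow> y \<in> Obj C \<Longrightarrow> f \<in> arr C x y \<Longrightarrow> Star C x y f \<in> arr C y x"
  using star_conj_linear[of x y] by (auto dest: conj_linear_onD)

lemma cmp_right:
  assumes "x \<in> Obj C" "y \<in> Obj C" "z \<in> Obj C" "g \<in> arr C y z" "f \<in> arr C x y"
  shows "f' \<in> arr C x y \<Longrightarrow> Cmp C x y z g (f \<oplus>\<^bsub>Hom C x y\<^esub> f') = Cmp C x y z g f \<oplus>\<^bsub>Hom C x z\<^esub> Cmp C x y z g f'"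
    and "Cmp C x y z g (k \<odot>\<^bsub>Hom C x y\<^esub> f) = k \<odot>\<^bsub>Hom C x z\<^esub> Cmp C x y z g f"
    and "f' \<in> arr C x y \<Longrightarrow> Cmp C x y z g (f \<ominus>\<^bsub>Hom C x y\<^esub> f') = Cmp C x y z g f \<ominus>\<^bsub>Hom C x z\<^esub> Cmp C x y z g f'"
  using assms by (simp_all add: linear_onD(2,3)[OF cmp_linear_right]
    linear_on_minus[OF hom_space hom_space cmp_linear_right])

lemma cmp_left:
  assumes "x \<in> Obj C" "y \<in> Obj C" "z \<in> Obj C" "g \<in> arr C y z" "f \<in> arr C x y"
  shows "g' \<in> arr C y z \<Longrightarrow> Cmp C x y z (g \<oplus>\<^bsub>Hom C y z\<^esub> g') f = Cmp C x y z g f \<oplus>\<^bsub>Hom C x z\<^esub> Cmp C x y z g' f"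
    and "Cmp C x y z (k \<odot>\<^bsub>Hom C y z\<^esub> g) f = k \<odot>\<^bsub>Hom C x z\<^esub> Cmp C x y z g f"
    and "g' \<in> arr C y z \<Longrightarrow> Cmp C x y z (g \<ominus>\<^bsub>Hom C y z\<^esub> g') f = Cmp C x y z g f \<ominus>\<^bsub>Hom C x z\<^esub> Cmp C x y z g' f"
  using assms by (simp_all add: linear_onD(2,3)[OF cmp_linear_left]
    linear_on_minus[OF hom_space hom_space cmp_linear_left])

lemma cmp_zero:
  assumes "x \<in> Obj C" "y \<in> Obj C" "z \<in> Obj C"
  shows "g \<in> arr C y z \<Longrightarrow> Cmp C x y z g \<zero>\<^bsub>Hom C x y\<^esub> = \<zero>\<^bsub>Hom C x z\<^esub>"
    and "f \<in> arr C x y \<Longrightarrow> Cmp C x y z \<zero>\<^bsub>Hom C y z\<^esub> f = \<zero>\<^bsub>Hom C x z\<^esub>"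
proof -
  assume "g \<in> arr C y z"
  with assms show "Cmp C x y z g \<zero>\<^bsub>Hom C x y\<^esub> = \<zero>\<^bsub>Hom C x z\<^esub>"
    by (intro linear_on_zero[OF hom_space hom_space cmp_linear_right])
next
  assume "f \<in> arr C x y"
  with assms show "Cmp C x y z \<zero>\<^bsub>Hom C y z\<^esub> f = \<zero>\<^bsub>Hom C x z\<^esub>"
    by (intro linear_on_zero[OF hom_space hom_space cmp_linear_left])
qed

lemma star_add:
  assumes "x \<in> Obj C" "y \<in> Obj C" "f \<in> arr C x y"
  shows "f' \<in> arr C x y \<Longrightarrow> Star C x y (f \<oplus>\<^bsub>Hom C x y\<^esub> f') = Star C x y f \<oplus>\<^bsub>Hom C y x\<^esub> Star C x y f'"
    and "Star C x y (k \<odot>\<^bsub>Hom C x y\<^esub> f) = cnj k \<odot>\<^bsub>Hom C y x\<^esub> Star C x y f"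
    and "f' \<in> arr C x y \<Longrightarrow> Star C x y (f \<ominus>\<^bsub>Hom C x y\<^esub> f') = Star C x y f \<ominus>\<^bsub>Hom C y x\<^esub> Star C x y f'"
  using assms by (simp_all add: conj_linear_onD(2,3)[OF star_conj_linear]
    conj_linear_on_minus[OF hom_space hom_space star_conj_linear])

lemma nrm_nonneg: "x \<in> Obj C \<Longrightarrow> y \<in> Obj C \<Longrightarrow> f \<in> arr C x y \<Longrightarrow> 0 \<le> nrm (Hom C x y) f"
  by (rule banach_cspaceD(3)[OF banach])

lemma nrm_star_le:
  assumes "x \<in> Obj C" "y \<in> Obj C" "f \<in> arr C x y"
  shows "nrm (Hom C x y) f \<le> nrm (Hom C y x) (Star C x y f)"
proof (cases "nrm (Hom C x y) f = 0")
  case True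
  then show ?thesis using assms by (simp add: nrm_nonneg)
next
  case False
  have "nrm (Hom C x y) f * nrm (Hom C x y) f \<le> nrm (Hom C y x) (Star C x y f) * nrm (Hom C x y) f"
    using cstar_identity[of x y f] nrm_cmp[of x y x f "Star C x y f"] assms by (simp add: power2_eq_square)
  then show ?thesis using False assms nrm_nonneg[of x y f] by simp
qed

lemma nrm_star:
  "x \<in> Obj C \<Longrightarrow> y \<in> Obj C \<Longrightarrow> f \<in> arr C x y \<Longrightarrow> nrm (Hom C y x) (Star C x y f) = nrm (Hom C x y) f"
  using nrm_star_le[of x y f] nrm_star_le[of y x "Star C x y f"] by (simp add: star_star)

subsection \<open>Polynomials in a self-adjoint endomorphism\<close>

context
  fixes x p
  assumes x: "x \<in> Obj C" and p: "p \<in> arr C x x" and sp: "Star C x x p = p"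
begin

abbreviation (input) "V \<equiv> Hom C x x"
abbreviation (input) mul (infixl \<open>\<bullet>\<bullet>\<close> 70) where "a \<bullet>\<bullet> b \<equiv> Cmp C x x x a b"

text \<open>
  \<open>pact f u\<close> is \<open>f(p) u\<close>. Letting polynomials act by multiplication avoids a norm on the unitization.
\<close>

definition pact :: "complex poly \<Rightarrow> 'm \<Rightarrow> 'm" where
  "pact f u = fold_coeffs (\<lambda>c v. c \<odot>\<^bsub>V\<^esub> u \<oplus>\<^bsub>V\<^esub> p \<bullet>\<bullet> v) f \<zero>\<^bsub>V\<^esub>"

lemma V: "complex_space V" using x by simp

lemma pact_0 [simp]: "pact 0 u = \<zero>\<^bsub>V\<^esub>"
  by (simp add: pact_def)

lemma pact_pCons: "u \<in> carrier V \<Longrightarrow> pact (pCons c f) u = c \<odot>\<^bsub>V\<^esub> u \<oplus>\<^bsub>V\<^esub> p \<bullet>\<bullet> pact f u"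
proof (cases "c = 0 \<and> f = 0")
  case True
  assume "u \<in> carrier V"
  then show ?thesis using True x p V abelian_groupE(5)[of V]
    by (simp add: cmp_zero cs_smult module_def)
next
  case False
  then show ?thesis by (auto simp: pact_def)
qed

lemma pact_closed [simp]: "u \<in> carrier V \<Longrightarrow> pact f u \<in> carrier V"
  by (induction f rule: pCons_induct) (use x p V in \<open>auto simp: pact_pCons\<close>)

lemma pact_add: "u \<in> carrier V \<Longrightarrow> pact (f + g) u = pact f u \<oplus>\<^bsub>V\<^esub> pact g u"
proof (induction f g rule: poly_induct2)
  case 0
  then show ?case using V abelian_groupE(5)[of V] by (simp add: module_def)
next
  case (pCons a f b g)
  note u = pCons.prems
  have "pact (pCons a f + pCons b g) u = (a + b) \<odot>\<^bsub>V\<^esub> u \<oplus>\<^bsub>V\<^esub> p \<bullet>\<bullet> (pact f u \<oplus>\<^bsub>V\<^esub> pact g u)"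
    using u pCons.IH by (simp add: pact_pCons)
  also have "\<dots> = (a \<odot>\<^bsub>V\<^esub> u \<oplus>\<^bsub>V\<^esub> p \<bullet>\<bullet> pact f u) \<oplus>\<^bsub>V\<^esub> (b \<odot>\<^bsub>V\<^esub> u \<oplus>\<^bsub>V\<^esub> p \<bullet>\<bullet> pact g u)"
    using u x p V by (intro vec_eqI[OF V]) (auto simp: functional_simps cmp_right algebra_simps)
  finally show ?case using u by (simp add: pact_pCons)
qed

lemma pact_smult: "u \<in> carrier V \<Longrightarrow> pact (Polynomial.smult c f) u = c \<odot>\<^bsub>V\<^esub> pact f u"
proof (induction f rule: pCons_induct)
  case (pCons a f)
  then have "pact (Polynomial.smult c (pCons a f)) u = (c * a) \<odot>\<^bsub>V\<^esub> u \<oplus>\<^bsub>V\<^esub> p \<bullet>\<bullet> (c \<odot>\<^bsub>V\<^esub> pact f u)"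
    by (simp add: pact_pCons)
  also have "\<dots> = c \<odot>\<^bsub>V\<^esub> (a \<odot>\<^bsub>V\<^esub> u \<oplus>\<^bsub>V\<^esub> p \<bullet>\<bullet> pact f u)"
    using pCons.prems x p V by (intro vec_eqI[OF V]) (auto simp: functional_simps cmp_right algebra_simps)
  finally show ?case using pCons.prems by (simp add: pact_pCons)
qed (use V in \<open>simp add: cs_smult\<close>)

lemma pact_X: "u \<in> carrier V \<Longrightarrow> pact (pCons 0 f) u = p \<bullet>\<bullet> pact f u"
  using x p by (simp add: pact_pCons) (intro vec_eqI[OF V], auto simp: functional_simps V)

lemma pact_mult: "u \<in> carrier V \<Longrightarrow> pact (f * g) u = pact f (pact g u)"
proof (induction f rule: pCons_induct)
  case (pCons a f)
  then show ?case by (simp add: pact_add pact_smult pact_X) (simp add: pact_pCons)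
qed simp

lemma pact_const: "u \<in> carrier V \<Longrightarrow> pact [:c:] u = c \<odot>\<^bsub>V\<^esub> u"
  using x p V by (simp add: pact_pCons cmp_zero) (intro vec_eqI[OF V], auto simp: functional_simps V)

lemma pact_one: "u \<in> carrier V \<Longrightarrow> pact 1 u = u"
  using V pact_const[of u 1] by (simp add: cs_smult one_pCons[symmetric])

text \<open>The adjoint of f(p) is the conjugate polynomial in p. As f(p) need not be a morphism
  itself, this is expressed with test elements on both sides. The element \<open>v\<close> varies
  because each induction step moves a factor \<open>p\<close> onto it.\<close>

lemma pact_star:
  "u \<in> carrier V \<Longrightarrow> v \<in> carrier V \<Longrightarrow> Star C x x (pact f u) \<bullet>\<bullet> v = Star C x x u \<bullet>\<bullet> pact (map_poly cnj f) v"
proof (induction f arbitrary: v rule: pCons_induct)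
  case 0
  then show ?case
    using x V conj_linear_on_zero[OF V V star_conj_linear[OF x x]] by (simp add: cmp_zero)
next
  case (pCons a f)
  note uv = pCons.prems
  \<comment> \<open>That \<open>p\<close> commutes with f(p) is commutativity of polynomial
    multiplication, seen through \<open>pact_mult\<close>.\<close>
  have comm: "p \<bullet>\<bullet> pact f v = pact f (p \<bullet>\<bullet> v)" if "v \<in> carrier V" for f v
  proof -
    have X: "pact [:0, 1:] v = p \<bullet>\<bullet> v" if "v \<in> carrier V" for v
      using pact_X[of v 1] pact_one that by (simp flip: one_pCons)
    have "pact ([:0, 1:] * f) v = pact (f * [:0, 1:]) v" by simp
    then show ?thesis using that x p unfolding pact_mult[OF that] by (simp only: X pact_closed)
  qed
  have "Star C x x (pact (pCons a f) u) \<bullet>\<bullet> v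
      = (cnj a \<odot>\<^bsub>V\<^esub> Star C x x u \<oplus>\<^bsub>V\<^esub> Star C x x (pact f u) \<bullet>\<bullet> p) \<bullet>\<bullet> v"
    using uv x p V by (simp add: pact_pCons star_add star_cmp sp)
  also have "\<dots> = cnj a \<odot>\<^bsub>V\<^esub> (Star C x x u \<bullet>\<bullet> v) \<oplus>\<^bsub>V\<^esub> Star C x x (pact f u) \<bullet>\<bullet> (p \<bullet>\<bullet> v)"
    using uv x p V by (simp add: cmp_left cmp_assoc)
  also have "Star C x x (pact f u) \<bullet>\<bullet> (p \<bullet>\<bullet> v) = Star C x x u \<bullet>\<bullet> (p \<bullet>\<bullet> pact (map_poly cnj f) v)"
    using uv x p pCons.IH[of "p \<bullet>\<bullet> v"] by (simp add: comm)
  also have "cnj a \<odot>\<^bsub>V\<^esub> (Star C x x u \<bullet>\<bullet> v) \<oplus>\<^bsub>V\<^esub> Star C x x u \<bullet>\<bullet> (p \<bullet>\<bullet> pact (map_poly cnj f) v)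
     = Star C x x u \<bullet>\<bullet> (pact (map_poly cnj (pCons a f)) v)"
    using uv x p V by (simp add: pact_pCons cmp_right)
  finally show ?case .
qed

section \<open>The C*-seminorm induced by a self-adjoint endomorphism\<close>

definition pnorm :: "complex poly \<Rightarrow> real" where
  "pnorm f = Inf {K. 0 \<le> K \<and> (\<forall>u\<in>carrier V. nrm V (pact f u) \<le> K * nrm V u)}"

text \<open>Horner's scheme: a bound \<open>K\<close> for \<open>f\<close> yields |a| + |p| K for
  \<open>pCons a f\<close>. Defining \<open>pnorm\<close> as the least bound also covers the zero
  algebra, which has no unit vectors to take a supremum over.\<close>

lemma pnorm_set_nonempty: "{K. 0 \<le> K \<and> (\<forall>u\<in>carrier V. nrm V (pact f u) \<le> K * nrm V u)} \<noteq> {}"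
proof (induction f rule: pCons_induct)
  case 0
  have "nrm V (pact 0 u) \<le> 0 * nrm V u" if "u \<in> carrier V" for u
    using nrm_zero[OF banach[OF x x]] by simp
  then show ?case by blast
next
  case (pCons a f)
  then obtain K where K: "0 \<le> K" "\<And>u. u \<in> carrier V \<Longrightarrow> nrm V (pact f u) \<le> K * nrm V u" by auto
  have "nrm V (pact (pCons a f) u) \<le> (cmod a + nrm V p * K) * nrm V u" if u: "u \<in> carrier V" for u
  proof -
    have "nrm V (pact (pCons a f) u) \<le> nrm V (a \<odot>\<^bsub>V\<^esub> u) + nrm V (p \<bullet>\<bullet> pact f u)"
      using u x p V by (simp add: pact_pCons banach_cspaceD(5)[OF banach])
    also have "nrm V (a \<odot>\<^bsub>V\<^esub> u) = cmod a * nrm V u"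
      using u x by (simp add: banach_cspaceD(6)[OF banach])
    also have "nrm V (p \<bullet>\<bullet> pact f u) \<le> nrm V p * nrm V (pact f u)"
      using u x p by (simp add: nrm_cmp)
    also have "\<dots> \<le> nrm V p * (K * nrm V u)"
      using K(2)[OF u] nrm_nonneg[OF x x p] by (rule mult_left_mono)
    finally show ?thesis by (simp add: algebra_simps)
  qed
  moreover have "0 \<le> cmod a + nrm V p * K" using K(1) nrm_nonneg[OF x x p] by simp
  ultimately show ?case by blast
qed

lemma pnorm_le:
  assumes "0 \<le> K" "\<And>u. u \<in> carrier V \<Longrightarrow> nrm V (pact f u) \<le> K * nrm V u"
  shows "pnorm f \<le> K"
  unfolding pnorm_def using assms by (intro cInf_lower bdd_belowI[of _ 0]) auto

lemma pnorm_nonneg: "0 \<le> pnorm f"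
  unfolding pnorm_def by (rule cInf_greatest[OF pnorm_set_nonempty]) auto

lemma nrm_pact_le:
  assumes u: "u \<in> carrier V"
  shows "nrm V (pact f u) \<le> pnorm f * nrm V u"
proof (cases "nrm V u = 0")
  case True
  obtain K where "nrm V (pact f u) \<le> K * nrm V u"
    using pnorm_set_nonempty[of f] u by auto
  then show ?thesis using True by simp
next
  case False
  then have pos: "0 < nrm V u" using nrm_nonneg[OF x x u] by simp
  have "nrm V (pact f u) / nrm V u \<le> pnorm f"
    unfolding pnorm_def
    by (rule cInf_greatest[OF pnorm_set_nonempty]) (use u pos in \<open>auto simp: pos_divide_le_eq\<close>)
  then show ?thesis using pos by (simp add: pos_divide_le_eq)
qed

lemma pnorm_smult_le: "pnorm (Polynomial.smult c f) \<le> cmod c * pnorm f"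
proof (rule pnorm_le)
  fix u assume u: "u \<in> carrier V"
  have "nrm V (pact (Polynomial.smult c f) u) = cmod c * nrm V (pact f u)"
    using u x by (simp add: pact_smult banach_cspaceD(6)[OF banach])
  also have "\<dots> \<le> cmod c * (pnorm f * nrm V u)"
    using nrm_pact_le[OF u] by (rule mult_left_mono) simp
  finally show "nrm V (pact (Polynomial.smult c f) u) \<le> cmod c * pnorm f * nrm V u"
    by (simp add: mult.assoc)
qed (simp add: pnorm_nonneg)

text \<open>The C*-inequality is the part with content: by \<open>pact_star\<close> the product of
  f(p) u with its star can be rewritten with the conjugate polynomial times \<open>f\<close> acting
  between the star of u and u, and the C*-identity of the category then bounds |f(p) u|^2.\<close>

lemma poly_cstar_seminorm: "poly_cstar_seminorm pnorm"
proof
  show "0 \<le> pnorm f" for f by (rule pnorm_nonneg)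
  show "pnorm (f + g) \<le> pnorm f + pnorm g" for f g
  proof (rule pnorm_le)
    fix u assume u: "u \<in> carrier V"
    have "nrm V (pact (f + g) u) \<le> nrm V (pact f u) + nrm V (pact g u)"
      using u x by (simp add: pact_add banach_cspaceD(5)[OF banach])
    also have "\<dots> \<le> pnorm f * nrm V u + pnorm g * nrm V u"
      using nrm_pact_le[OF u] by (intro add_mono)
    finally show "nrm V (pact (f + g) u) \<le> (pnorm f + pnorm g) * nrm V u"
      by (simp add: algebra_simps)
  qed (simp add: pnorm_nonneg)
  show "pnorm (f * g) \<le> pnorm f * pnorm g" for f g
  proof (rule pnorm_le)
    fix u assume u: "u \<in> carrier V"
    have "nrm V (pact (f * g) u) \<le> pnorm f * nrm V (pact g u)"
      using u nrm_pact_le[of "pact g u" f] by (simp add: pact_mult)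
    also have "\<dots> \<le> pnorm f * (pnorm g * nrm V u)"
      using nrm_pact_le[OF u] pnorm_nonneg by (intro mult_left_mono)
    finally show "nrm V (pact (f * g) u) \<le> pnorm f * pnorm g * nrm V u"
      by (simp add: algebra_simps)
  qed (simp add: pnorm_nonneg)
  show "pnorm (Polynomial.smult c f) = cmod c * pnorm f" for c f
  proof (cases "c = 0")
    case True
    then show ?thesis using pnorm_smult_le[of 0 f] pnorm_nonneg[of 0] by simp
  next
    case False
    then have "cmod c * pnorm f \<le> pnorm (Polynomial.smult c f)"
      using pnorm_smult_le[of "1 / c" "Polynomial.smult c f"]
      by (simp add: norm_divide field_simps)
    then show ?thesis using pnorm_smult_le[of c f] by simp
  qed
  show "(pnorm f)\<^sup>2 \<le> pnorm (map_poly cnj f * f)" for f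
  proof -
    let ?K = "sqrt (pnorm (map_poly cnj f * f))"
    have "pnorm f \<le> ?K"
    proof (rule pnorm_le)
      fix u assume u: "u \<in> carrier V"
      have "(nrm V (pact f u))\<^sup>2 = nrm V (Star C x x (pact f u) \<bullet>\<bullet> pact f u)"
        using u x by (simp add: cstar_identity)
      also have "\<dots> = nrm V (Star C x x u \<bullet>\<bullet> pact (map_poly cnj f * f) u)"
        using u by (simp add: pact_star pact_mult)
      also have "\<dots> \<le> nrm V u * nrm V (pact (map_poly cnj f * f) u)"
        using u x nrm_cmp[of x x x "pact (map_poly cnj f * f) u" "Star C x x u"] by (simp add: nrm_star)
      also have "\<dots> \<le> nrm V u * (pnorm (map_poly cnj f * f) * nrm V u)"
        using nrm_pact_le[OF u] nrm_nonneg[OF x x u] by (intro mult_left_mono)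
      also have "\<dots> = (?K * nrm V u)\<^sup>2"
        using pnorm_nonneg[of "map_poly cnj f * f"] by (simp add: power_mult_distrib) (simp add: power2_eq_square)
      finally show "nrm V (pact f u) \<le> ?K * nrm V u"
        using u x nrm_nonneg[OF x x u] pnorm_nonneg by (auto intro: power2_le_imp_le)
    qed (simp add: pnorm_nonneg)
    then have "(pnorm f)\<^sup>2 \<le> ?K\<^sup>2" using pnorm_nonneg by (intro power_mono)
    then show ?thesis using pnorm_nonneg by simp
  qed
  show "pnorm 1 \<le> 1" by (rule pnorm_le) (simp_all add: pact_one)
qed

text \<open>Testing on \<open>p\<close> itself gives the lower bound, since |p p| = |p|^2 for
  self-adjoint \<open>p\<close>. This converts estimates on polynomials into estimates on
  morphisms.\<close>

lemma pnorm_X: "pnorm [:0, 1:] = nrm V p"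
proof (rule antisym)
  have X: "pact [:0, 1:] u = p \<bullet>\<bullet> u" if "u \<in> carrier V" for u
    using pact_X[of u 1] that by (simp add: pact_one flip: one_pCons)
  show "pnorm [:0, 1:] \<le> nrm V p"
    by (rule pnorm_le) (use x p in \<open>simp_all add: X nrm_nonneg nrm_cmp\<close>)
  have "nrm V p * nrm V p = nrm V (pact [:0, 1:] p)"
    using cstar_identity[OF x x p] p by (simp add: X sp power2_eq_square)
  also have "\<dots> \<le> pnorm [:0, 1:] * nrm V p" using p by (rule nrm_pact_le)
  finally show "nrm V p \<le> pnorm [:0, 1:]"
    using nrm_nonneg[OF x x p] pnorm_nonneg[of "[:0, 1:]"] by (cases "nrm V p = 0") auto
qed

end

end

context cstar_category
begin

subsection \<open>Positive elements\<close>

text \<open>\<open>d\<close> plays the role of \<open>1 - s (s + p)\<^sup>-\<^sup>1 = p (s + p)\<^sup>-\<^sup>1\<close>, but needs no unit.\<close>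

lemma positive_quasi_inverse:
  assumes x: "x \<in> Obj C" and p: "positive C x p" and s: "0 < s"
  obtains d where "d \<in> arr C x x"
    "p = complex_of_real s \<odot>\<^bsub>Hom C x x\<^esub> d \<oplus>\<^bsub>Hom C x x\<^esub> Cmp C x x x p d"
    "p = complex_of_real s \<odot>\<^bsub>Hom C x x\<^esub> d \<oplus>\<^bsub>Hom C x x\<^esub> Cmp C x x x d p"
proof -
  let ?V = "Hom C x x"
  have V: "complex_space ?V" using x by simp
  have pV: "p \<in> carrier ?V" using p by (simp add: positive_def)
  note goal = that
  \<comment> \<open>Both equations are checked on functionals, where products of morphisms become
    opaque numbers and only linear arithmetic remains.\<close>
  have result: thesis if d: "d \<in> carrier ?V"
    and eq: "\<And>\<phi>. functional_on ?V \<phi> \<Longrightarrow>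
      \<phi> p = complex_of_real s * \<phi> d + \<phi> (Cmp C x x x p d) \<and> \<phi> p = complex_of_real s * \<phi> d + \<phi> (Cmp C x x x d p)" for d
    by (rule goal[OF d]; rule vec_eqI[OF V pV])
      (use d pV x V eq in \<open>auto simp: functional_simps\<close>)
  have ns: "- complex_of_real s \<notin> spectrum C x p"
    using p s by (auto simp: positive_def nonneg_Reals_def)
  show thesis
  proof (cases "\<exists>u. endo_unit C x u")
    case True
    have uniq: "v = u" if "endo_unit C x u" "endo_unit C x v" for u v
      using that by (metis endo_unit_def)
    define u where "u = (THE u. endo_unit C x u)"
    have u: "endo_unit C x u"
      unfolding u_def using True uniq by (metis theI)
    then have uV: "u \<in> carrier ?V" and unit: "\<And>a. a \<in> carrier ?V \<Longrightarrow> Cmp C x x x u a = a \<and> Cmp C x x x a u = a"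
      by (auto simp: endo_unit_def)
    have "p \<ominus>\<^bsub>?V\<^esub> ((- complex_of_real s) \<odot>\<^bsub>?V\<^esub> u) \<in> Units (endo_ring C x)"
      using ns True by (simp add: spectrum_def endo_ring_def u_def)
    then obtain y where y: "y \<in> carrier ?V"
      "Cmp C x x x y (p \<ominus>\<^bsub>?V\<^esub> ((- complex_of_real s) \<odot>\<^bsub>?V\<^esub> u)) = u"
      "Cmp C x x x (p \<ominus>\<^bsub>?V\<^esub> ((- complex_of_real s) \<odot>\<^bsub>?V\<^esub> u)) y = u"
      by (auto simp: Units_def endo_ring_def u_def)
    \<comment> \<open>\<open>y\<close> inverts p + s, so this is 1 - s (s + p)^-1.\<close>
    define d where "d = u \<ominus>\<^bsub>?V\<^esub> complex_of_real s \<odot>\<^bsub>?V\<^esub> y"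
    have dV: "d \<in> carrier ?V" using uV y V by (simp add: d_def)
    have e: "\<phi> (Cmp C x x x y p) + complex_of_real s * \<phi> y = \<phi> u" "\<phi> (Cmp C x x x p y) + complex_of_real s * \<phi> y = \<phi> u"
      if \<phi>: "functional_on ?V \<phi>" for \<phi>
      using arg_cong[OF y(2), of \<phi>] arg_cong[OF y(3), of \<phi>] \<phi> V x y(1) uV pV unit[OF y(1)]
      by (simp_all add: cmp_right cmp_left functional_simps)
    have "\<phi> p = complex_of_real s * \<phi> d + \<phi> (Cmp C x x x p d) \<and> \<phi> p = complex_of_real s * \<phi> d + \<phi> (Cmp C x x x d p)"
      if \<phi>: "functional_on ?V \<phi>" for \<phi>
      using e[OF \<phi>] V x y(1) uV pV unit[OF pV] \<phi>
      by (simp add: d_def cmp_left cmp_right functional_simps) (simp add: algebra_simps flip: distrib_left)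
    then show thesis by (rule result[OF dV])
  next
    case False
    have "(p, complex_of_real s) \<in> Units (endo_unitization C x)"
      using ns False by (simp add: spectrum_def)
    then obtain y l where y: "y \<in> carrier ?V" and l: "l * complex_of_real s = 1"
      and 1: "Cmp C x x x y p \<oplus>\<^bsub>?V\<^esub> s \<odot>\<^bsub>?V\<^esub> y \<oplus>\<^bsub>?V\<^esub> l \<odot>\<^bsub>?V\<^esub> p = \<zero>\<^bsub>?V\<^esub>"
      and 2: "Cmp C x x x p y \<oplus>\<^bsub>?V\<^esub> l \<odot>\<^bsub>?V\<^esub> p \<oplus>\<^bsub>?V\<^esub> s \<odot>\<^bsub>?V\<^esub> y = \<zero>\<^bsub>?V\<^esub>"
      by (auto simp: Units_def endo_unitization_def Let_def)
    \<comment> \<open>The inverse of (p, s) in the unitization is (y, l) with l = 1/s. In 1 - s (y +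
      l 1) the scalar part cancels, and - s y remains inside the algebra.\<close>
    define d where "d = (- complex_of_real s) \<odot>\<^bsub>?V\<^esub> y"
    have dV: "d \<in> carrier ?V" using y V by (simp add: d_def)
    have e: "\<phi> p = - complex_of_real s * (\<phi> (Cmp C x x x y p) + complex_of_real s * \<phi> y)" "\<phi> p = - complex_of_real s * (\<phi> (Cmp C x x x p y) + complex_of_real s * \<phi> y)"
      if \<phi>: "functional_on ?V \<phi>" for \<phi>
    proof -
      have "\<phi> (Cmp C x x x y p) + complex_of_real s * \<phi> y = - l * \<phi> p"
        using arg_cong[OF 1, of \<phi>] \<phi> V x y pV by (simp add: functional_simps) (simp add: eq_neg_iff_add_eq_0)
      then show "\<phi> p = - complex_of_real s * (\<phi> (Cmp C x x x y p) + complex_of_real s * \<phi> y)" using l by (simp add: mult.commute)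
      have "\<phi> (Cmp C x x x p y) + complex_of_real s * \<phi> y = - l * \<phi> p"
        using arg_cong[OF 2, of \<phi>] \<phi> V x y pV by (simp add: functional_simps) (simp add: eq_neg_iff_add_eq_0 algebra_simps)
      then show "\<phi> p = - complex_of_real s * (\<phi> (Cmp C x x x p y) + complex_of_real s * \<phi> y)" using l by (simp add: mult.commute)
    qed
    have "\<phi> p = complex_of_real s * \<phi> d + \<phi> (Cmp C x x x p d) \<and> \<phi> p = complex_of_real s * \<phi> d + \<phi> (Cmp C x x x d p)"
      if \<phi>: "functional_on ?V \<phi>" for \<phi>
      using e[OF \<phi>] V x y pV \<phi>
      by (simp add: d_def cmp_left cmp_right functional_simps) (auto simp: algebra_simps)
    then show thesis by (rule result[OF dV])
  qed
qed

text \<open>With w = f(p) u and g = (s + p) w, the quasi-inverse satisfies d g = p w. Hence s w = g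
  - d g and s |w| \<le> (1 + |d|) |g|, which explains \<open>K\<close>. This discharges the
  hypothesis \<open>inv\<close> of the polynomial estimates.\<close>

lemma pnorm_bounded_below:
  assumes x: "x \<in> Obj C" and p: "positive C x p" and s: "0 < s"
  shows "\<exists>K\<ge>0. \<forall>f. pnorm x p f \<le> K * pnorm x p ([:complex_of_real s, 1:] * f)"
proof -
  let ?V = "Hom C x x"
  have V: "complex_space ?V" using x by simp
  have pV: "p \<in> carrier ?V" and sp: "Star C x x p = p" using p by (auto simp: positive_def)
  note A = x pV sp
  obtain d where d: "d \<in> carrier ?V"
    "p = complex_of_real s \<odot>\<^bsub>?V\<^esub> d \<oplus>\<^bsub>?V\<^esub> Cmp C x x x d p"
    by (rule positive_quasi_inverse[OF x p s])
  define K where "K = (1 + nrm ?V d) / s"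
  have K: "0 \<le> K" using s nrm_nonneg[OF x x d(1)] by (simp add: K_def)
  show ?thesis
  proof (intro exI[of _ K] conjI allI K)
    fix f
    let ?g = "[:complex_of_real s, 1:] * f"
    show "pnorm x p f \<le> K * pnorm x p ?g"
    proof (rule pnorm_le[OF A])
      show "0 \<le> K * pnorm x p ?g" using K pnorm_nonneg[OF A] by simp
      fix u assume u: "u \<in> carrier ?V"
      define w where "w = pact x p f u"
      define g where "g = pact x p ?g u"
      have w: "w \<in> carrier ?V" using u A by (simp add: w_def pact_closed)
      have X: "pact x p [:complex_of_real s, 1:] w = complex_of_real s \<odot>\<^bsub>?V\<^esub> w \<oplus>\<^bsub>?V\<^esub> Cmp C x x x p w"
        using w by (simp only: pact_pCons[OF A w, of _ "[:1:]"] pact_const[OF A w] cs_smult[OF V])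
      have g: "g = complex_of_real s \<odot>\<^bsub>?V\<^esub> w \<oplus>\<^bsub>?V\<^esub> Cmp C x x x p w"
        by (simp only: g_def pact_mult[OF A u] X flip: w_def)
      have gV: "g \<in> carrier ?V" using w V x pV by (simp add: g)
      have "Cmp C x x x d g = Cmp C x x x (complex_of_real s \<odot>\<^bsub>?V\<^esub> d \<oplus>\<^bsub>?V\<^esub> Cmp C x x x d p) w"
        unfolding g using x d(1) pV w V by (simp add: cmp_right cmp_left cmp_assoc)
      also have "\<dots> = Cmp C x x x p w" using d(2) by simp
      finally have dg: "Cmp C x x x d g = Cmp C x x x p w" .
      have "complex_of_real s \<odot>\<^bsub>?V\<^esub> w = g \<ominus>\<^bsub>?V\<^esub> Cmp C x x x d g"
        unfolding dg unfolding g
        by (rule vec_eqI[OF V]) (use w V x pV in \<open>auto simp: functional_simps\<close>)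
      then have "s * nrm ?V w = nrm ?V (g \<ominus>\<^bsub>?V\<^esub> Cmp C x x x d g)"
        using banach_cspaceD(6)[OF banach[OF x x] w, of "complex_of_real s"] s by simp
      also have "\<dots> \<le> nrm ?V g + nrm ?V (Cmp C x x x d g)"
        by (rule nrm_minus_le[OF banach[OF x x]]) (use gV d x in auto)
      also have "\<dots> \<le> (1 + nrm ?V d) * nrm ?V g"
        using nrm_cmp[OF x x x gV d(1)] by (simp add: algebra_simps)
      also have "\<dots> \<le> (1 + nrm ?V d) * (pnorm x p ?g * nrm ?V u)"
        unfolding g_def using nrm_pact_le[OF A u] nrm_nonneg[OF x x d(1)] by (intro mult_left_mono) auto
      finally have "nrm ?V w \<le> (1 + nrm ?V d) * (pnorm x p ?g * nrm ?V u) / s"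
        using s by (simp add: pos_le_divide_eq mult.commute)
      then show "nrm ?V (pact x p f u) \<le> K * pnorm x p ?g * nrm ?V u"
        by (simp add: K_def w_def mult.assoc)
    qed
  qed
qed

text \<open>Positivity in terms of norms, which is evidently stable under sums.\<close>

definition npos :: "'o \<Rightarrow> 'm \<Rightarrow> bool" where
  "npos x q \<longleftrightarrow> q \<in> arr C x x \<and>
     (\<exists>T\<ge>0. \<forall>u\<in>arr C x x.
        nrm (Hom C x x) (complex_of_real T \<odot>\<^bsub>Hom C x x\<^esub> u \<ominus>\<^bsub>Hom C x x\<^esub> Cmp C x x x q u) \<le> T * nrm (Hom C x x) u)"

lemma npos_add:
  assumes x: "x \<in> Obj C" and p: "npos x p" and q: "npos x q"
  shows "npos x (p \<oplus>\<^bsub>Hom C x x\<^esub> q)"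
proof -
  let ?V = "Hom C x x"
  have V: "complex_space ?V" using x by simp
  have pV: "p \<in> carrier ?V" "q \<in> carrier ?V" using p q by (auto simp: npos_def)
  obtain T where T: "0 \<le> T" "\<And>u. u \<in> carrier ?V \<Longrightarrow> nrm ?V (complex_of_real T \<odot>\<^bsub>?V\<^esub> u \<ominus>\<^bsub>?V\<^esub> Cmp C x x x p u) \<le> T * nrm ?V u"
    using p by (auto simp: npos_def)
  obtain S where S: "0 \<le> S" "\<And>u. u \<in> carrier ?V \<Longrightarrow> nrm ?V (complex_of_real S \<odot>\<^bsub>?V\<^esub> u \<ominus>\<^bsub>?V\<^esub> Cmp C x x x q u) \<le> S * nrm ?V u"
    using q by (auto simp: npos_def)
  have "nrm ?V (complex_of_real (T + S) \<odot>\<^bsub>?V\<^esub> u \<ominus>\<^bsub>?V\<^esub> Cmp C x x x (p \<oplus>\<^bsub>?V\<^esub> q) u) \<le> (T + S) * nrm ?V u"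
    if u: "u \<in> carrier ?V" for u
  proof -
    have eq: "complex_of_real (T + S) \<odot>\<^bsub>?V\<^esub> u \<ominus>\<^bsub>?V\<^esub> Cmp C x x x (p \<oplus>\<^bsub>?V\<^esub> q) u =
      (complex_of_real T \<odot>\<^bsub>?V\<^esub> u \<ominus>\<^bsub>?V\<^esub> Cmp C x x x p u) \<oplus>\<^bsub>?V\<^esub> (complex_of_real S \<odot>\<^bsub>?V\<^esub> u \<ominus>\<^bsub>?V\<^esub> Cmp C x x x q u)"
      by (rule vec_eqI[OF V]) (use u V x pV in \<open>auto simp: functional_simps cmp_left algebra_simps\<close>)
    have "nrm ?V (complex_of_real (T + S) \<odot>\<^bsub>?V\<^esub> u \<ominus>\<^bsub>?V\<^esub> Cmp C x x x (p \<oplus>\<^bsub>?V\<^esub> q) u)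
      \<le> nrm ?V (complex_of_real T \<odot>\<^bsub>?V\<^esub> u \<ominus>\<^bsub>?V\<^esub> Cmp C x x x p u) + nrm ?V (complex_of_real S \<odot>\<^bsub>?V\<^esub> u \<ominus>\<^bsub>?V\<^esub> Cmp C x x x q u)"
      unfolding eq by (rule banach_cspaceD(5)[OF banach]) (use u V x pV in auto)
    then show ?thesis using T(2)[OF u] S(2)[OF u] by (simp add: algebra_simps)
  qed
  moreover have "0 \<le> T + S" using T S by simp
  ultimately show ?thesis using pV V unfolding npos_def by blast
qed

text \<open>T = |p| is a witness: \<open>N_shift_le\<close> applies there because
  \<open>pnorm\<close> of the variable is |p|.\<close>

lemma positive_npos:
  assumes x: "x \<in> Obj C" and p: "positive C x p"
  shows "npos x p"
proof -
  let ?V = "Hom C x x"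
  have V: "complex_space ?V" using x by simp
  have pV: "p \<in> carrier ?V" and sp: "Star C x x p = p" using p by (auto simp: positive_def)
  note A = x pV sp
  interpret poly_cstar_seminorm "pnorm x p" by (rule poly_cstar_seminorm[OF A])
  let ?t = "nrm ?V p"
  have le: "pnorm x p [:complex_of_real ?t, -1:] \<le> ?t"
    by (rule N_shift_le[OF pnorm_bounded_below[OF x p]]) (simp_all add: pnorm_X[OF A])
  have "nrm ?V (complex_of_real ?t \<odot>\<^bsub>?V\<^esub> u \<ominus>\<^bsub>?V\<^esub> Cmp C x x x p u) \<le> ?t * nrm ?V u" if u: "u \<in> carrier ?V" for u
  proof -
    have "pact x p [:complex_of_real ?t, -1:] u = complex_of_real ?t \<odot>\<^bsub>?V\<^esub> u \<ominus>\<^bsub>?V\<^esub> Cmp C x x x p u"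
      using u x pV V
      by (simp add: pact_pCons[OF A u, of _ "[:-1:]"] pact_const[OF A u] cmp_right cs_minus[OF V] del: pCons_0_0)
    then have "nrm ?V (complex_of_real ?t \<odot>\<^bsub>?V\<^esub> u \<ominus>\<^bsub>?V\<^esub> Cmp C x x x p u) \<le> pnorm x p [:complex_of_real ?t, -1:] * nrm ?V u"
      using nrm_pact_le[OF A u, of "[:complex_of_real ?t, -1:]"] by simp
    also have "\<dots> \<le> ?t * nrm ?V u"
      using le nrm_nonneg[OF x x u] by (rule mult_right_mono)
    finally show ?thesis .
  qed
  moreover have "0 \<le> ?t" using nrm_nonneg[OF x x pV] .
  ultimately show ?thesis using pV unfolding npos_def by blast
qed

text \<open>T + p = (p + q) + (T - q), with T a witness for \<open>npos x q\<close>. As a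
  multiplication operator the left side has norm at least |p| + T by \<open>N_shift_ge\<close>, and
  the right side at most |p + q| + T; then T cancels.\<close>

lemma nrm_positive_le_sum:
  assumes x: "x \<in> Obj C" and p: "positive C x p" and q: "npos x q"
  shows "nrm (Hom C x x) p \<le> nrm (Hom C x x) (p \<oplus>\<^bsub>Hom C x x\<^esub> q)"
proof (cases "nrm (Hom C x x) p = 0")
  case True
  have "p \<oplus>\<^bsub>Hom C x x\<^esub> q \<in> arr C x x" using p q x by (simp add: positive_def npos_def)
  then show ?thesis using True nrm_nonneg[OF x x] by simp
next
  case False
  let ?V = "Hom C x x"
  have V: "complex_space ?V" using x by simp
  have pV: "p \<in> carrier ?V" and sp: "Star C x x p = p" and qV: "q \<in> carrier ?V"
    using p q by (auto simp: positive_def npos_def)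
  note A = x pV sp
  interpret poly_cstar_seminorm "pnorm x p" by (rule poly_cstar_seminorm[OF A])
  obtain T where T: "0 \<le> T" "\<And>u. u \<in> carrier ?V \<Longrightarrow> nrm ?V (complex_of_real T \<odot>\<^bsub>?V\<^esub> u \<ominus>\<^bsub>?V\<^esub> Cmp C x x x q u) \<le> T * nrm ?V u"
    using q by (auto simp: npos_def)
  let ?r = "p \<oplus>\<^bsub>?V\<^esub> q"
  have rV: "?r \<in> carrier ?V" using pV qV V by simp
  have "nrm ?V p + T \<le> pnorm x p [:complex_of_real T, 1:]"
    using N_shift_ge[OF pnorm_bounded_below[OF x p], of T] False nrm_nonneg[OF x x pV] T(1)
    by (simp add: pnorm_X[OF A])
  also have "\<dots> \<le> nrm ?V ?r + T"
  proof (rule pnorm_le[OF A])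
    show "0 \<le> nrm ?V ?r + T" using nrm_nonneg[OF x x rV] T(1) by simp
    fix u assume u: "u \<in> carrier ?V"
    have eq: "pact x p [:complex_of_real T, 1:] u = complex_of_real T \<odot>\<^bsub>?V\<^esub> u \<oplus>\<^bsub>?V\<^esub> Cmp C x x x p u"
      using u by (simp only: pact_pCons[OF A u, of _ "[:1:]"] pact_const[OF A u] cs_smult[OF V])
    also have "\<dots> = Cmp C x x x ?r u \<oplus>\<^bsub>?V\<^esub> (complex_of_real T \<odot>\<^bsub>?V\<^esub> u \<ominus>\<^bsub>?V\<^esub> Cmp C x x x q u)"
      by (rule vec_eqI[OF V]) (use u V x pV qV in \<open>auto simp: functional_simps cmp_left algebra_simps\<close>)
    finally have eq: "pact x p [:complex_of_real T, 1:] u = Cmp C x x x ?r u \<oplus>\<^bsub>?V\<^esub> (complex_of_real T \<odot>\<^bsub>?V\<^esub> u \<ominus>\<^bsub>?V\<^esub> Cmp C x x x q u)" .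
    have "nrm ?V (pact x p [:complex_of_real T, 1:] u) \<le> nrm ?V (Cmp C x x x ?r u) + nrm ?V (complex_of_real T \<odot>\<^bsub>?V\<^esub> u \<ominus>\<^bsub>?V\<^esub> Cmp C x x x q u)"
      unfolding eq by (rule banach_cspaceD(5)[OF banach]) (use u V x rV qV in auto)
    also have "\<dots> \<le> nrm ?V ?r * nrm ?V u + T * nrm ?V u"
      using T(2)[OF u] nrm_cmp[OF x x x u rV] by simp
    finally show "nrm ?V (pact x p [:complex_of_real T, 1:] u) \<le> (nrm ?V ?r + T) * nrm ?V u"
      by (simp add: algebra_simps)
  qed
  finally show ?thesis by simp
qed

lemma positive_star_cmp:
  "x \<in> Obj C \<Longrightarrow> y \<in> Obj C \<Longrightarrow> a \<in> arr C x y \<Longrightarrow> positive C x (Cmp C x y x (Star C x y a) a)"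
  using spectrum_star_cmp[of x y a] by (simp add: positive_def star_cmp star_star)

end

section \<open>Hilbert modules\<close>

locale hmodule = cstar_category A + hilbert_module A E
  for A :: "('o, 'm) star_cat" and E :: "('o, 'm, 'e) hmod"
begin

lemma val [simp, intro]: "x \<in> Obj A \<Longrightarrow> complex_space (Val E x)"
  by (rule val_space)

lemma act_closed [simp, intro]:
  "w \<in> Obj A \<Longrightarrow> x \<in> Obj A \<Longrightarrow> e \<in> elts E x \<Longrightarrow> a \<in> arr A w x \<Longrightarrow> act E w x e a \<in> elts E w"
  by (rule linear_onD(1)[OF act_linear_left])

lemma inn_closed [simp, intro]:
  "x \<in> Obj A \<Longrightarrow> y \<in> Obj A \<Longrightarrow> e \<in> elts E y \<Longrightarrow> f \<in> elts E x \<Longrightarrow> inn E y x e f \<in> arr A x y"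
  by (rule linear_onD(1)[OF inn_linear_right])

lemma act_left:
  assumes "w \<in> Obj A" "x \<in> Obj A" "a \<in> arr A w x" "e \<in> elts E x"
  shows "e' \<in> elts E x \<Longrightarrow> act E w x (e \<oplus>\<^bsub>Val E x\<^esub> e') a = act E w x e a \<oplus>\<^bsub>Val E w\<^esub> act E w x e' a"
    and "act E w x (k \<odot>\<^bsub>Val E x\<^esub> e) a = k \<odot>\<^bsub>Val E w\<^esub> act E w x e a"
    and "e' \<in> elts E x \<Longrightarrow> act E w x (e \<ominus>\<^bsub>Val E x\<^esub> e') a = act E w x e a \<ominus>\<^bsub>Val E w\<^esub> act E w x e' a"
  using assms by (simp_all add: linear_onD(2,3)[OF act_linear_left]
    linear_on_minus[OF val val act_linear_left])

lemma act_right: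
  assumes "w \<in> Obj A" "x \<in> Obj A" "a \<in> arr A w x" "e \<in> elts E x"
  shows "a' \<in> arr A w x \<Longrightarrow> act E w x e (a \<oplus>\<^bsub>Hom A w x\<^esub> a') = act E w x e a \<oplus>\<^bsub>Val E w\<^esub> act E w x e a'"
    and "act E w x e (k \<odot>\<^bsub>Hom A w x\<^esub> a) = k \<odot>\<^bsub>Val E w\<^esub> act E w x e a"
    and "a' \<in> arr A w x \<Longrightarrow> act E w x e (a \<ominus>\<^bsub>Hom A w x\<^esub> a') = act E w x e a \<ominus>\<^bsub>Val E w\<^esub> act E w x e a'"
  using assms by (simp_all add: linear_onD(2,3)[OF act_linear_right]
    linear_on_minus[OF hom_space val act_linear_right])

lemma inn_right:
  assumes "x \<in> Obj A" "y \<in> Obj A" "e \<in> elts E y" "f \<in> elts E x"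
  shows "f' \<in> elts E x \<Longrightarrow> inn E y x e (f \<oplus>\<^bsub>Val E x\<^esub> f') = inn E y x e f \<oplus>\<^bsub>Hom A x y\<^esub> inn E y x e f'"
    and "inn E y x e (k \<odot>\<^bsub>Val E x\<^esub> f) = k \<odot>\<^bsub>Hom A x y\<^esub> inn E y x e f"
    and "f' \<in> elts E x \<Longrightarrow> inn E y x e (f \<ominus>\<^bsub>Val E x\<^esub> f') = inn E y x e f \<ominus>\<^bsub>Hom A x y\<^esub> inn E y x e f'"
  using assms by (simp_all add: linear_onD(2,3)[OF inn_linear_right]
    linear_on_minus[OF val hom_space inn_linear_right])

lemma inn_left:
  assumes "x \<in> Obj A" "y \<in> Obj A" "e \<in> elts E y" "f \<in> elts E x"
  shows "e' \<in> elts E y \<Longrightarrow> inn E y x (e \<oplus>\<^bsub>Val E y\<^esub> e') f = inn E y x e f \<oplus>\<^bsub>Hom A x y\<^esub> inn E y x e' f"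
    and "inn E y x (k \<odot>\<^bsub>Val E y\<^esub> e) f = cnj k \<odot>\<^bsub>Hom A x y\<^esub> inn E y x e f"
    and "e' \<in> elts E y \<Longrightarrow> inn E y x (e \<ominus>\<^bsub>Val E y\<^esub> e') f = inn E y x e f \<ominus>\<^bsub>Hom A x y\<^esub> inn E y x e' f"
  using assms by (simp_all add: conj_linear_onD(2,3)[OF inn_conj_linear_left]
    conj_linear_on_minus[OF val hom_space inn_conj_linear_left])

lemma inn_zero:
  assumes "x \<in> Obj A" "y \<in> Obj A"
  shows "e \<in> elts E y \<Longrightarrow> inn E y x e \<zero>\<^bsub>Val E x\<^esub> = \<zero>\<^bsub>Hom A x y\<^esub>"
    and "f \<in> elts E x \<Longrightarrow> inn E y x \<zero>\<^bsub>Val E y\<^esub> f = \<zero>\<^bsub>Hom A x y\<^esub>"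
  using assms by (auto intro!: linear_on_zero[OF val hom_space inn_linear_right]
    conj_linear_on_zero[OF val hom_space inn_conj_linear_left])

lemma inn_act_left:
  assumes "x \<in> Obj A" "y \<in> Obj A" "w \<in> Obj A" "e \<in> elts E y" "f \<in> elts E x" "g \<in> arr A w y"
  shows "inn E w x (act E w y e g) f = Cmp A x y w (Star A w y g) (inn E y x e f)"
proof -
  have "inn E w x (act E w y e g) f = Star A w x (inn E x w f (act E w y e g))"
    using assms by (intro inn_star) auto
  also have "inn E x w f (act E w y e g) = Cmp A w y x (inn E x y f e) g"
    using assms by (simp add: inn_act)
  also have "Star A w x \<dots> = Cmp A x y w (Star A w y g) (Star A y x (inn E x y f e))"
    using assms by (simp add: star_cmp)
  also have "Star A y x (inn E x y f e) = inn E y x e f"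
    using assms by (simp add: inn_star[of x y e f])
  finally show ?thesis .
qed

section \<open>The norm of a Hilbert module\<close>

lemma mnorm_nonneg: "x \<in> Obj A \<Longrightarrow> e \<in> elts E x \<Longrightarrow> 0 \<le> mnorm A E x e"
  by (simp add: mnorm_def nrm_nonneg)

lemma mnorm_sq: "x \<in> Obj A \<Longrightarrow> e \<in> elts E x \<Longrightarrow> (mnorm A E x e)\<^sup>2 = nrm (Hom A x x) (inn E x x e e)"
  by (simp add: mnorm_def nrm_nonneg)

lemma mnorm_zero [simp]: "x \<in> Obj A \<Longrightarrow> mnorm A E x \<zero>\<^bsub>Val E x\<^esub> = 0"
  by (simp add: mnorm_def inn_zero nrm_zero[OF banach])

lemma mnorm_eq_zero: "x \<in> Obj A \<Longrightarrow> e \<in> elts E x \<Longrightarrow> mnorm A E x e = 0 \<Longrightarrow> e = \<zero>\<^bsub>Val E x\<^esub>"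
  using banach_cspaceD(4)[OF banach[of x x], of "inn E x x e e"] by (auto simp: mnorm_def intro: inn_definite)

lemma mnorm_smult: "x \<in> Obj A \<Longrightarrow> e \<in> elts E x \<Longrightarrow> mnorm A E x (k \<odot>\<^bsub>Val E x\<^esub> e) = cmod k * mnorm A E x e"
  by (simp add: mnorm_def inn_left inn_right banach_cspaceD(6)[OF banach] real_sqrt_mult)

lemma mnorm_act:
  assumes "w \<in> Obj A" "x \<in> Obj A" "e \<in> elts E x" "a \<in> arr A w x"
  shows "mnorm A E w (act E w x e a) \<le> mnorm A E x e * nrm (Hom A w x) a"
proof -
  let ?i = "inn E x x e e"
  have i: "?i \<in> arr A x x" "Cmp A w x x ?i a \<in> arr A w x" using assms by auto
  have "inn E w w (act E w x e a) (act E w x e a) = Cmp A w x w (Star A w x a) (Cmp A w x x ?i a)"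
    using assms by (simp add: inn_act_left inn_act)
  then have "(mnorm A E w (act E w x e a))\<^sup>2 = nrm (Hom A w w) (Cmp A w x w (Star A w x a) (Cmp A w x x ?i a))"
    using assms by (simp add: mnorm_sq)
  also have "\<dots> \<le> nrm (Hom A w x) a * nrm (Hom A w x) (Cmp A w x x ?i a)"
    using nrm_cmp[of w x w "Cmp A w x x ?i a" "Star A w x a"] assms i by (simp add: nrm_star)
  also have "\<dots> \<le> nrm (Hom A w x) a * (nrm (Hom A x x) ?i * nrm (Hom A w x) a)"
    using nrm_cmp[of w x x a ?i] assms i by (intro mult_left_mono) (auto simp: nrm_nonneg)
  also have "\<dots> = (mnorm A E x e * nrm (Hom A w x) a)\<^sup>2"
    using assms by (simp add: power_mult_distrib mnorm_sq) (simp add: power2_eq_square)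
  finally show ?thesis
    using assms by (auto intro!: power2_le_imp_le mult_nonneg_nonneg simp: mnorm_nonneg nrm_nonneg)
qed

text \<open>
  The parallelogram identity yields the triangle inequality and the Cauchy-Schwarz inequality up to
  constants, which is all that convergence arguments need.
\<close>

lemma parallelogram_le:
  assumes x: "x \<in> Obj A" and e: "e \<in> elts E x" and f: "f \<in> elts E x"
  shows "(mnorm A E x (e \<oplus>\<^bsub>Val E x\<^esub> f))\<^sup>2 \<le> 2 * (mnorm A E x e)\<^sup>2 + 2 * (mnorm A E x f)\<^sup>2"
proof -
  let ?V = "Hom A x x" and ?W = "Val E x"
  have V: "complex_space ?V" and W: "complex_space ?W" using x by auto
  let ?p = "inn E x x (e \<oplus>\<^bsub>?W\<^esub> f) (e \<oplus>\<^bsub>?W\<^esub> f)"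
  let ?q = "inn E x x (e \<ominus>\<^bsub>?W\<^esub> f) (e \<ominus>\<^bsub>?W\<^esub> f)"
  have eq: "?p \<oplus>\<^bsub>?V\<^esub> ?q = 2 \<odot>\<^bsub>?V\<^esub> inn E x x e e \<oplus>\<^bsub>?V\<^esub> 2 \<odot>\<^bsub>?V\<^esub> inn E x x f f"
    by (rule vec_eqI[OF V]) (use x e f V W in \<open>auto simp: functional_simps inn_left inn_right\<close>)
  have "(mnorm A E x (e \<oplus>\<^bsub>?W\<^esub> f))\<^sup>2 = nrm ?V ?p"
    using x e f W by (simp add: mnorm_sq)
  \<comment> \<open>Adding the positive term of e - f does not lower the norm.\<close>
  also have "\<dots> \<le> nrm ?V (?p \<oplus>\<^bsub>?V\<^esub> ?q)"
    using x e f W by (intro nrm_positive_le_sum positive_npos inn_positive) auto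
  also have "\<dots> \<le> nrm ?V (2 \<odot>\<^bsub>?V\<^esub> inn E x x e e) + nrm ?V (2 \<odot>\<^bsub>?V\<^esub> inn E x x f f)"
    unfolding eq using x e f V by (intro banach_cspaceD(5)[OF banach]) auto
  also have "\<dots> = 2 * (mnorm A E x e)\<^sup>2 + 2 * (mnorm A E x f)\<^sup>2"
    using x e f by (simp add: banach_cspaceD(6)[OF banach] mnorm_sq)
  finally show ?thesis .
qed

lemma mnorm_add_le:
  assumes x: "x \<in> Obj A" and e: "e \<in> elts E x" and f: "f \<in> elts E x"
  shows "mnorm A E x (e \<oplus>\<^bsub>Val E x\<^esub> f) \<le> 2 * (mnorm A E x e + mnorm A E x f)"
proof (rule power2_le_imp_le)
  have 1: "0 \<le> mnorm A E x e * mnorm A E x f" using assms by (simp add: mnorm_nonneg)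
  have 2: "(2 * (mnorm A E x e + mnorm A E x f))\<^sup>2
      = 4 * (mnorm A E x e)\<^sup>2 + 4 * (mnorm A E x f)\<^sup>2 + 8 * (mnorm A E x e * mnorm A E x f)"
    by (simp add: power_mult_distrib power2_sum)
  show "(mnorm A E x (e \<oplus>\<^bsub>Val E x\<^esub> f))\<^sup>2 \<le> (2 * (mnorm A E x e + mnorm A E x f))\<^sup>2"
    using parallelogram_le[OF assms] zero_le_power2[of "mnorm A E x e"] zero_le_power2[of "mnorm A E x f"] 1
    unfolding 2 by linarith
qed (use assms in \<open>simp add: mnorm_nonneg\<close>)

lemma mnorm_minus_commute:
  assumes x: "x \<in> Obj A" and e: "e \<in> elts E x" and f: "f \<in> elts E x"
  shows "mnorm A E x (e \<ominus>\<^bsub>Val E x\<^esub> f) = mnorm A E x (f \<ominus>\<^bsub>Val E x\<^esub> e)"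
proof -
  have "e \<ominus>\<^bsub>Val E x\<^esub> f = (-1) \<odot>\<^bsub>Val E x\<^esub> (f \<ominus>\<^bsub>Val E x\<^esub> e)"
    by (rule vec_eqI[OF val[OF x]]) (use assms in \<open>auto simp: functional_simps\<close>)
  then show ?thesis using assms by (simp add: mnorm_smult)
qed

lemma mnorm_triangle:
  assumes x: "x \<in> Obj A" and e: "e \<in> elts E x" and f: "f \<in> elts E x" and g: "g \<in> elts E x"
  shows "mnorm A E x (e \<ominus>\<^bsub>Val E x\<^esub> g) \<le> 2 * (mnorm A E x (e \<ominus>\<^bsub>Val E x\<^esub> f) + mnorm A E x (f \<ominus>\<^bsub>Val E x\<^esub> g))"
proof -
  have "e \<ominus>\<^bsub>Val E x\<^esub> g = (e \<ominus>\<^bsub>Val E x\<^esub> f) \<oplus>\<^bsub>Val E x\<^esub> (f \<ominus>\<^bsub>Val E x\<^esub> g)"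
    by (rule vec_eqI[OF val[OF x]]) (use assms in \<open>auto simp: functional_simps\<close>)
  then show ?thesis using mnorm_add_le[of x "e \<ominus>\<^bsub>Val E x\<^esub> f" "f \<ominus>\<^bsub>Val E x\<^esub> g"] assms by simp
qed

lemma null_triangle:
  assumes x: "x \<in> Obj A"
    and cl: "\<And>n. e n \<in> elts E x" "\<And>n. f n \<in> elts E x" "\<And>n. g n \<in> elts E x"
    and lim: "(\<lambda>n. mnorm A E x (e n \<ominus>\<^bsub>Val E x\<^esub> f n)) \<longlonglongrightarrow> 0" "(\<lambda>n. mnorm A E x (f n \<ominus>\<^bsub>Val E x\<^esub> g n)) \<longlonglongrightarrow> 0"
  shows "(\<lambda>n. mnorm A E x (e n \<ominus>\<^bsub>Val E x\<^esub> g n)) \<longlonglongrightarrow> 0"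
proof (rule Lim_null_comparison)
  show "(\<lambda>n. 2 * (mnorm A E x (e n \<ominus>\<^bsub>Val E x\<^esub> f n) + mnorm A E x (f n \<ominus>\<^bsub>Val E x\<^esub> g n))) \<longlonglongrightarrow> 0"
    using tendsto_mult_left[OF tendsto_add[OF lim], of 2] by simp
  show "eventually (\<lambda>n. norm (mnorm A E x (e n \<ominus>\<^bsub>Val E x\<^esub> g n))
      \<le> 2 * (mnorm A E x (e n \<ominus>\<^bsub>Val E x\<^esub> f n) + mnorm A E x (f n \<ominus>\<^bsub>Val E x\<^esub> g n))) sequentially"
    using mnorm_triangle[OF x cl] x cl by (simp add: mnorm_nonneg)
qed

text \<open>Polarization with two phases: for |k| = 1, \<open>S k\<close> is k <e,f> + cnj k <f,e>,
  whence S 1 - i S i = 2 <e,f>. The constant 3 is 2 from the parallelogram estimate plus 1 from the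
  subtracted squares.\<close>

lemma cauchy_schwarz_aux:
  assumes x: "x \<in> Obj A" and e: "e \<in> elts E x" and f: "f \<in> elts E x"
  shows "nrm (Hom A x x) (inn E x x e f) \<le> 3 * ((mnorm A E x e)\<^sup>2 + (mnorm A E x f)\<^sup>2)"
proof -
  let ?V = "Hom A x x" and ?W = "Val E x"
  have V: "complex_space ?V" and W: "complex_space ?W" using x by auto
  note B = banach[OF x x]
  define S where "S k = inn E x x (e \<oplus>\<^bsub>?W\<^esub> k \<odot>\<^bsub>?W\<^esub> f) (e \<oplus>\<^bsub>?W\<^esub> k \<odot>\<^bsub>?W\<^esub> f) \<ominus>\<^bsub>?V\<^esub> (inn E x x e e \<oplus>\<^bsub>?V\<^esub> inn E x x f f)" for k
  have SV: "S k \<in> carrier ?V" for k using x e f V W by (simp add: S_def)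
  have S: "nrm ?V (S k) \<le> 3 * ((mnorm A E x e)\<^sup>2 + (mnorm A E x f)\<^sup>2)" if k: "cmod k = 1" for k
  proof -
    have "nrm ?V (S k) \<le> nrm ?V (inn E x x (e \<oplus>\<^bsub>?W\<^esub> k \<odot>\<^bsub>?W\<^esub> f) (e \<oplus>\<^bsub>?W\<^esub> k \<odot>\<^bsub>?W\<^esub> f)) + nrm ?V (inn E x x e e \<oplus>\<^bsub>?V\<^esub> inn E x x f f)"
      unfolding S_def using x e f V W by (intro nrm_minus_le[OF B]) auto
    also have "\<dots> \<le> (mnorm A E x (e \<oplus>\<^bsub>?W\<^esub> k \<odot>\<^bsub>?W\<^esub> f))\<^sup>2 + ((mnorm A E x e)\<^sup>2 + (mnorm A E x f)\<^sup>2)"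
      using x e f V W banach_cspaceD(5)[OF B, of "inn E x x e e" "inn E x x f f"] by (simp add: mnorm_sq)
    also have "\<dots> \<le> 3 * ((mnorm A E x e)\<^sup>2 + (mnorm A E x f)\<^sup>2)"
      using parallelogram_le[OF x e, of "k \<odot>\<^bsub>?W\<^esub> f"] x f W k by (simp add: mnorm_smult)
    finally show ?thesis .
  qed
  have eq: "2 \<odot>\<^bsub>?V\<^esub> inn E x x e f = S 1 \<ominus>\<^bsub>?V\<^esub> \<i> \<odot>\<^bsub>?V\<^esub> S \<i>"
    by (rule vec_eqI[OF V]) (use x e f V W in \<open>auto simp: S_def functional_simps inn_left inn_right algebra_simps\<close>)
  have "2 * nrm ?V (inn E x x e f) = nrm ?V (S 1 \<ominus>\<^bsub>?V\<^esub> \<i> \<odot>\<^bsub>?V\<^esub> S \<i>)"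
    using banach_cspaceD(6)[OF B, of "inn E x x e f" 2] x e f by (simp add: eq)
  also have "\<dots> \<le> nrm ?V (S 1) + nrm ?V (\<i> \<odot>\<^bsub>?V\<^esub> S \<i>)"
    using V SV by (intro nrm_minus_le[OF B]) auto
  also have "\<dots> \<le> 2 * (3 * ((mnorm A E x e)\<^sup>2 + (mnorm A E x f)\<^sup>2))"
    using S[of 1] S[of \<i>] SV by (simp add: banach_cspaceD(6)[OF B])
  finally show ?thesis by simp
qed

text \<open>Over a single object, rescaling both vectors to norm 1 turns the bound 3 (1 + 1) into
  the constant 6. Over different objects put b = <e,f> and replace \<open>e\<close> by e.b, which
  lies over \<open>x\<close>: then |b|^2 = |<e.b, f>| \<le> 6 |e| |b| |f|, and one factor |b|
  cancels.\<close>

lemma cauchy_schwarz: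
  assumes x: "x \<in> Obj A" and y: "y \<in> Obj A" and e: "e \<in> elts E y" and f: "f \<in> elts E x"
  shows "nrm (Hom A x y) (inn E y x e f) \<le> 6 * mnorm A E y e * mnorm A E x f"
proof -
  have same: "nrm (Hom A x x) (inn E x x e f) \<le> 6 * mnorm A E x e * mnorm A E x f"
    if e: "e \<in> elts E x" for e
  proof (cases "mnorm A E x e = 0 \<or> mnorm A E x f = 0")
    case True
    then have "inn E x x e f = \<zero>\<^bsub>Hom A x x\<^esub>"
      using x e f mnorm_eq_zero[OF x e] mnorm_eq_zero[OF x f] by (auto simp: inn_zero)
    then show ?thesis using x e f by (simp add: nrm_zero[OF banach] mnorm_nonneg)
  next
    case False
    let ?a = "mnorm A E x e" and ?b = "mnorm A E x f"
    have pos: "0 < ?a" "0 < ?b"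
      using False mnorm_nonneg[OF x e] mnorm_nonneg[OF x f] by auto
    let ?e = "complex_of_real (1 / ?a) \<odot>\<^bsub>Val E x\<^esub> e" and ?f = "complex_of_real (1 / ?b) \<odot>\<^bsub>Val E x\<^esub> f"
    have ef: "?e \<in> elts E x" "?f \<in> elts E x" using x e f by auto
    have n: "mnorm A E x ?e = 1" "mnorm A E x ?f = 1"
      using pos x e f by (simp_all add: mnorm_smult del: of_real_divide)
    have "nrm (Hom A x x) (inn E x x ?e ?f) = nrm (Hom A x x) (inn E x x e f) / (?a * ?b)"
      using x e f pos by (simp add: inn_left inn_right banach_cspaceD(6)[OF banach] norm_divide norm_mult)
    moreover have "nrm (Hom A x x) (inn E x x ?e ?f) \<le> 6"
      using cauchy_schwarz_aux[OF x ef] by (simp only: n) simp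
    ultimately show ?thesis using pos by (simp add: divide_le_eq mult.assoc)
  qed
  let ?b = "inn E y x e f"
  have b: "?b \<in> arr A x y" using x y e f by simp
  show ?thesis
  proof (cases "nrm (Hom A x y) ?b = 0")
    case True
    then show ?thesis using x y e f by (simp add: mnorm_nonneg)
  next
    case False
    have "nrm (Hom A x y) ?b * nrm (Hom A x y) ?b = nrm (Hom A x x) (inn E x x (act E x y e ?b) f)"
      using x y e f b cstar_identity[OF x y b] by (simp add: inn_act_left power2_eq_square)
    also have "\<dots> \<le> 6 * mnorm A E x (act E x y e ?b) * mnorm A E x f"
      using x y e b by (intro same) auto
    also have "\<dots> \<le> 6 * (mnorm A E y e * nrm (Hom A x y) ?b) * mnorm A E x f"
      using mnorm_act[OF x y e b] x f by (intro mult_right_mono) (auto simp: mnorm_nonneg)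
    finally have "nrm (Hom A x y) ?b * nrm (Hom A x y) ?b \<le> (6 * mnorm A E y e * mnorm A E x f) * nrm (Hom A x y) ?b"
      by (simp add: algebra_simps)
    then show ?thesis using False nrm_nonneg[OF x y b] by simp
  qed
qed

lemma eq_if_inn_eq:
  assumes "x \<in> Obj A" "e \<in> elts E x" "f \<in> elts E x"
    and "\<And>g. g \<in> elts E x \<Longrightarrow> inn E x x g e = inn E x x g f"
  shows "e = f"
proof -
  have "inn E x x (e \<ominus>\<^bsub>Val E x\<^esub> f) (e \<ominus>\<^bsub>Val E x\<^esub> f) = \<zero>\<^bsub>Hom A x x\<^esub>"
    using assms by (simp add: inn_right cs_minus_eq_zero)
  then show ?thesis using assms inn_definite[of x "e \<ominus>\<^bsub>Val E x\<^esub> f"] by (simp add: cs_minus_eq_zero)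
qed

end

section \<open>Operators between Hilbert modules\<close>

lemma natural_transfD:
  assumes "natural_transf A E F T"
  shows "x \<in> Obj A \<Longrightarrow> e \<in> elts E x \<Longrightarrow> T x e \<in> elts F x"
    and "x \<in> Obj A \<Longrightarrow> linear_on (Val E x) (Val F x) (T x)"
    and "w \<in> Obj A \<Longrightarrow> x \<in> Obj A \<Longrightarrow> e \<in> elts E x \<Longrightarrow> a \<in> arr A w x \<Longrightarrow>
      T w (act E w x e a) = act F w x (T x e) a"
    and "x \<notin> Obj A \<Longrightarrow> T x = undefined"
    and "x \<in> Obj A \<Longrightarrow> e \<notin> elts E x \<Longrightarrow> T x e = undefined"
  using assms unfolding natural_transf_def by (auto simp: PiE_iff extensional_def)

lemma natural_transf_linear:
  assumes "natural_transf A E F T" "x \<in> Obj A" "e \<in> elts E x"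
  shows "e' \<in> elts E x \<Longrightarrow> T x (e \<oplus>\<^bsub>Val E x\<^esub> e') = T x e \<oplus>\<^bsub>Val F x\<^esub> T x e'"
    and "T x (k \<odot>\<^bsub>Val E x\<^esub> e) = k \<odot>\<^bsub>Val F x\<^esub> T x e"
  using assms linear_onD(2,3)[OF natural_transfD(2)[OF assms(1,2)]] by auto

lemma natural_transfI:
  assumes "\<And>x e. x \<in> Obj A \<Longrightarrow> e \<in> elts E x \<Longrightarrow> t x e \<in> elts F x"
    and "\<And>x e e'. x \<in> Obj A \<Longrightarrow> e \<in> elts E x \<Longrightarrow> e' \<in> elts E x \<Longrightarrow>
      t x (e \<oplus>\<^bsub>Val E x\<^esub> e') = t x e \<oplus>\<^bsub>Val F x\<^esub> t x e'"
    and "\<And>x e k. x \<in> Obj A \<Longrightarrow> e \<in> elts E x \<Longrightarrow> t x (k \<odot>\<^bsub>Val E x\<^esub> e) = k \<odot>\<^bsub>Val F x\<^esub> t x e"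
    and "\<And>w x e a. w \<in> Obj A \<Longrightarrow> x \<in> Obj A \<Longrightarrow> e \<in> elts E x \<Longrightarrow> a \<in> arr A w x \<Longrightarrow>
      t w (act E w x e a) = act F w x (t x e) a"
    and "hmodule A E"
  shows "natural_transf A E F (\<lambda>x\<in>Obj A. \<lambda>e\<in>elts E x. t x e)"
proof -
  interpret hmodule A E by fact
  show ?thesis
    using assms(1-4) unfolding natural_transf_def linear_on_def by auto
qed

lemma natural_transf_eqI:
  assumes S: "natural_transf A E F S" and T: "natural_transf A E F T"
    and eq: "\<And>x e. x \<in> Obj A \<Longrightarrow> e \<in> elts E x \<Longrightarrow> S x e = T x e"
  shows "S = T"
proof (intro ext)
  fix x e
  show "S x e = T x e"
    using eq[of x e] natural_transfD(4,5)[OF S] natural_transfD(4,5)[OF T]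
    by (cases "x \<in> Obj A"; cases "e \<in> elts E x") simp_all
qed

lemma operator_space_simps [simp]:
  "carrier (operator_space A E F) = operators A E F"
  "\<zero>\<^bsub>operator_space A E F\<^esub> = (\<lambda>x\<in>Obj A. \<lambda>e\<in>elts E x. \<zero>\<^bsub>Val F x\<^esub>)"
  "S \<oplus>\<^bsub>operator_space A E F\<^esub> T = (\<lambda>x\<in>Obj A. \<lambda>e\<in>elts E x. S x e \<oplus>\<^bsub>Val F x\<^esub> T x e)"
  "k \<odot>\<^bsub>operator_space A E F\<^esub> T = (\<lambda>x\<in>Obj A. \<lambda>e\<in>elts E x. k \<odot>\<^bsub>Val F x\<^esub> T x e)"
  by (simp_all add: operator_space_def)

lemma Hilb_simps [simp]:
  "Obj (Hilb A) = {E. hilbert_module A E}"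
  "Hom (Hilb A) E F = operator_space A E F"
  "Cmp (Hilb A) E F G S T = op_comp A E S T"
  "Star (Hilb A) E F = adjoint A E F"
  by (simp_all add: Hilb_def)

lemma op_comp_apply [simp]:
  "x \<in> Obj A \<Longrightarrow> e \<in> elts E x \<Longrightarrow> op_comp A E S T x e = S x (T x e)"
  by (simp add: op_comp_def)

lemma op_id_apply [simp]: "x \<in> Obj A \<Longrightarrow> e \<in> elts E x \<Longrightarrow> op_id A E x e = e"
  by (simp add: op_id_def)

lemma is_adjointD:
  assumes "is_adjoint A E F T S"
  shows "natural_transf A F E S"
    and "x \<in> Obj A \<Longrightarrow> y \<in> Obj A \<Longrightarrow> e \<in> elts E y \<Longrightarrow> f \<in> elts F x \<Longrightarrow> inn F y x (T y e) f = inn E y x e (S x f)"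
  using assms by (auto simp: is_adjoint_def)

lemma operatorsD:
  assumes "T \<in> operators A E F"
  shows "natural_transf A E F T" "bdd_above (unit_sphere_norms A E F T)" "\<exists>S. is_adjoint A E F T S"
  using assms by (auto simp: operators_def)

section \<open>Adjoints and bounds of operators\<close>

context
  fixes A :: "('o, 'm) star_cat" and E :: "('o, 'm, 'e) hmod" and F :: "('o, 'm, 'f) hmod"
  assumes E: "hmodule A E" and F: "hmodule A F"
begin

interpretation E: hmodule A E by (rule E)
interpretation F: hmodule A F by (rule F)

lemma natural_transf_minus:
  assumes "natural_transf A E F T" "x \<in> Obj A" "e \<in> elts E x" "e' \<in> elts E x"
  shows "T x (e \<ominus>\<^bsub>Val E x\<^esub> e') = T x e \<ominus>\<^bsub>Val F x\<^esub> T x e'"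
  using assms by (intro linear_on_minus natural_transfD(2)[OF assms(1)]) auto

lemma natural_transf_zero:
  "natural_transf A E F T \<Longrightarrow> x \<in> Obj A \<Longrightarrow> T x \<zero>\<^bsub>Val E x\<^esub> = \<zero>\<^bsub>Val F x\<^esub>"
  by (intro linear_on_zero natural_transfD(2)) auto

lemma is_adjoint_unique:
  assumes "is_adjoint A E F T S" "is_adjoint A E F T S'"
  shows "S = S'"
proof (rule natural_transf_eqI[OF is_adjointD(1)[OF assms(1)] is_adjointD(1)[OF assms(2)]])
  fix x f assume x: "x \<in> Obj A" and f: "f \<in> elts F x"
  show "S x f = S' x f"
  proof (rule E.eq_if_inn_eq[OF x])
    show "inn E x x e (S x f) = inn E x x e (S' x f)" if "e \<in> elts E x" for e
      using is_adjointD(2)[OF assms(1) x x that f] is_adjointD(2)[OF assms(2) x x that f] by simp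
  qed (use x f in \<open>auto intro: natural_transfD(1)[OF is_adjointD(1)[OF assms(1)]]
        natural_transfD(1)[OF is_adjointD(1)[OF assms(2)]]\<close>)
qed

lemma adjoint_eq: "is_adjoint A E F T S \<Longrightarrow> adjoint A E F T = S"
  unfolding adjoint_def using is_adjoint_unique by blast

lemma adjoint_is_adjoint: "T \<in> operators A E F \<Longrightarrow> is_adjoint A E F T (adjoint A E F T)"
  using operatorsD(3) adjoint_eq by metis

lemma is_adjoint_sym:
  assumes S: "is_adjoint A E F T S" and T: "natural_transf A E F T"
  shows "is_adjoint A F E S T"
  unfolding is_adjoint_def
proof (intro conjI ballI T)
  fix x y f e assume x: "x \<in> Obj A" and y: "y \<in> Obj A" and f: "f \<in> elts F y" and e: "e \<in> elts E x"
  have Sf: "S y f \<in> elts E y" using natural_transfD(1)[OF is_adjointD(1)[OF S]] y f by simp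
  have Te: "T x e \<in> elts F x" using natural_transfD(1)[OF T] x e by simp
  have "inn E y x (S y f) e = Star A y x (inn E x y e (S y f))"
    by (rule E.inn_star[OF x y Sf e])
  also have "\<dots> = Star A y x (inn F x y (T x e) f)"
    using is_adjointD(2)[OF S y x e f] by simp
  also have "\<dots> = inn F y x f (T x e)"
    by (rule F.inn_star[OF x y f Te, symmetric])
  finally show "inn E y x (S y f) e = inn F y x f (T x e)" .
qed

lemma operatorsI:
  assumes T: "natural_transf A E F T" and S: "is_adjoint A E F T S"
    and K: "\<And>x e. x \<in> Obj A \<Longrightarrow> e \<in> elts E x \<Longrightarrow> mnorm A F x (T x e) \<le> K * mnorm A E x e"
  shows "T \<in> operators A E F"
proof -
  have "bdd_above (unit_sphere_norms A E F T)"
    by (rule bdd_aboveI[of _ K]) (use K in \<open>force simp: unit_sphere_norms_def\<close>)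
  with T S show ?thesis by (auto simp: operators_def)
qed

lemma operators_bound:
  assumes T: "T \<in> operators A E F"
  obtains K where "0 \<le> K"
    "\<And>x e. x \<in> Obj A \<Longrightarrow> e \<in> elts E x \<Longrightarrow> mnorm A F x (T x e) \<le> K * mnorm A E x e"
proof -
  note T1 = operatorsD(1)[OF T]
  obtain K where K: "\<And>r. r \<in> unit_sphere_norms A E F T \<Longrightarrow> r \<le> K"
    using operatorsD(2)[OF T] by (auto simp: bdd_above_def)
  show thesis
  \<comment> \<open>If there are no unit vectors, an upper bound of their image norms may be
    negative.\<close>
  proof (rule that[of "max 0 K"])
    fix x e assume x: "x \<in> Obj A" and e: "e \<in> elts E x"
    have Te: "T x e \<in> elts F x" using natural_transfD(1)[OF T1 x e] .
    show "mnorm A F x (T x e) \<le> max 0 K * mnorm A E x e"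
    proof (cases "mnorm A E x e = 0")
      case True
      then have "e = \<zero>\<^bsub>Val E x\<^esub>" using E.mnorm_eq_zero[OF x e] by simp
      then show ?thesis using natural_transf_zero[OF T1 x] x by simp
    next
      case False
      let ?n = "mnorm A E x e"
      have n: "0 < ?n" using False E.mnorm_nonneg[OF x e] by simp
      let ?e = "complex_of_real (1 / ?n) \<odot>\<^bsub>Val E x\<^esub> e"
      have e': "?e \<in> elts E x" "mnorm A E x ?e = 1"
        using x e n by (simp_all add: E.mnorm_smult del: of_real_divide)
      have "mnorm A F x (T x ?e) \<le> K"
        by (rule K) (use x e' in \<open>auto simp: unit_sphere_norms_def\<close>)
      moreover have "mnorm A F x (T x ?e) = mnorm A F x (T x e) / ?n"
        using natural_transf_linear(2)[OF T1 x e] Te x n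
        by (simp add: F.mnorm_smult del: of_real_divide)
      ultimately have "mnorm A F x (T x e) \<le> K * ?n"
        using n by (simp add: pos_divide_le_eq)
      also have "\<dots> \<le> max 0 K * ?n" using n by (intro mult_right_mono) auto
      finally show ?thesis .
    qed
  qed simp
qed

lemma opnorm_le_one:
  assumes T: "\<And>x e. x \<in> Obj A \<Longrightarrow> e \<in> elts E x \<Longrightarrow> mnorm A F x (T x e) \<le> mnorm A E x e"
  shows "opnorm A E F T \<le> 1"
  unfolding opnorm_def by (rule cSup_least) (use T in \<open>force simp: unit_sphere_norms_def\<close>)+

text \<open>|S f|^2 = |<T S f, f>|, to which Cauchy-Schwarz applies with its constant 6. Membership
  in \<open>operators\<close> includes a bound for the operator only, so one for the adjoint has to
  be derived.\<close>

lemma adjoint_bound: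
  assumes T: "natural_transf A E F T" and S: "is_adjoint A E F T S" and K0: "0 \<le> K"
    and K: "\<And>x e. x \<in> Obj A \<Longrightarrow> e \<in> elts E x \<Longrightarrow> mnorm A F x (T x e) \<le> K * mnorm A E x e"
    and x: "x \<in> Obj A" and f: "f \<in> elts F x"
  shows "mnorm A E x (S x f) \<le> 6 * K * mnorm A F x f"
proof -
  have Sf: "S x f \<in> elts E x" using natural_transfD(1)[OF is_adjointD(1)[OF S]] x f by simp
  have TSf: "T x (S x f) \<in> elts F x" using natural_transfD(1)[OF T] x Sf by simp
  let ?n = "mnorm A E x (S x f)"
  have n: "0 \<le> ?n" using E.mnorm_nonneg[OF x Sf] .
  have f0: "0 \<le> mnorm A F x f" using F.mnorm_nonneg[OF x f] .
  have 1: "mnorm A F x (T x (S x f)) \<le> K * ?n" using K[OF x Sf] .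
  have "?n * ?n = nrm (Hom A x x) (inn F x x (T x (S x f)) f)"
    using E.mnorm_sq[OF x Sf] is_adjointD(2)[OF S x x Sf f] by (simp add: power2_eq_square)
  also have "\<dots> \<le> 6 * mnorm A F x (T x (S x f)) * mnorm A F x f"
    by (rule F.cauchy_schwarz[OF x x TSf f])
  also have "\<dots> \<le> 6 * (K * ?n) * mnorm A F x f"
    using 1 f0 by (intro mult_right_mono mult_left_mono) auto
  finally have 2: "?n * ?n \<le> (6 * K * mnorm A F x f) * ?n" by (simp add: algebra_simps)
  show ?thesis
  proof (cases "?n = 0")
    case True
    have "0 \<le> K * mnorm A F x f" using f0 K0 by simp
    then show ?thesis using True by simp
  next
    case False
    then show ?thesis using 2 n by simp
  qed
qed

lemma adjoint_operators:
  assumes T: "T \<in> operators A E F"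
  shows "adjoint A E F T \<in> operators A F E" and "adjoint A F E (adjoint A E F T) = T"
proof -
  obtain K where K: "0 \<le> K"
    "\<And>x e. x \<in> Obj A \<Longrightarrow> e \<in> elts E x \<Longrightarrow> mnorm A F x (T x e) \<le> K * mnorm A E x e"
    by (rule operators_bound[OF T], rule that)
  note T1 = operatorsD(1)[OF T]
  note S = adjoint_is_adjoint[OF T]
  note sym = is_adjoint_sym[OF S T1]
  have "bdd_above (unit_sphere_norms A F E (adjoint A E F T))"
    by (rule bdd_aboveI[of _ "6 * K"])
      (use adjoint_bound[OF T1 S K] in \<open>force simp: unit_sphere_norms_def\<close>)
  with sym is_adjointD(1)[OF S] show "adjoint A E F T \<in> operators A F E"
    by (auto simp: operators_def)
  have "S' = T" if "is_adjoint A F E (adjoint A E F T) S'" for S'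
  proof (rule natural_transf_eqI[OF is_adjointD(1)[OF that] T1])
    fix x e assume x: "x \<in> Obj A" and e: "e \<in> elts E x"
    have c: "S' x e \<in> elts F x" "T x e \<in> elts F x"
      using natural_transfD(1)[OF is_adjointD(1)[OF that] x e] natural_transfD(1)[OF T1 x e] by auto
    show "S' x e = T x e"
      by (rule F.eq_if_inn_eq[OF x c])
        (use is_adjointD(2)[OF that x x _ e] is_adjointD(2)[OF sym x x _ e] in auto)
  qed
  then show "adjoint A F E (adjoint A E F T) = T"
    unfolding adjoint_def[of A F E] using sym by (intro the_equality) auto
qed

lemma is_adjoint_add:
  assumes T: "is_adjoint A E F T S" "is_adjoint A E F T' S'"
    and n: "natural_transf A E F T" "natural_transf A E F T'"
  shows "is_adjoint A E F (T \<oplus>\<^bsub>operator_space A E F\<^esub> T') (S \<oplus>\<^bsub>operator_space A F E\<^esub> S')"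
proof -
  note c = natural_transfD(1)[OF is_adjointD(1)[OF T(1)]] natural_transfD(1)[OF is_adjointD(1)[OF T(2)]]
    natural_transfD(1)[OF n(1)] natural_transfD(1)[OF n(2)]
  have "natural_transf A F E (\<lambda>x\<in>Obj A. \<lambda>e\<in>elts F x. S x e \<oplus>\<^bsub>Val E x\<^esub> S' x e)"
  proof (rule natural_transfI[OF _ _ _ _ F])
    note l = natural_transf_linear[OF is_adjointD(1)[OF T(1)]] natural_transf_linear[OF is_adjointD(1)[OF T(2)]]
    show "S x (e \<oplus>\<^bsub>Val F x\<^esub> e') \<oplus>\<^bsub>Val E x\<^esub> S' x (e \<oplus>\<^bsub>Val F x\<^esub> e')
        = (S x e \<oplus>\<^bsub>Val E x\<^esub> S' x e) \<oplus>\<^bsub>Val E x\<^esub> (S x e' \<oplus>\<^bsub>Val E x\<^esub> S' x e')"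
      if "x \<in> Obj A" "e \<in> elts F x" "e' \<in> elts F x" for x e e'
      using that by (intro vec_eqI[OF E.val]) (auto simp: l c functional_simps)
    show "S x (k \<odot>\<^bsub>Val F x\<^esub> e) \<oplus>\<^bsub>Val E x\<^esub> S' x (k \<odot>\<^bsub>Val F x\<^esub> e) = k \<odot>\<^bsub>Val E x\<^esub> (S x e \<oplus>\<^bsub>Val E x\<^esub> S' x e)"
      if "x \<in> Obj A" "e \<in> elts F x" for x e k
      using that by (simp add: l c cs_smult)
    show "S w (act F w x e a) \<oplus>\<^bsub>Val E w\<^esub> S' w (act F w x e a) = act E w x (S x e \<oplus>\<^bsub>Val E x\<^esub> S' x e) a"
      if "w \<in> Obj A" "x \<in> Obj A" "e \<in> elts F x" "a \<in> arr A w x" for w x e a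
      using that natural_transfD(3)[OF is_adjointD(1)[OF T(1)]] natural_transfD(3)[OF is_adjointD(1)[OF T(2)]]
      by (simp add: c E.act_left)
  qed (use c in auto)
  then show ?thesis
    using is_adjointD(2)[OF T(1)] is_adjointD(2)[OF T(2)] c
    by (simp add: is_adjoint_def E.inn_right F.inn_left)
qed

lemma is_adjoint_smult:
  assumes T: "is_adjoint A E F T S" and n: "natural_transf A E F T"
  shows "is_adjoint A E F (k \<odot>\<^bsub>operator_space A E F\<^esub> T) (cnj k \<odot>\<^bsub>operator_space A F E\<^esub> S)"
proof -
  note c = natural_transfD(1)[OF is_adjointD(1)[OF T]] natural_transfD(1)[OF n]
  have "natural_transf A F E (\<lambda>x\<in>Obj A. \<lambda>e\<in>elts F x. cnj k \<odot>\<^bsub>Val E x\<^esub> S x e)"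
  proof (rule natural_transfI[OF _ _ _ _ F])
    note l = natural_transf_linear[OF is_adjointD(1)[OF T]]
    show "cnj k \<odot>\<^bsub>Val E x\<^esub> S x (e \<oplus>\<^bsub>Val F x\<^esub> e')
        = cnj k \<odot>\<^bsub>Val E x\<^esub> S x e \<oplus>\<^bsub>Val E x\<^esub> cnj k \<odot>\<^bsub>Val E x\<^esub> S x e'"
      if "x \<in> Obj A" "e \<in> elts F x" "e' \<in> elts F x" for x e e'
      using that by (simp add: l(1) c cs_smult)
    show "cnj k \<odot>\<^bsub>Val E x\<^esub> S x (r \<odot>\<^bsub>Val F x\<^esub> e) = r \<odot>\<^bsub>Val E x\<^esub> (cnj k \<odot>\<^bsub>Val E x\<^esub> S x e)"
      if "x \<in> Obj A" "e \<in> elts F x" for x e r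
      using that by (intro vec_eqI[OF E.val]) (auto simp: l c functional_simps)
    show "cnj k \<odot>\<^bsub>Val E w\<^esub> S w (act F w x e a) = act E w x (cnj k \<odot>\<^bsub>Val E x\<^esub> S x e) a"
      if "w \<in> Obj A" "x \<in> Obj A" "e \<in> elts F x" "a \<in> arr A w x" for w x e a
      using that natural_transfD(3)[OF is_adjointD(1)[OF T]] by (simp add: c E.act_left)
  qed (use c in auto)
  then show ?thesis
    using is_adjointD(2)[OF T] c by (simp add: is_adjoint_def E.inn_right F.inn_left)
qed

end

section \<open>Sums, multiples and composites of operators\<close>

lemma operators_add:
  assumes E: "hmodule A E" and F: "hmodule A F"
    and S: "S \<in> operators A E F" and T: "T \<in> operators A E F"
  shows "S \<oplus>\<^bsub>operator_space A E F\<^esub> T \<in> operators A E F"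
proof -
  interpret F: hmodule A F by (rule F)
  note adj = is_adjoint_add[OF E F adjoint_is_adjoint[OF E F S] adjoint_is_adjoint[OF E F T] operatorsD(1)[OF S] operatorsD(1)[OF T]]
  \<comment> \<open>Exchanging the modules exhibits the sum of \<open>S\<close> and \<open>T\<close>
    as an adjoint, which supplies its naturality.\<close>
  note adj' = is_adjoint_add[OF F E is_adjoint_sym[OF E F adjoint_is_adjoint[OF E F S] operatorsD(1)[OF S]]
      is_adjoint_sym[OF E F adjoint_is_adjoint[OF E F T] operatorsD(1)[OF T]]
      is_adjointD(1)[OF adjoint_is_adjoint[OF E F S]] is_adjointD(1)[OF adjoint_is_adjoint[OF E F T]]]
  obtain K where "0 \<le> K" and K: "\<And>x e. x \<in> Obj A \<Longrightarrow> e \<in> elts E x \<Longrightarrow> mnorm A F x (S x e) \<le> K * mnorm A E x e"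
    by (rule operators_bound[OF E F S], rule that)
  obtain L where "0 \<le> L" and L: "\<And>x e. x \<in> Obj A \<Longrightarrow> e \<in> elts E x \<Longrightarrow> mnorm A F x (T x e) \<le> L * mnorm A E x e"
    by (rule operators_bound[OF E F T], rule that)
  show ?thesis
  proof (rule operatorsI[OF E F is_adjointD(1)[OF adj'] adj])
    fix x e assume x: "x \<in> Obj A" and e: "e \<in> elts E x"
    have "mnorm A F x (S x e \<oplus>\<^bsub>Val F x\<^esub> T x e) \<le> 2 * (mnorm A F x (S x e) + mnorm A F x (T x e))"
      using x e natural_transfD(1)[OF operatorsD(1)[OF S]] natural_transfD(1)[OF operatorsD(1)[OF T]]
      by (intro F.mnorm_add_le) auto
    also have "\<dots> \<le> 2 * (K * mnorm A E x e + L * mnorm A E x e)"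
      using K[OF x e] L[OF x e] by simp
    finally show "mnorm A F x ((S \<oplus>\<^bsub>operator_space A E F\<^esub> T) x e) \<le> (2 * (K + L)) * mnorm A E x e"
      using x e by (simp add: algebra_simps)
  qed
qed

lemma operators_smult:
  assumes E: "hmodule A E" and F: "hmodule A F" and T: "T \<in> operators A E F"
  shows "k \<odot>\<^bsub>operator_space A E F\<^esub> T \<in> operators A E F"
proof -
  interpret F: hmodule A F by (rule F)
  note adj = is_adjoint_smult[OF E F adjoint_is_adjoint[OF E F T] operatorsD(1)[OF T], of k]
  note adj' = is_adjoint_smult[OF F E is_adjoint_sym[OF E F adjoint_is_adjoint[OF E F T] operatorsD(1)[OF T]]
      is_adjointD(1)[OF adjoint_is_adjoint[OF E F T]], of "cnj k"]
  obtain L where "0 \<le> L" and L: "\<And>x e. x \<in> Obj A \<Longrightarrow> e \<in> elts E x \<Longrightarrow> mnorm A F x (T x e) \<le> L * mnorm A E x e"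
    by (rule operators_bound[OF E F T], rule that)
  show ?thesis
  proof (rule operatorsI[OF E F _ adj])
    show "natural_transf A E F (k \<odot>\<^bsub>operator_space A E F\<^esub> T)"
      using is_adjointD(1)[OF adj'] by simp
    fix x e assume x: "x \<in> Obj A" and e: "e \<in> elts E x"
    have "cmod k * mnorm A F x (T x e) \<le> cmod k * (L * mnorm A E x e)"
      using L[OF x e] by (intro mult_left_mono) auto
    then show "mnorm A F x ((k \<odot>\<^bsub>operator_space A E F\<^esub> T) x e) \<le> (cmod k * L) * mnorm A E x e"
      using x e natural_transfD(1)[OF operatorsD(1)[OF T]] by (simp add: F.mnorm_smult mult.assoc)
  qed
qed

lemma natural_transf_comp:
  assumes E: "hmodule A E" and T: "natural_transf A E F T" and S: "natural_transf A F G S"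
  shows "natural_transf A E G (op_comp A E S T)"
  unfolding op_comp_def
  by (rule natural_transfI[OF _ _ _ _ E])
    (simp_all add: natural_transfD(1,3)[OF T] natural_transfD(1,3)[OF S]
      natural_transf_linear[OF T] natural_transf_linear[OF S])

lemma is_adjoint_comp:
  assumes E: "hmodule A E" and G: "hmodule A G"
    and T: "natural_transf A E F T" "is_adjoint A E F T T'"
    and S: "natural_transf A F G S" "is_adjoint A F G S S'"
  shows "is_adjoint A E G (op_comp A E S T) (op_comp A G T' S')"
  using natural_transf_comp[OF G is_adjointD(1)[OF S(2)] is_adjointD(1)[OF T(2)]]
    is_adjointD(2)[OF S(2)] is_adjointD(2)[OF T(2)] natural_transfD(1)[OF T(1)]
    natural_transfD(1)[OF is_adjointD(1)[OF S(2)]]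
  by (simp add: is_adjoint_def)

lemma operators_comp:
  assumes E: "hmodule A E" and F: "hmodule A F" and G: "hmodule A G"
    and T: "T \<in> operators A E F" and S: "S \<in> operators A F G"
  shows "op_comp A E S T \<in> operators A E G"
    and "adjoint A E G (op_comp A E S T) = op_comp A G (adjoint A E F T) (adjoint A F G S)"
proof -
  note adj = is_adjoint_comp[OF E G operatorsD(1)[OF T] adjoint_is_adjoint[OF E F T] operatorsD(1)[OF S] adjoint_is_adjoint[OF F G S]]
  show "adjoint A E G (op_comp A E S T) = op_comp A G (adjoint A E F T) (adjoint A F G S)"
    by (rule adjoint_eq[OF E G adj])
  obtain K where K: "0 \<le> K" "\<And>x e. x \<in> Obj A \<Longrightarrow> e \<in> elts F x \<Longrightarrow> mnorm A G x (S x e) \<le> K * mnorm A F x e"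
    by (rule operators_bound[OF F G S], rule that)
  obtain L where "0 \<le> L" and L: "\<And>x e. x \<in> Obj A \<Longrightarrow> e \<in> elts E x \<Longrightarrow> mnorm A F x (T x e) \<le> L * mnorm A E x e"
    by (rule operators_bound[OF E F T], rule that)
  show "op_comp A E S T \<in> operators A E G"
  proof (rule operatorsI[OF E G natural_transf_comp[OF E operatorsD(1)[OF T] operatorsD(1)[OF S]] adj])
    fix x e assume x: "x \<in> Obj A" and e: "e \<in> elts E x"
    have "mnorm A G x (S x (T x e)) \<le> K * mnorm A F x (T x e)"
      using x natural_transfD(1)[OF operatorsD(1)[OF T] x e] by (rule K(2))
    also have "\<dots> \<le> K * (L * mnorm A E x e)" using L[OF x e] K(1) by (rule mult_left_mono)
    finally show "mnorm A G x (op_comp A E S T x e) \<le> (K * L) * mnorm A E x e"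
      using x e by (simp add: mult.assoc)
  qed
qed

lemma op_id_operators:
  assumes E: "hmodule A E"
  shows "op_id A E \<in> operators A E E" "is_adjoint A E E (op_id A E) (op_id A E)"
proof -
  interpret hmodule A E by (rule E)
  have n: "natural_transf A E E (op_id A E)"
    unfolding op_id_def by (rule natural_transfI[OF _ _ _ _ E]) auto
  then show adj: "is_adjoint A E E (op_id A E) (op_id A E)" by (simp add: is_adjoint_def)
  show "op_id A E \<in> operators A E E"
    by (rule operatorsI[OF E E n adj, of 1]) simp
qed

section \<open>Transport of structure\<close>

lemma complex_space_transport:
  assumes V: "complex_space V" and h: "bij_betw h (carrier W) (carrier V)"
    and zero: "\<zero>\<^bsub>W\<^esub> \<in> carrier W" "h \<zero>\<^bsub>W\<^esub> = \<zero>\<^bsub>V\<^esub>"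
    and add: "\<And>u v. u \<in> carrier W \<Longrightarrow> v \<in> carrier W \<Longrightarrow> u \<oplus>\<^bsub>W\<^esub> v \<in> carrier W \<and> h (u \<oplus>\<^bsub>W\<^esub> v) = h u \<oplus>\<^bsub>V\<^esub> h v"
    and smult: "\<And>k u. u \<in> carrier W \<Longrightarrow> k \<odot>\<^bsub>W\<^esub> u \<in> carrier W \<and> h (k \<odot>\<^bsub>W\<^esub> u) = k \<odot>\<^bsub>V\<^esub> h u"
  shows "complex_space W"
proof -
  have hV: "h u \<in> carrier V" if "u \<in> carrier W" for u
    using h that by (auto simp: bij_betw_def)
  have eqI: "u = v" if "u \<in> carrier W" "v \<in> carrier W" "h u = h v" for u v
    using h that by (auto simp: bij_betw_def dest: inj_onD)
  interpret module complex_field V by (rule V)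
  note s = zero add smult hV
  have "abelian_group W"
  proof (rule abelian_groupI)
    show "\<exists>v\<in>carrier W. v \<oplus>\<^bsub>W\<^esub> u = \<zero>\<^bsub>W\<^esub>" if u: "u \<in> carrier W" for u
    proof (rule bexI[of _ "(-1) \<odot>\<^bsub>W\<^esub> u"])
      have "(-1) \<odot>\<^bsub>V\<^esub> h u \<oplus>\<^bsub>V\<^esub> h u = \<zero>\<^bsub>V\<^esub>"
        using cs_smult(2)[OF V hV[OF u], of "-1" 1] cs_smult(4,5)[OF V hV[OF u]] by simp
      then show "(-1) \<odot>\<^bsub>W\<^esub> u \<oplus>\<^bsub>W\<^esub> u = \<zero>\<^bsub>W\<^esub>"
        using u by (intro eqI) (auto simp: s)
    qed (use u in \<open>auto simp: s\<close>)
  qed (auto intro!: eqI simp: s M.a_assoc M.a_comm M.a_lcomm)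
  then show ?thesis
    by (rule moduleI[OF cring_complex_field]) (auto intro!: eqI simp: s cs_smult[OF V])
qed

text \<open>Of \<open>Q\<close> only the operations and a structure-preserving bijection onto a
  genuine Hilbert module are given; all axioms, positivity and completeness included, are pulled
  back. This serves both for renaming representables and for completions, whose elements are sets of
  sequences.\<close>

locale hmodule_iso = N: hmodule A N
  for A :: "('o, 'm) star_cat" and N :: "('o, 'm, 'e) hmod" +
  fixes Q :: "('o, 'm, 'f) hmod" and h :: "'o \<Rightarrow> 'f \<Rightarrow> 'e"
  assumes bij: "x \<in> Obj A \<Longrightarrow> bij_betw (h x) (elts Q x) (elts N x)"
    and zero: "x \<in> Obj A \<Longrightarrow> \<zero>\<^bsub>Val Q x\<^esub> \<in> elts Q x \<and> h x \<zero>\<^bsub>Val Q x\<^esub> = \<zero>\<^bsub>Val N x\<^esub>"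
    and add: "x \<in> Obj A \<Longrightarrow> u \<in> elts Q x \<Longrightarrow> v \<in> elts Q x \<Longrightarrow>
      u \<oplus>\<^bsub>Val Q x\<^esub> v \<in> elts Q x \<and> h x (u \<oplus>\<^bsub>Val Q x\<^esub> v) = h x u \<oplus>\<^bsub>Val N x\<^esub> h x v"
    and smult: "x \<in> Obj A \<Longrightarrow> u \<in> elts Q x \<Longrightarrow>
      k \<odot>\<^bsub>Val Q x\<^esub> u \<in> elts Q x \<and> h x (k \<odot>\<^bsub>Val Q x\<^esub> u) = k \<odot>\<^bsub>Val N x\<^esub> h x u"
    and act: "w \<in> Obj A \<Longrightarrow> x \<in> Obj A \<Longrightarrow> u \<in> elts Q x \<Longrightarrow> a \<in> arr A w x \<Longrightarrow>
      act Q w x u a \<in> elts Q w \<and> h w (act Q w x u a) = act N w x (h x u) a"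
    and inn: "x \<in> Obj A \<Longrightarrow> y \<in> Obj A \<Longrightarrow> u \<in> elts Q y \<Longrightarrow> v \<in> elts Q x \<Longrightarrow>
      inn Q y x u v = inn N y x (h y u) (h x v)"
begin

lemma h_closed: "x \<in> Obj A \<Longrightarrow> u \<in> elts Q x \<Longrightarrow> h x u \<in> elts N x"
  using bij by (auto simp: bij_betw_def)

lemma h_eqI: "x \<in> Obj A \<Longrightarrow> u \<in> elts Q x \<Longrightarrow> v \<in> elts Q x \<Longrightarrow> h x u = h x v \<Longrightarrow> u = v"
  using bij[of x] by (auto simp: bij_betw_def dest: inj_onD)

lemma hmodule: "hmodule A Q"
proof -
  have space: "complex_space (Val Q x)" if x: "x \<in> Obj A" for x
    by (rule complex_space_transport[OF N.val[OF x] bij[OF x]]) (use zero add smult x in auto)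
  note s = zero add smult act inn h_closed
  have minus: "h x (u \<ominus>\<^bsub>Val Q x\<^esub> v) = h x u \<ominus>\<^bsub>Val N x\<^esub> h x v"
    if "x \<in> Obj A" "u \<in> elts Q x" "v \<in> elts Q x" for x u v
    using that by (simp add: cs_minus[OF space] cs_minus[OF N.val] s)
  have mnorm: "mnorm A Q x u = mnorm A N x (h x u)" if "x \<in> Obj A" "u \<in> elts Q x" for x u
    using that by (simp add: mnorm_def inn)
  have "hilbert_module A Q"
  proof (rule hilbert_module.intro)
    show "complex_space (Val Q x)" if "x \<in> Obj A" for x by (rule space[OF that])
    show "linear_on (Val Q x) (Val Q w) (\<lambda>e. act Q w x e a)" if "w \<in> Obj A" "x \<in> Obj A" "a \<in> arr A w x" for w x a
      unfolding linear_on_def using that by (auto intro!: h_eqI[of w] simp: s N.act_left)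
    show "linear_on (Hom A w x) (Val Q w) (\<lambda>a. act Q w x e a)" if "w \<in> Obj A" "x \<in> Obj A" "e \<in> elts Q x" for w x e
      unfolding linear_on_def using that by (auto intro!: h_eqI[of w] simp: s N.act_right)
    show "act Q v x e (Cmp A v w x a b) = act Q v w (act Q w x e a) b"
      if "v \<in> Obj A" "w \<in> Obj A" "x \<in> Obj A" "e \<in> elts Q x" "a \<in> arr A w x" "b \<in> arr A v w" for v w x e a b
      using that by (intro h_eqI[of v]) (auto simp: s N.act_cmp)
    show "linear_on (Val Q x) (Hom A x y) (\<lambda>f. inn Q y x e f)" if "x \<in> Obj A" "y \<in> Obj A" "e \<in> elts Q y" for x y e
      unfolding linear_on_def using that by (auto simp: s N.inn_right)
    show "conj_linear_on (Val Q y) (Hom A x y) (\<lambda>e. inn Q y x e f)" if "x \<in> Obj A" "y \<in> Obj A" "f \<in> elts Q x" for x y f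
      unfolding conj_linear_on_def using that by (auto simp: s N.inn_left)
    show "inn Q y x e f = Star A y x (inn Q x y f e)" if "x \<in> Obj A" "y \<in> Obj A" "e \<in> elts Q y" "f \<in> elts Q x" for x y e f
      using that N.inn_star[of x y "h y e" "h x f"] by (simp add: s)
    show "Cmp A w x y (inn Q y x e f) g = inn Q y w e (act Q w x f g)"
      if "w \<in> Obj A" "x \<in> Obj A" "y \<in> Obj A" "e \<in> elts Q y" "f \<in> elts Q x" "g \<in> arr A w x" for w x y e f g
      using that by (simp add: s N.inn_act)
    show "positive A x (inn Q x x e e)" if "x \<in> Obj A" "e \<in> elts Q x" for x e
      using that by (simp add: s N.inn_positive)
    show "e = \<zero>\<^bsub>Val Q x\<^esub>" if "x \<in> Obj A" "e \<in> elts Q x" "inn Q x x e e = \<zero>\<^bsub>Hom A x x\<^esub>" for x e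
      using that N.inn_definite[of x "h x e"] by (intro h_eqI[of x]) (auto simp: s)
    show "complete_in (Val Q x) (mnorm A Q x)" if x: "x \<in> Obj A" for x
      unfolding complete_in_def
    proof (intro allI impI)
      fix t assume t: "cauchy_in (Val Q x) (mnorm A Q x) t"
      then have tQ: "t n \<in> elts Q x" for n by (simp add: cauchy_in_def)
      have e: "mnorm A Q x (t m \<ominus>\<^bsub>Val Q x\<^esub> u) = mnorm A N x (h x (t m) \<ominus>\<^bsub>Val N x\<^esub> h x u)" if "u \<in> elts Q x" for m u
        using x tQ that space by (simp add: mnorm minus)
      have "cauchy_in (Val N x) (mnorm A N x) (\<lambda>n. h x (t n))"
        using t x tQ by (simp add: cauchy_in_def e h_closed)
      then obtain l where l: "l \<in> elts N x" "(\<lambda>n. mnorm A N x (h x (t n) \<ominus>\<^bsub>Val N x\<^esub> l)) \<longlonglongrightarrow> 0"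
        using N.complete[OF x] by (auto simp: complete_in_def)
      have "l \<in> h x ` elts Q x" using l(1) bij[OF x] by (simp add: bij_betw_def)
      then obtain u where u: "u \<in> elts Q x" "h x u = l" by auto
      then show "\<exists>l\<in>elts Q x. (\<lambda>n. mnorm A Q x (t n \<ominus>\<^bsub>Val Q x\<^esub> l)) \<longlonglongrightarrow> 0"
        using l u(2) by (intro bexI[OF _ u(1)]) (simp add: e[OF u(1)])
    qed
  qed
  then show ?thesis by (intro hmodule.intro N.cstar_category_axioms)
qed

text \<open>Since \<open>h\<close> preserves inner products, its inverse \<open>g\<close> is an
  adjoint: <h u, n> = <u, g n> because n = h (g n).\<close>

lemma unitary: "unitary_op A Q N (\<lambda>x\<in>Obj A. \<lambda>u\<in>elts Q x. h x u)"
proof -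
  note N = N.hmodule_axioms and Q = hmodule
  define g where "g x = inv_into (elts Q x) (h x)" for x
  define U where "U = (\<lambda>x\<in>Obj A. \<lambda>u\<in>elts Q x. h x u)"
  define S where "S = (\<lambda>x\<in>Obj A. \<lambda>u\<in>elts N x. g x u)"
  have gcl: "g x n \<in> elts Q x" and hg: "h x (g x n) = n" if "x \<in> Obj A" "n \<in> elts N x" for x n
  proof -
    have "n \<in> h x ` elts Q x" using bij[OF that(1)] that(2) by (simp add: bij_betw_def)
    then show "g x n \<in> elts Q x" "h x (g x n) = n"
      unfolding g_def by (rule inv_into_into, rule f_inv_into_f)
  qed
  have gh: "g x (h x u) = u" if "x \<in> Obj A" "u \<in> elts Q x" for x u
    using bij[OF that(1)] that unfolding g_def by (simp add: bij_betw_def)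
  have geq: "g x n = u" if "x \<in> Obj A" "u \<in> elts Q x" "n = h x u" for x n u
    using gh that by simp
  have U: "natural_transf A Q N U"
    unfolding U_def by (rule natural_transfI[OF _ _ _ _ Q]) (auto simp: h_closed add smult act)
  have S: "natural_transf A N Q S"
    unfolding S_def
    by (rule natural_transfI[OF _ _ _ _ N]) (auto intro!: geq simp: gcl hg add smult act)
  have adj: "is_adjoint A Q N U S"
    using S by (auto simp: is_adjoint_def U_def S_def inn gcl hg)
  have "U \<in> operators A Q N"
    by (rule operatorsI[OF Q N U adj, of 1]) (simp add: U_def mnorm_def inn)
  moreover have "adjoint A Q N U = S" by (rule adjoint_eq[OF Q N adj])
  moreover have "op_comp A Q S U = op_id A Q" "op_comp A N U S = op_id A N"
    by (auto simp: op_comp_def op_id_def U_def S_def gh hg h_closed gcl fun_eq_iff restrict_def)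
  ultimately show ?thesis by (simp add: unitary_op_def U_def)
qed

end

section \<open>Representable modules\<close>

lemma truncate_simps [simp]:
  "carrier (module.truncate V) = carrier V" "\<zero>\<^bsub>module.truncate V\<^esub> = \<zero>\<^bsub>V\<^esub>"
  "u \<oplus>\<^bsub>module.truncate V\<^esub> v = u \<oplus>\<^bsub>V\<^esub> v" "k \<odot>\<^bsub>module.truncate V\<^esub> v = k \<odot>\<^bsub>V\<^esub> v"
  by (simp_all add: module.truncate_def)

lemma complex_space_truncate: "complex_space V \<Longrightarrow> complex_space (module.truncate V)"
  by (rule complex_space_transport[of V "\<lambda>x. x"]) (auto simp: bij_betw_def)

lemma minus_truncate:
  "complex_space V \<Longrightarrow> u \<in> carrier V \<Longrightarrow> v \<in> carrier V \<Longrightarrow> u \<ominus>\<^bsub>module.truncate V\<^esub> v = u \<ominus>\<^bsub>V\<^esub> v"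
  by (simp add: cs_minus complex_space_truncate)

context cstar_category
begin

lemma representable_simps [simp]:
  "Val (representable C x) y = module.truncate (Hom C y x)"
  "act (representable C x) w y b a = Cmp C w y x b a"
  "inn (representable C x) z y a b = Cmp C y x z (Star C z x a) b"
  by (simp_all add: representable_def)

lemma mnorm_representable:
  "x \<in> Obj C \<Longrightarrow> y \<in> Obj C \<Longrightarrow> a \<in> arr C y x \<Longrightarrow> mnorm C (representable C x) y a = nrm (Hom C y x) a"
  by (simp add: mnorm_def cstar_identity nrm_nonneg)

text \<open>Definiteness and completeness both rest on the C*-identity, by which the module norm is
  the norm of the Hom space.\<close>

lemma representable_hmodule:
  assumes x: "x \<in> Obj C"
  shows "hmodule C (representable C x)"
proof (intro hmodule.intro cstar_category_axioms)
  show "hilbert_module C (representable C x)"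
  proof (rule hilbert_module.intro)
    show "complex_space (Val (representable C x) y)" if "y \<in> Obj C" for y
      using that x by (simp add: complex_space_truncate)
    show "linear_on (Val (representable C x) y) (Val (representable C x) w) (\<lambda>e. act (representable C x) w y e a)"
      if "w \<in> Obj C" "y \<in> Obj C" "a \<in> arr C w y" for w y a
      using that x by (auto simp: linear_on_def cmp_left)
    show "linear_on (Hom C w y) (Val (representable C x) w) (\<lambda>a. act (representable C x) w y e a)"
      if "w \<in> Obj C" "y \<in> Obj C" "e \<in> elts (representable C x) y" for w y e
      using that x by (auto simp: linear_on_def cmp_right)
    show "linear_on (Val (representable C x) z) (Hom C z y) (\<lambda>f. inn (representable C x) y z e f)"
      if "z \<in> Obj C" "y \<in> Obj C" "e \<in> elts (representable C x) y" for z y e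
      using that x by (auto simp: linear_on_def cmp_right)
    show "conj_linear_on (Val (representable C x) y) (Hom C z y) (\<lambda>e. inn (representable C x) y z e f)"
      if "z \<in> Obj C" "y \<in> Obj C" "f \<in> elts (representable C x) z" for z y f
      using that x by (auto simp: conj_linear_on_def cmp_left star_add)
    show "complete_in (Val (representable C x) y) (mnorm C (representable C x) y)" if y: "y \<in> Obj C" for y
      unfolding complete_in_def
    proof (intro allI impI)
      let ?V = "Hom C y x" and ?W = "Val (representable C x) y" and ?N = "mnorm C (representable C x) y"
      fix t assume t: "cauchy_in ?W ?N t"
      then have tV: "t n \<in> carrier ?V" for n by (simp add: cauchy_in_def)
      have e: "?N (a \<ominus>\<^bsub>?W\<^esub> b) = nrm ?V (a \<ominus>\<^bsub>?V\<^esub> b)" if "a \<in> carrier ?V" "b \<in> carrier ?V" for a b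
        using x y that by (simp add: mnorm_representable minus_truncate)
      have "cauchy_in ?V (nrm ?V) t"
        using t unfolding cauchy_in_def by (simp only: e[OF tV tV]) (simp add: tV)
      then obtain l where l: "l \<in> carrier ?V" "(\<lambda>n. nrm ?V (t n \<ominus>\<^bsub>?V\<^esub> l)) \<longlonglongrightarrow> 0"
        using banach_cspaceD(2)[OF banach[OF y x]] unfolding complete_in_def by blast
      have "(\<lambda>n. ?N (t n \<ominus>\<^bsub>?W\<^esub> l)) \<longlonglongrightarrow> 0"
        using l(2) by (simp only: e[OF tV l(1)])
      then show "\<exists>l\<in>carrier ?W. (\<lambda>n. ?N (t n \<ominus>\<^bsub>?W\<^esub> l)) \<longlonglongrightarrow> 0"
        using l(1) by auto
    qed
    show "e = \<zero>\<^bsub>Val (representable C x) y\<^esub>"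
      if "y \<in> Obj C" "e \<in> elts (representable C x) y" "inn (representable C x) y y e e = \<zero>\<^bsub>Hom C y y\<^esub>" for y e
    proof -
      have "(nrm (Hom C y x) e)\<^sup>2 = 0"
        using that x cstar_identity[of y x e] by (simp add: nrm_zero[OF banach])
      then show ?thesis using that x banach_cspaceD(4)[OF banach[of y x], of e] by simp
    qed
  qed (use x in \<open>auto simp: cmp_assoc star_cmp star_star positive_star_cmp\<close>)
qed

end

section \<open>The Yoneda embedding and the operators given by module elements\<close>

locale yoneda_universe = cstar_category A
  for A :: "('o, 'm) star_cat" and j :: "'m \<Rightarrow> 'u" +
  assumes inj_j: "inj j"
begin

abbreviation "yon \<equiv> fob (yoneda j A)"

lemma inv_j [simp]: "inv_into UNIV j (j a) = a"
  by (rule inv_f_f[OF inj_j])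

lemma yon_simps [simp]:
  "elts (yon x) y = j ` arr A y x"
  "\<zero>\<^bsub>Val (yon x) y\<^esub> = j \<zero>\<^bsub>Hom A y x\<^esub>"
  "j a \<oplus>\<^bsub>Val (yon x) y\<^esub> j b = j (a \<oplus>\<^bsub>Hom A y x\<^esub> b)"
  "k \<odot>\<^bsub>Val (yon x) y\<^esub> j b = j (k \<odot>\<^bsub>Hom A y x\<^esub> b)"
  "act (yon x) w y (j b) a = j (Cmp A w y x b a)"
  "inn (yon x) z y (j b) (j a) = Cmp A y x z (Star A z x b) a"
  by (simp_all add: yoneda_def rename_module_def rename_space_def)

lemma yoneda_far_apply [simp]:
  "z \<in> Obj A \<Longrightarrow> b \<in> arr A z x \<Longrightarrow> far (yoneda j A) x y a z (j b) = j (Cmp A z x y a b)"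
  by (simp add: yoneda_def)

lemma yon_hmodule:
  assumes x: "x \<in> Obj A"
  shows "hmodule A (yon x)"
proof (intro hmodule_iso.hmodule[of _ "representable A x" _ "\<lambda>_. inv_into UNIV j"] hmodule_iso.intro
    representable_hmodule[OF x] hmodule_iso_axioms.intro)
  show "bij_betw (inv_into UNIV j) (elts (yon x) y) (elts (representable A x) y)" for y
    by (auto simp: bij_betw_def inj_on_def image_image)
qed (use x in auto)

lemma mnorm_yon: "x \<in> Obj A \<Longrightarrow> y \<in> Obj A \<Longrightarrow> a \<in> arr A y x \<Longrightarrow> mnorm A (yon x) y (j a) = nrm (Hom A y x) a"
  by (simp add: mnorm_def cstar_identity nrm_nonneg)

text \<open>The half of the Yoneda correspondence that survives without identities: \<open>m\<close>
  yields an operator, although there may be no identity of \<open>x\<close> at which to read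
  \<open>m\<close> off again.\<close>

definition theta :: "('o, 'm, 'e) hmod \<Rightarrow> 'o \<Rightarrow> 'e \<Rightarrow> 'o \<Rightarrow> 'u \<Rightarrow> 'e" where
  "theta M x m = (\<lambda>y\<in>Obj A. \<lambda>e\<in>elts (yon x) y. act M y x m (inv_into UNIV j e))"

definition theta_adj :: "('o, 'm, 'e) hmod \<Rightarrow> 'o \<Rightarrow> 'e \<Rightarrow> 'o \<Rightarrow> 'e \<Rightarrow> 'u" where
  "theta_adj M x m = (\<lambda>y\<in>Obj A. \<lambda>n\<in>elts M y. j (inn M x y m n))"

lemma theta_apply [simp]: "y \<in> Obj A \<Longrightarrow> a \<in> arr A y x \<Longrightarrow> theta M x m y (j a) = act M y x m a"
  by (simp add: theta_def)

lemma theta_adj_apply [simp]: "y \<in> Obj A \<Longrightarrow> n \<in> elts M y \<Longrightarrow> theta_adj M x m y n = j (inn M x y m n)"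
  by (simp add: theta_adj_def)

context
  fixes M :: "('o, 'm, 'e) hmod" and x m
  assumes M: "hmodule A M" and x: "x \<in> Obj A" and m: "m \<in> elts M x"
begin

interpretation M: hmodule A M by (rule M)

lemma theta_natural: "natural_transf A (yon x) M (theta M x m)"
  unfolding theta_def
  by (rule natural_transfI[OF _ _ _ _ yon_hmodule[OF x]])
    (use x m in \<open>auto simp: M.act_right M.act_cmp\<close>)

lemma theta_adj_natural: "natural_transf A M (yon x) (theta_adj M x m)"
  unfolding theta_adj_def
  by (rule natural_transfI[OF _ _ _ _ M])
    (use x m in \<open>auto simp: M.inn_right M.inn_act\<close>)

lemma theta_is_adjoint: "is_adjoint A (yon x) M (theta M x m) (theta_adj M x m)"
  using theta_adj_natural x m by (auto simp: is_adjoint_def M.inn_act_left)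

lemma theta_operators: "theta M x m \<in> operators A (yon x) M"
proof (rule operatorsI[OF yon_hmodule[OF x] M theta_natural theta_is_adjoint])
  show "mnorm A M y (theta M x m y e) \<le> mnorm A M x m * mnorm A (yon x) y e"
    if "y \<in> Obj A" "e \<in> elts (yon x) y" for y e
    using that x m by (auto simp: mnorm_yon intro: M.mnorm_act)
qed

lemma adjoint_theta: "adjoint A (yon x) M (theta M x m) = theta_adj M x m"
  by (rule adjoint_eq[OF yon_hmodule[OF x] M theta_is_adjoint])

lemma theta_adj_operators: "theta_adj M x m \<in> operators A M (yon x)"
  using adjoint_operators(1)[OF yon_hmodule[OF x] M theta_operators] by (simp add: adjoint_theta)

lemma theta_comp:
  assumes T: "natural_transf A M N T"
  shows "op_comp A (yon x) T (theta M x m) = theta N x (T x m)"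
proof (intro ext)
  fix y e
  show "op_comp A (yon x) T (theta M x m) y e = theta N x (T x m) y e"
    using natural_transfD(3)[OF T _ x m] by (auto simp: op_comp_def theta_def restrict_def)
qed

lemma theta_add:
  assumes m': "m' \<in> elts M x"
  shows "theta M x (m \<oplus>\<^bsub>Val M x\<^esub> m') = theta M x m \<oplus>\<^bsub>operator_space A (yon x) M\<^esub> theta M x m'"
  using x m m' by (auto simp: theta_def M.act_left fun_eq_iff restrict_def)

lemma theta_smult:
  "theta M x (k \<odot>\<^bsub>Val M x\<^esub> m) = k \<odot>\<^bsub>operator_space A (yon x) M\<^esub> theta M x m"
  using x m by (auto simp: theta_def M.act_left fun_eq_iff restrict_def)

text \<open>Source of the balancing relation: under \<open>F\<close> this moves \<open>a\<close>
  from the left factor of a tensor to the right one.\<close>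

lemma theta_act:
  assumes w: "w \<in> Obj A" and a: "a \<in> arr A w x"
  shows "theta M w (act M w x m a) = op_comp A (yon w) (theta M x m) (far (yoneda j A) w x a)"
  using x m w a by (auto simp: op_comp_def theta_def M.act_cmp fun_eq_iff restrict_def inj_eq[OF inj_j])

end

text \<open>Boundedness and adjointability of Yoneda arrows thereby become a case of
  \<open>theta_operators\<close>.\<close>

lemma yoneda_far_eq: "a \<in> arr A w x \<Longrightarrow> far (yoneda j A) w x a = theta (yon x) w (j a)"
  by (auto simp: theta_def yoneda_def rename_module_def rename_space_def fun_eq_iff restrict_def)

lemma yoneda_far_operators:
  "w \<in> Obj A \<Longrightarrow> x \<in> Obj A \<Longrightarrow> a \<in> arr A w x \<Longrightarrow> far (yoneda j A) w x a \<in> operators A (yon w) (yon x)"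
  by (simp add: yoneda_far_eq theta_operators yon_hmodule)

lemma theta_adj_theta:
  assumes M: "hmodule A M" and x: "x \<in> Obj A" and m: "m \<in> elts M x"
    and w: "w \<in> Obj A" and n: "n \<in> elts M w"
  shows "op_comp A (yon w) (theta_adj M x m) (theta M w n) = far (yoneda j A) w x (inn M x w m n)"
proof -
  interpret M: hmodule A M by (rule M)
  have i: "inn M x w m n \<in> arr A w x" using x m w n by simp
  show ?thesis
    by (rule natural_transf_eqI[OF natural_transf_comp[OF yon_hmodule[OF w] theta_natural[OF M w n]
          theta_adj_natural[OF M x m]] operatorsD(1)[OF yoneda_far_operators[OF w x i]]])
      (use x m w n in \<open>auto simp: M.inn_act\<close>)
qed

text \<open>
  The operator \<open>v\<close> is \<open>(1 + \<theta> \<theta>\<^sup>*)\<^sup>-\<^sup>1\<close>, where \<open>\<theta>\<close> is given by the element \<open>m\<close>;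
  it exists because \<open>1 + \<langle>m, m\<rangle>\<close> is invertible.
\<close>

lemma single_contraction:
  assumes M: "hmodule A M" and x: "x \<in> Obj A" and m: "m \<in> elts M x"
  obtains v m' where "m' \<in> elts M x" "v \<in> operators A M M" "is_adjoint A M M v v"
    "\<And>y n. y \<in> Obj A \<Longrightarrow> n \<in> elts M y \<Longrightarrow> mnorm A M y (v y n) \<le> mnorm A M y n"
    "mnorm A M x (v x m) \<le> 1"
    "op_id A M = v \<oplus>\<^bsub>operator_space A M M\<^esub> op_comp A M (theta M x m') (theta_adj M x m)"
proof -
  interpret M: hmodule A M by (rule M)
  define a where "a = inn M x x m m"
  have aV: "a \<in> arr A x x" and sa: "Star A x x a = a"
    using M.inn_positive[OF x m] by (auto simp: a_def positive_def)
  obtain d where d: "d \<in> arr A x x" and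
    ad: "a = complex_of_real 1 \<odot>\<^bsub>Hom A x x\<^esub> d \<oplus>\<^bsub>Hom A x x\<^esub> Cmp A x x x a d"
    and da: "a = complex_of_real 1 \<odot>\<^bsub>Hom A x x\<^esub> d \<oplus>\<^bsub>Hom A x x\<^esub> Cmp A x x x d a"
    using positive_quasi_inverse[OF x M.inn_positive[OF x m], of 1] unfolding a_def by auto
  have V: "complex_space (Hom A x x)" using x by simp
  have ad: "a = d \<oplus>\<^bsub>Hom A x x\<^esub> Cmp A x x x a d" and da: "a = d \<oplus>\<^bsub>Hom A x x\<^esub> Cmp A x x x d a"
    using ad da d V by (simp_all add: cs_smult)
  \<comment> \<open>Write e for the star of d; the star of \<open>ad\<close> reads a = e + e a.
    Substituting a = d + a d into e a, and a = e + e a into a d, produces the same element, so e a =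
    a d and hence e = d.\<close>
  have sd: "Star A x x d = d"
  proof -
    let ?e = "Star A x x d"
    have e: "?e \<in> arr A x x" using d x by simp
    have ea: "a = ?e \<oplus>\<^bsub>Hom A x x\<^esub> Cmp A x x x ?e a"
      using arg_cong[OF ad, of "Star A x x"] x d aV by (simp add: star_add star_cmp sa)
    have 1: "Cmp A x x x ?e a = Cmp A x x x ?e d \<oplus>\<^bsub>Hom A x x\<^esub> Cmp A x x x (Cmp A x x x ?e a) d"
    proof -
      have "Cmp A x x x ?e a = Cmp A x x x ?e (d \<oplus>\<^bsub>Hom A x x\<^esub> Cmp A x x x a d)" using ad by simp
      also have "\<dots> = Cmp A x x x ?e d \<oplus>\<^bsub>Hom A x x\<^esub> Cmp A x x x (Cmp A x x x ?e a) d"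
        using x d aV e by (simp add: cmp_right cmp_assoc)
      finally show ?thesis .
    qed
    have 2: "Cmp A x x x a d = Cmp A x x x ?e d \<oplus>\<^bsub>Hom A x x\<^esub> Cmp A x x x (Cmp A x x x ?e a) d"
    proof -
      have "Cmp A x x x a d = Cmp A x x x (?e \<oplus>\<^bsub>Hom A x x\<^esub> Cmp A x x x ?e a) d" using ea by simp
      also have "\<dots> = Cmp A x x x ?e d \<oplus>\<^bsub>Hom A x x\<^esub> Cmp A x x x (Cmp A x x x ?e a) d"
        using x d aV e by (simp add: cmp_left)
      finally show ?thesis .
    qed
    show ?thesis
    proof (rule vec_eqI[OF V e d])
      fix \<phi> assume \<phi>: "functional_on (Hom A x x) \<phi>"
      have "\<phi> a = \<phi> d + \<phi> (Cmp A x x x a d)"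
        using arg_cong[OF ad, of \<phi>] x d aV V \<phi> by (simp add: functional_simps)
      moreover have "\<phi> a = \<phi> ?e + \<phi> (Cmp A x x x ?e a)"
        using arg_cong[OF ea, of \<phi>] x e aV V \<phi> by (simp add: functional_simps)
      ultimately show "\<phi> ?e = \<phi> d" using 1 2 by simp
    qed
  qed
  \<comment> \<open>As \<open>d\<close> stands for a (1 + a)^-1, this is m.(1 + a)^-1 written
    without 1. With t = \<open>theta M x m\<close> and adjoint t', the operator \<open>u\<close> is
    then t (1 + t' t)^-1 t' = 1 - (1 + t t')^-1.\<close>
  define m' where "m' = m \<ominus>\<^bsub>Val M x\<^esub> act M x x m d"
  have m': "m' \<in> elts M x" using x m d by (simp add: m'_def)
  define u where "u = op_comp A M (theta M x m') (theta_adj M x m)"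
  define v where "v = op_id A M \<oplus>\<^bsub>operator_space A M M\<^esub> (-1) \<odot>\<^bsub>operator_space A M M\<^esub> u"
  have u: "u \<in> operators A M M"
    unfolding u_def
    by (rule operators_comp(1)[OF M yon_hmodule[OF x] M theta_adj_operators[OF M x m] theta_operators[OF M x m']])
  have vop: "v \<in> operators A M M"
    unfolding v_def by (intro operators_add operators_smult op_id_operators M u)
  have vapp: "v y n = n \<ominus>\<^bsub>Val M y\<^esub> act M y x m' (inn M x y m n)" if "y \<in> Obj A" "n \<in> elts M y" for y n
    using that x m m' by (simp add: v_def u_def cs_minus)
  note vcl = natural_transfD(1)[OF operatorsD(1)[OF vop]]
  have mm': "inn M x x m m' = a \<ominus>\<^bsub>Hom A x x\<^esub> Cmp A x x x a d"
    using x m d by (simp add: m'_def M.inn_right M.inn_act a_def)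
  have m'm: "inn M x y m' n = inn M x y m n \<ominus>\<^bsub>Hom A y x\<^esub> Cmp A y x x d (inn M x y m n)"
    if "y \<in> Obj A" "n \<in> elts M y" for y n
    using that x m d by (simp add: m'_def M.inn_left M.inn_act_left sd)
  \<comment> \<open>Self-adjointness of \<open>d\<close> allows the factor 1 - d to sit at either
    copy of \<open>m\<close>; this symmetry is what makes \<open>v\<close> self-adjoint.\<close>
  have act_m': "act M y x m' (inn M x y m n) = act M y x m (inn M x y m' n)" if "y \<in> Obj A" "n \<in> elts M y" for y n
    using that x m d by (simp add: m'm M.act_right M.act_cmp) (simp add: m'_def M.act_left)
  have selfadj: "inn M y z (v y n) k = inn M y z n (v z k)"
    if "y \<in> Obj A" "z \<in> Obj A" "n \<in> elts M y" "k \<in> elts M z" for y z n k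
  proof -
    have "Star A y x (inn M x y m n) = inn M y x n m"
      using that x m by (simp add: M.inn_star[of x y n m])
    then have "inn M y z (act M y x m' (inn M x y m n)) k = inn M y z n (act M z x m' (inn M x z m k))"
      using that x m m' by (simp add: M.inn_act_left act_m'[of z k] M.inn_act[symmetric])
    then show ?thesis
      using that x m m' by (simp add: vapp M.inn_left M.inn_right)
  qed
  have adj: "is_adjoint A M M v v"
    using operatorsD(1)[OF vop] selfadj by (simp add: is_adjoint_def)
  \<comment> \<open>Both estimates come from one expansion. With w = m.<m, v n> one has n = v n + w,
    and each of the two cross terms equals q, the star of <m, v n> times <m, v n>. So <n,n> is a sum
    of positive terms that include <v n, v n> and q, and each of these is dominated in norm.\<close>
  have bounds: "mnorm A M y (v y n) \<le> mnorm A M y n \<and> nrm (Hom A y x) (inn M x y m (v y n)) \<le> mnorm A M y n"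
    if y: "y \<in> Obj A" and n: "n \<in> elts M y" for y n
  proof -
    let ?b = "inn M x y m n" and ?b' = "inn M x y m (v y n)" and ?vn = "v y n" and ?H = "Hom A y y"
    have H: "complex_space ?H" and W: "complex_space (Hom A y x)" using y x by auto
    have b: "?b \<in> arr A y x" and vn: "?vn \<in> elts M y" and b': "?b' \<in> arr A y x"
      using x y m n vcl by auto
    have "?b' = ?b \<ominus>\<^bsub>Hom A y x\<^esub> Cmp A y x x (a \<ominus>\<^bsub>Hom A x x\<^esub> Cmp A x x x a d) ?b"
      using x y m n m' b by (simp add: vapp M.inn_right M.inn_act[symmetric] mm')
    \<comment> \<open>This is a (1 - d) = a (1 + a)^-1 = d in terms of inverses.\<close>
    also have "a \<ominus>\<^bsub>Hom A x x\<^esub> Cmp A x x x a d = d"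
    proof (rule vec_eqI[OF V _ d])
      fix \<phi> assume \<phi>: "functional_on (Hom A x x) \<phi>"
      show "\<phi> (a \<ominus>\<^bsub>Hom A x x\<^esub> Cmp A x x x a d) = \<phi> d"
        using arg_cong[OF ad, of \<phi>] x d aV V \<phi> by (simp add: functional_simps)
    qed (use x aV d V in auto)
    finally have b'eq: "?b' = ?b \<ominus>\<^bsub>Hom A y x\<^esub> Cmp A y x x d ?b" .
    have "act M y x m' ?b = act M y x m ?b'"
      using x y m d b by (simp add: m'_def b'eq M.act_left M.act_right M.act_cmp)
    then have neq: "n = ?vn \<oplus>\<^bsub>Val M y\<^esub> act M y x m ?b'"
      using x y m m' n b b' M.val[OF y] by (intro vec_eqI[OF M.val[OF y]]) (auto simp: vapp functional_simps)
    let ?q = "Cmp A y x y (Star A y x ?b') ?b'" and ?w = "act M y x m ?b'"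
    have w: "?w \<in> elts M y" using x y m b' by simp
    have c1: "inn M y y ?w ?vn = ?q"
      using x y m vn b' by (simp add: M.inn_act_left)
    have c2: "inn M y y ?vn ?w = ?q"
      using M.inn_star[OF y y vn w] c1 x y b' by (simp add: star_cmp star_star)
    have q: "positive A y ?q" "npos y ?q" "?q \<in> arr A y y"
      using x y b' by (auto intro: positive_star_cmp positive_npos)
    have p: "positive A y (inn M y y ?vn ?vn)" "npos y (inn M y y ?vn ?vn)" "inn M y y ?vn ?vn \<in> arr A y y"
      using x y vn by (auto intro: M.inn_positive positive_npos)
    have r: "npos y (inn M y y ?w ?w)" "inn M y y ?w ?w \<in> arr A y y"
      using x y w by (auto intro: M.inn_positive positive_npos)
    have "inn M y y n n = inn M y y (?vn \<oplus>\<^bsub>Val M y\<^esub> ?w) (?vn \<oplus>\<^bsub>Val M y\<^esub> ?w)"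
      using neq by simp
    also have "\<dots> = inn M y y ?vn ?vn \<oplus>\<^bsub>?H\<^esub> (?q \<oplus>\<^bsub>?H\<^esub> (?q \<oplus>\<^bsub>?H\<^esub> inn M y y ?w ?w))"
      using y vn w c1 c2 q p r H M.val[OF y]
      by (intro vec_eqI[OF H]) (auto simp: M.inn_left M.inn_right functional_simps)
    finally have e1: "inn M y y n n = inn M y y ?vn ?vn \<oplus>\<^bsub>?H\<^esub> (?q \<oplus>\<^bsub>?H\<^esub> (?q \<oplus>\<^bsub>?H\<^esub> inn M y y ?w ?w))" .
    also have "\<dots> = ?q \<oplus>\<^bsub>?H\<^esub> (inn M y y ?vn ?vn \<oplus>\<^bsub>?H\<^esub> (?q \<oplus>\<^bsub>?H\<^esub> inn M y y ?w ?w))"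
      using q p r H by (intro vec_eqI[OF H]) (auto simp: functional_simps)
    finally have e2: "inn M y y n n = ?q \<oplus>\<^bsub>?H\<^esub> (inn M y y ?vn ?vn \<oplus>\<^bsub>?H\<^esub> (?q \<oplus>\<^bsub>?H\<^esub> inn M y y ?w ?w))" .
    have "(mnorm A M y ?vn)\<^sup>2 \<le> (mnorm A M y n)\<^sup>2"
      unfolding M.mnorm_sq[OF y n] M.mnorm_sq[OF y vn] e1
      by (rule nrm_positive_le_sum[OF y p(1)]) (intro npos_add y q r)
    moreover have "(nrm (Hom A y x) ?b')\<^sup>2 \<le> (mnorm A M y n)\<^sup>2"
      unfolding M.mnorm_sq[OF y n] e2 cstar_identity[OF y x b', symmetric]
      by (rule nrm_positive_le_sum[OF y q(1)]) (intro npos_add y q r p)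
    ultimately show ?thesis
      using M.mnorm_nonneg[OF y n] power2_le_imp_le by blast
  qed
  have vm: "v x m \<in> elts M x" using x m vcl by simp
  \<comment> \<open>Self-adjointness gives |v m|^2 = |<m, v (v m)>|, and the second estimate, taken
    at n = v m, bounds this by |v m|.\<close>
  have "mnorm A M x (v x m) * mnorm A M x (v x m) \<le> 1 * mnorm A M x (v x m)"
    using bounds[OF x vm] M.mnorm_sq[OF x vm] selfadj[OF x x m vm] by (simp add: power2_eq_square)
  then have small: "mnorm A M x (v x m) \<le> 1"
    using M.mnorm_nonneg[OF x vm] by (cases "mnorm A M x (v x m) = 0") auto
  have "op_id A M = v \<oplus>\<^bsub>operator_space A M M\<^esub> u"
  proof -
    have "n = v y n \<oplus>\<^bsub>Val M y\<^esub> u y n" if "y \<in> Obj A" "n \<in> elts M y" for y n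
      using that x m m' M.val[OF that(1)] vcl[OF that]
      by (intro vec_eqI[OF M.val[OF that(1)]]) (auto simp: vapp u_def functional_simps)
    then show ?thesis by (auto simp: op_id_def fun_eq_iff restrict_def)
  qed
  then show thesis
    using that m' vop adj bounds small unfolding u_def by blast

qed

end

section \<open>Evaluation of formal tensors\<close>

lemma op_comp_id:
  assumes T: "natural_transf A M N T"
  shows "op_comp A M (op_id A N) T = T" "op_comp A M T (op_id A M) = T"
proof -
  have "op_comp A M (op_id A N) T x e = T x e \<and> op_comp A M T (op_id A M) x e = T x e" for x e
    using natural_transfD(1,4,5)[OF T, of x]
    by (cases "x \<in> Obj A"; cases "e \<in> elts M x") (simp_all add: op_comp_def op_id_def)
  then show "op_comp A M (op_id A N) T = T" "op_comp A M T (op_id A M) = T" by auto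
qed

lemma functional_finsum:
  assumes V: "complex_space V" and \<phi>: "functional_on V \<phi>" and f: "f \<in> K \<rightarrow> carrier V" and K: "finite K"
  shows "\<phi> (finsum V f K) = (\<Sum>k\<in>K. \<phi> (f k))"
proof -
  interpret module complex_field V by (rule V)
  show ?thesis
    using K f
  proof (induction K)
    case empty
    then show ?case using V \<phi> by (simp add: functional_simps)
  next
    case (insert k K)
    then have "finsum V f K \<in> carrier V" by (intro finsum_closed) auto
    then show ?case using insert V \<phi> by (simp add: functional_simps Pi_iff)
  qed
qed

lemma functional_ev:
  assumes V: "complex_space V" and g: "g \<in> S \<rightarrow> carrier V" and \<phi>: "functional_on V \<phi>"
    and c: "Poly_Mapping.keys c \<subseteq> S"
  shows "\<phi> (ev V g c) = (\<Sum>t\<in>Poly_Mapping.keys c. Poly_Mapping.lookup c t * \<phi> (g t))"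
proof -
  have "g t \<in> carrier V" if "t \<in> Poly_Mapping.keys c" for t
    using g c that by (auto simp: Pi_iff)
  then show ?thesis
    unfolding ev_def using V \<phi>
    by (subst functional_finsum[OF V \<phi>]) (auto simp: functional_simps intro!: sum.cong)
qed

lemma ev_sum:
  assumes V: "complex_space V" and g: "g \<in> S \<rightarrow> carrier V" and \<phi>: "functional_on V \<phi>"
    and K: "finite K" and f: "\<And>k. k \<in> K \<Longrightarrow> Poly_Mapping.keys (f k) \<subseteq> S"
  shows "Poly_Mapping.keys (sum f K) \<subseteq> S" and "\<phi> (ev V g (sum f K)) = (\<Sum>k\<in>K. \<phi> (ev V g (f k)))"
proof -
  show "Poly_Mapping.keys (sum f K) \<subseteq> S"
    using f Poly_Mapping.keys_sum[of f K] by blast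
  show "\<phi> (ev V g (sum f K)) = (\<Sum>k\<in>K. \<phi> (ev V g (f k)))"
    using K f
  proof (induction K)
    case empty
    then show ?case using V \<phi> by (simp add: functional_simps ev_zero[OF V g])
  next
    case (insert k K)
    have k: "Poly_Mapping.keys (f k) \<subseteq> S" "Poly_Mapping.keys (sum f K) \<subseteq> S"
      using insert.prems Poly_Mapping.keys_sum[of f K] by blast+
    then show ?case
      using insert V \<phi> by (simp add: functional_simps ev_add[OF V g] ev_closed[OF V g])
  qed
qed

definition formal_map :: "('t \<Rightarrow> 's) \<Rightarrow> ('t \<Rightarrow>\<^sub>0 complex) \<Rightarrow> ('s \<Rightarrow>\<^sub>0 complex)" where
  "formal_map q c = (\<Sum>t\<in>Poly_Mapping.keys c. fscale (Poly_Mapping.lookup c t) (Poly_Mapping.single (q t) 1))"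

lemma keys_formal_map: "Poly_Mapping.keys (formal_map q c) \<subseteq> q ` Poly_Mapping.keys c"
proof -
  have "Poly_Mapping.keys (formal_map q c) \<subseteq> (\<Union>t\<in>Poly_Mapping.keys c. Poly_Mapping.keys (fscale (Poly_Mapping.lookup c t) (Poly_Mapping.single (q t) (1::complex))))"
    unfolding formal_map_def by (rule Poly_Mapping.keys_sum)
  also have "\<dots> \<subseteq> q ` Poly_Mapping.keys c"
    by (auto simp: fscale_simps)
  finally show ?thesis .
qed

text \<open>Common to the action of \<open>B\<close> and to operators: \<open>q\<close> changes the
  labels of pure tensors and \<open>L\<close> the values they evaluate to, and compatibility on
  labels extends by linearity.\<close>

lemma ev_formal_map:
  assumes V: "complex_space V" and W: "complex_space W"
    and g: "g \<in> S \<rightarrow> carrier V" and g': "g' \<in> S' \<rightarrow> carrier W"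
    and L: "linear_on V W L" and q: "\<And>t. t \<in> S \<Longrightarrow> q t \<in> S' \<and> g' (q t) = L (g t)"
    and c: "Poly_Mapping.keys c \<subseteq> S"
  shows "Poly_Mapping.keys (formal_map q c) \<subseteq> S'" and "ev W g' (formal_map q c) = L (ev V g c)"
proof -
  show keys: "Poly_Mapping.keys (formal_map q c) \<subseteq> S'"
    using keys_formal_map[of q c] q c by blast
  show "ev W g' (formal_map q c) = L (ev V g c)"
  proof (rule vec_eqI[OF W])
    show "ev W g' (formal_map q c) \<in> carrier W" by (rule ev_closed[OF W g' keys])
    show "L (ev V g c) \<in> carrier W" by (rule linear_onD(1)[OF L ev_closed[OF V g c]])
    fix \<phi> assume \<phi>: "functional_on W \<phi>"
    have "\<phi> (ev W g' (formal_map q c)) = (\<Sum>t\<in>Poly_Mapping.keys c. \<phi> (ev W g' (fscale (Poly_Mapping.lookup c t) (Poly_Mapping.single (q t) 1))))"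
      unfolding formal_map_def
      by (rule ev_sum(2)[OF W g' \<phi>]) (use c q in \<open>auto simp: fscale_simps\<close>)
    also have "\<dots> = (\<Sum>t\<in>Poly_Mapping.keys c. Poly_Mapping.lookup c t * \<phi> (L (g t)))"
    proof (rule sum.cong)
      fix t assume "t \<in> Poly_Mapping.keys c"
      then have t: "t \<in> S" using c by auto
      then have "L (g t) \<in> carrier W" using g linear_onD(1)[OF L] by (auto simp: Pi_iff)
      then show "\<phi> (ev W g' (fscale (Poly_Mapping.lookup c t) (Poly_Mapping.single (q t) 1))) = Poly_Mapping.lookup c t * \<phi> (L (g t))"
        using q[OF t] W \<phi> by (simp add: fscale_simps ev_single[OF W g'] functional_simps)
    qed simp
    also have "\<dots> = \<phi> (L (ev V g c))"
      using functional_ev[OF V g functional_linear[OF \<phi> L] c] by simp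
    finally show "\<phi> (ev W g' (formal_map q c)) = \<phi> (L (ev V g c))" .
  qed
qed

lemma tensor_relations_span:
  "tensor_relations A M E z = module.span (fscale :: complex \<Rightarrow> _) (basic_relations A M E z)"
  unfolding tensor_relations_def
    Modules.module.span_explicit[OF vector_space_fscale[folded module_iff_vector_space]] by auto

section \<open>Evaluating formal tensors in the image of a strong functor\<close>

locale strong_setup = yoneda_universe A j + B: cstar_category B
  for A :: "('oa, 'ma) star_cat" and B :: "('ob, 'mb) star_cat" and j :: "'ma \<Rightarrow> 'u" +
  fixes F :: "(('oa, 'ma, 'u) hmod, 'oa \<Rightarrow> 'u \<Rightarrow> 'u,
               ('ob, 'mb, 'v) hmod, 'ob \<Rightarrow> 'v \<Rightarrow> 'v) cfunctor"
    and E :: "('oa, 'ma, 'ob, 'mb, 'v) bimodule"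
  assumes F: "cstar_functor (Hilb A) (Hilb B) F"
    and F_unital: "preserves_identities (Hilb A) (Hilb B) F"
    and F_strong: "strong_functor A B F"
    and E: "E = functor_comp F (yoneda j A)"
begin

lemma E_simps [simp]:
  "fob E x = fob F (yon x)"
  "far E x y a = far F (yon x) (yon y) (far (yoneda j A) x y a)"
  by (simp_all add: E functor_comp_def)

lemma hilbD: "hmodule A M \<Longrightarrow> hilbert_module A M"
  by (simp add: hmodule_def)

lemma F_hmodule: "hmodule A M \<Longrightarrow> hmodule B (fob F M)"
  using F B.cstar_category_axioms by (auto simp: cstar_functor_def hmodule_def)

context
  fixes M N :: "('oa, 'ma, 'u) hmod"
  assumes M: "hmodule A M" and N: "hmodule A N"
begin

lemma F_linear: "linear_on (operator_space A M N) (operator_space B (fob F M) (fob F N)) (far F M N)"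
  using F hilbD[OF M] hilbD[OF N] by (auto simp: cstar_functor_def)

lemma F_operators: "T \<in> operators A M N \<Longrightarrow> far F M N T \<in> operators B (fob F M) (fob F N)"
  using linear_onD(1)[OF F_linear] by simp

lemma F_natural: "T \<in> operators A M N \<Longrightarrow> natural_transf B (fob F M) (fob F N) (far F M N T)"
  using F_operators operatorsD(1) by blast

lemma F_add:
  assumes "S \<in> operators A M N" "T \<in> operators A M N" "z \<in> Obj B" "e \<in> elts (fob F M) z"
  shows "far F M N (S \<oplus>\<^bsub>operator_space A M N\<^esub> T) z e = far F M N S z e \<oplus>\<^bsub>Val (fob F N) z\<^esub> far F M N T z e"
  using linear_onD(2)[OF F_linear, of S T] assms by simp

lemma F_smult:
  assumes "T \<in> operators A M N" "z \<in> Obj B" "e \<in> elts (fob F M) z"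
  shows "far F M N (k \<odot>\<^bsub>operator_space A M N\<^esub> T) z e = k \<odot>\<^bsub>Val (fob F N) z\<^esub> far F M N T z e"
  using linear_onD(3)[OF F_linear, of T k] assms by simp

lemma F_adjoint: "T \<in> operators A M N \<Longrightarrow> far F N M (adjoint A M N T) = adjoint B (fob F M) (fob F N) (far F M N T)"
  using F hilbD[OF M] hilbD[OF N] by (simp add: cstar_functor_def)

end

lemma F_comp:
  assumes "hmodule A M" "hmodule A N" "hmodule A L" "T \<in> operators A M N" "S \<in> operators A N L"
  shows "far F M L (op_comp A M S T) = op_comp B (fob F M) (far F N L S) (far F M N T)"
  using F assms(4,5) hilbD[OF assms(1)] hilbD[OF assms(2)] hilbD[OF assms(3)]
  by (simp add: cstar_functor_def)

text \<open>\<open>is_identity\<close> speaks about composites, not values. Composing with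
  \<open>op_id\<close> and applying both sides to an element recovers the value.\<close>

lemma F_id:
  assumes M: "hmodule A M" and z: "z \<in> Obj B" and f: "f \<in> elts (fob F M) z"
  shows "far F M M (op_id A M) z f = f"
proof -
  have "is_identity (Hilb A) M (op_id A M)"
    using op_id_operators(1)[OF M] op_comp_id operatorsD(1)
    by (simp add: is_identity_def) blast
  then have "is_identity (Hilb B) (fob F M) (far F M M (op_id A M))"
    using F_unital hilbD[OF M] by (simp add: preserves_identities_def)
  then have "op_comp B (fob F M) (far F M M (op_id A M)) (op_id B (fob F M)) = op_id B (fob F M)"
    using op_id_operators(1)[OF F_hmodule[OF M]] F_hmodule[OF M] by (simp add: is_identity_def hmodule_def)
  from fun_cong[OF fun_cong[OF this, of z], of f] show ?thesis
    using z f by simp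
qed

text \<open>Operators are extensional, so one that vanishes on the carriers equals 0 times itself,
  and linearity of \<open>F\<close> applies.\<close>

lemma F_zero:
  assumes M: "hmodule A M" and N: "hmodule A N" and z: "z \<in> Obj B" and f: "f \<in> elts (fob F M) z"
    and T: "T \<in> operators A M N" and T0: "\<And>x e. x \<in> Obj A \<Longrightarrow> e \<in> elts M x \<Longrightarrow> T x e = \<zero>\<^bsub>Val N x\<^esub>"
  shows "far F M N T z f = \<zero>\<^bsub>Val (fob F N) z\<^esub>"
proof -
  interpret N: hmodule A N by (rule N)
  interpret FN: hmodule B "fob F N" by (rule F_hmodule[OF N])
  have "0 \<odot>\<^bsub>operator_space A M N\<^esub> T = T"
    using natural_transfD(4,5)[OF operatorsD(1)[OF T]] T0
    by (auto simp: fun_eq_iff restrict_def cs_smult)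
  then have "far F M N T z f = 0 \<odot>\<^bsub>Val (fob F N) z\<^esub> far F M N T z f"
    using F_smult[OF M N T z f, of 0] by simp
  also have "\<dots> = \<zero>\<^bsub>Val (fob F N) z\<^esub>"
    using natural_transfD(1)[OF F_natural[OF M N T] z f] z by (simp add: cs_smult)
  finally show ?thesis .
qed

definition pure_val :: "('oa, 'ma, 'u) hmod \<Rightarrow> 'ob \<Rightarrow> 'oa \<times> 'u \<times> 'v \<Rightarrow> 'v" where
  "pure_val M z = (\<lambda>(x, m, e). far F (yon x) M (theta M x m) z e)"

definition pures :: "('oa, 'ma, 'u) hmod \<Rightarrow> 'ob \<Rightarrow> ('oa \<times> 'u \<times> 'v) set" where
  "pures M z = {(x, m, e). x \<in> Obj A \<and> m \<in> elts M x \<and> e \<in> elts (fob F (yon x)) z}"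

text \<open>The map \<open>m \<otimes> e \<mapsto> F(\<theta>\<^sub>m)(e)\<close>, where \<open>\<theta>\<^sub>m\<close> sends \<open>a\<close> to \<open>m \<cdot> a\<close>.\<close>

definition tensor_val :: "('oa, 'ma, 'u) hmod \<Rightarrow> 'ob \<Rightarrow> ('oa, 'u, 'v) formal \<Rightarrow> 'v" where
  "tensor_val M z c = ev (Val (fob F M) z) (pure_val M z) c"

lemma formal_tensors_eq: "formal_tensors A M E z = {c. Poly_Mapping.keys c \<subseteq> pures M z}"
  by (simp add: formal_tensors_def pures_def)

context
  fixes M :: "('oa, 'ma, 'u) hmod" and z :: 'ob
  assumes M: "hmodule A M" and z: "z \<in> Obj B"
begin

interpretation M: hmodule A M by (rule M)
interpretation FM: hmodule B "fob F M" by (rule F_hmodule[OF M])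

lemma pure_val_closed: "pure_val M z \<in> pures M z \<rightarrow> elts (fob F M) z"
  unfolding pure_val_def pures_def
  by (auto intro!: natural_transfD(1)[OF F_natural[OF yon_hmodule M theta_operators[OF M]] z])

lemma FMz: "complex_space (Val (fob F M) z)"
  using z by simp

lemma tensor_val_closed: "c \<in> formal_tensors A M E z \<Longrightarrow> tensor_val M z c \<in> elts (fob F M) z"
  unfolding tensor_val_def formal_tensors_eq by (simp add: ev_closed[OF FMz pure_val_closed])

lemma tensor_val_add:
  "c \<in> formal_tensors A M E z \<Longrightarrow> d \<in> formal_tensors A M E z \<Longrightarrow>
    tensor_val M z (c + d) = tensor_val M z c \<oplus>\<^bsub>Val (fob F M) z\<^esub> tensor_val M z d"
  unfolding tensor_val_def formal_tensors_eq by (simp add: ev_add[OF FMz pure_val_closed])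

lemma tensor_val_diff:
  "c \<in> formal_tensors A M E z \<Longrightarrow> d \<in> formal_tensors A M E z \<Longrightarrow>
    tensor_val M z (c - d) = tensor_val M z c \<ominus>\<^bsub>Val (fob F M) z\<^esub> tensor_val M z d"
  unfolding tensor_val_def formal_tensors_eq by (simp add: ev_diff[OF FMz pure_val_closed])

lemma tensor_val_fscale:
  "c \<in> formal_tensors A M E z \<Longrightarrow> tensor_val M z (fscale k c) = k \<odot>\<^bsub>Val (fob F M) z\<^esub> tensor_val M z c"
  unfolding tensor_val_def formal_tensors_eq by (simp add: ev_fscale[OF FMz pure_val_closed])

lemma tensor_val_pure:
  "x \<in> Obj A \<Longrightarrow> m \<in> elts M x \<Longrightarrow> e \<in> elts (fob F (yon x)) z \<Longrightarrow>
    tensor_val M z (pure x m e) = far F (yon x) M (theta M x m) z e"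
  using ev_single[OF FMz pure_val_closed, of "(x, m, e)" 1] pure_val_closed
  by (auto simp: tensor_val_def pures_def pure_val_def cs_smult[OF FMz] Pi_iff)

lemma formal_tensors_closed:
  "0 \<in> formal_tensors A M E z"
  "c \<in> formal_tensors A M E z \<Longrightarrow> d \<in> formal_tensors A M E z \<Longrightarrow> c + d \<in> formal_tensors A M E z"
  "c \<in> formal_tensors A M E z \<Longrightarrow> d \<in> formal_tensors A M E z \<Longrightarrow> c - d \<in> formal_tensors A M E z"
  "c \<in> formal_tensors A M E z \<Longrightarrow> fscale k c \<in> formal_tensors A M E z"
  "x \<in> Obj A \<Longrightarrow> m \<in> elts M x \<Longrightarrow> e \<in> elts (fob F (yon x)) z \<Longrightarrow> pure x m e \<in> formal_tensors A M E z"
  using Poly_Mapping.keys_add[of c d] Poly_Mapping.keys_diff[of c d] keys_fscale[of k c]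
  by (auto simp: formal_tensors_eq pures_def)

text \<open>Each kind of relation has its own source. Linearity on the left comes from linearity of
  \<open>theta\<close> in \<open>m\<close> and of \<open>F\<close> on operators, linearity on the
  right from the operators that \<open>F\<close> produces, and balancing from
  \<open>theta_act\<close> with functoriality.\<close>

lemma basic_relations_val:
  assumes "r \<in> basic_relations A M E z"
  shows "r \<in> formal_tensors A M E z \<and> tensor_val M z r = \<zero>\<^bsub>Val (fob F M) z\<^esub>"
proof -
  have yz: "complex_space (Val (fob F (yon x)) z)" if "x \<in> Obj A" for x
    using F_hmodule[OF yon_hmodule[OF that]] z by (simp add: hmodule.val)
  note v = tensor_val_diff tensor_val_pure tensor_val_fscale tensor_val_closed formal_tensors_closed
  note nat = F_natural[OF yon_hmodule M theta_operators[OF M]]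
  note cl = natural_transfD(1)[OF nat]
  show ?thesis
    using assms unfolding basic_relations_def E_simps(1)
  proof (elim UnE CollectE exE conjE, goal_cases)
    case (1 x m m' e)
    have eq: "far F (yon x) M (theta M x (m \<oplus>\<^bsub>Val M x\<^esub> m')) z e
        = far F (yon x) M (theta M x m) z e \<oplus>\<^bsub>Val (fob F M) z\<^esub> far F (yon x) M (theta M x m') z e"
      unfolding theta_add[OF M 1(2-4)]
      by (rule F_add[OF yon_hmodule M theta_operators[OF M] theta_operators[OF M]]) (use 1 z in auto)
    have "tensor_val M z r = \<zero>\<^bsub>Val (fob F M) z\<^esub>"
      using 1 FMz cl[OF _ _ _ z] by (simp add: v eq) (intro vec_eqI[OF FMz]; simp add: functional_simps)
    then show ?thesis using 1 by (simp add: v)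
  next
    case (2 x m e e')
    have eq: "far F (yon x) M (theta M x m) z (e \<oplus>\<^bsub>Val (fob F (yon x)) z\<^esub> e')
        = far F (yon x) M (theta M x m) z e \<oplus>\<^bsub>Val (fob F M) z\<^esub> far F (yon x) M (theta M x m) z e'"
      by (rule natural_transf_linear(1)[OF nat]) (use 2 z in auto)
    have "tensor_val M z r = \<zero>\<^bsub>Val (fob F M) z\<^esub>"
      using 2 FMz yz cl[OF _ _ _ z] by (simp add: v eq) (intro vec_eqI[OF FMz]; simp add: functional_simps)
    then show ?thesis using 2 yz by (simp add: v)
  next
    case (3 x k m e)
    have eq: "far F (yon x) M (theta M x (k \<odot>\<^bsub>Val M x\<^esub> m)) z e
        = k \<odot>\<^bsub>Val (fob F M) z\<^esub> far F (yon x) M (theta M x m) z e"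
      unfolding theta_smult[OF M 3(2,3)]
      by (rule F_smult[OF yon_hmodule M theta_operators[OF M]]) (use 3 z in auto)
    have "tensor_val M z r = \<zero>\<^bsub>Val (fob F M) z\<^esub>"
      using 3 FMz cl[OF _ _ _ z] by (simp add: v eq cs_minus_eq_zero)
    then show ?thesis using 3 by (simp add: v)
  next
    case (4 x k m e)
    have eq: "far F (yon x) M (theta M x m) z (k \<odot>\<^bsub>Val (fob F (yon x)) z\<^esub> e)
        = k \<odot>\<^bsub>Val (fob F M) z\<^esub> far F (yon x) M (theta M x m) z e"
      by (rule natural_transf_linear(2)[OF nat]) (use 4 z in auto)
    have "tensor_val M z r = \<zero>\<^bsub>Val (fob F M) z\<^esub>"
      using 4 FMz yz cl[OF _ _ _ z] by (simp add: v eq cs_minus_eq_zero)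
    then show ?thesis using 4 yz by (simp add: v)
  next
    case (5 w x m a e)
    let ?Y = "far (yoneda j A) w x a"
    have Y: "?Y \<in> operators A (yon w) (yon x)"
      using yoneda_far_operators[OF 5(2,3,5)] .
    have e': "far E w x a z e \<in> elts (fob F (yon x)) z"
      using natural_transfD(1)[OF F_natural[OF yon_hmodule yon_hmodule Y] z 5(6)] 5 by simp
    have eq: "far F (yon w) M (theta M w (act M w x m a)) z e = far F (yon x) M (theta M x m) z (far E w x a z e)"
      unfolding theta_act[OF M 5(3,4,2,5)]
      using F_comp[OF yon_hmodule yon_hmodule M Y theta_operators[OF M 5(3,4)]] 5 z by simp
    have "tensor_val M z r = \<zero>\<^bsub>Val (fob F M) z\<^esub>"
      using 5 e' FMz cl[OF _ _ _ z] by (simp add: v eq cs_minus_eq_zero del: E_simps)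
    then show ?thesis using 5 e' by (simp add: v del: E_simps)
  qed
qed

lemma tensor_relations_val:
  assumes "r \<in> tensor_relations A M E z"
  shows "r \<in> formal_tensors A M E z" "tensor_val M z r = \<zero>\<^bsub>Val (fob F M) z\<^esub>"
proof -
  interpret W: vector_space "fscale :: complex \<Rightarrow> ('oa, 'u, 'v) formal \<Rightarrow> _" by (rule vector_space_fscale)
  let ?R = "{r \<in> formal_tensors A M E z. tensor_val M z r = \<zero>\<^bsub>Val (fob F M) z\<^esub>}"
  have "W.span (basic_relations A M E z) \<subseteq> ?R"
  proof (rule W.span_minimal)
    show "basic_relations A M E z \<subseteq> ?R" using basic_relations_val by auto
    show "W.subspace ?R"
    proof (rule W.subspaceI)
      show "0 \<in> ?R" using formal_tensors_closed(1) by (simp add: tensor_val_def ev_zero[OF FMz pure_val_closed])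
      show "c + d \<in> ?R" if "c \<in> ?R" "d \<in> ?R" for c d
        using that FMz abelian_groupE(5)[of "Val (fob F M) z"]
        by (simp add: tensor_val_add formal_tensors_closed module_def)
      show "fscale k c \<in> ?R" if "c \<in> ?R" for k c
        using that FMz by (simp add: tensor_val_fscale formal_tensors_closed cs_smult)
    qed
  qed
  then have "r \<in> ?R" using assms by (auto simp: tensor_relations_span)
  then show "r \<in> formal_tensors A M E z" "tensor_val M z r = \<zero>\<^bsub>Val (fob F M) z\<^esub>" by auto
qed

end

text \<open>Because \<open>F\<close> preserves involutions, the adjoint of F applied to
  \<open>theta\<close> is F applied to \<open>theta_adj\<close>; \<open>theta_adj_theta\<close> then
  identifies the product on pure tensors. The sesquilinear extension is compared through
  functionals.\<close>

lemma formal_inn_val: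
  assumes M: "hmodule A M" and z: "z \<in> Obj B" and y: "y \<in> Obj B"
    and c: "c \<in> formal_tensors A M E y" and d: "d \<in> formal_tensors A M E z"
  shows "formal_inn B M E y z c d = inn (fob F M) y z (tensor_val M y c) (tensor_val M z d)"
proof -
  interpret M: hmodule A M by (rule M)
  interpret FM: hmodule B "fob F M" by (rule F_hmodule[OF M])
  have H: "complex_space (Hom B z y)" using z y by simp
  let ?gc = "pure_val M y" and ?gd = "pure_val M z"
  have c': "Poly_Mapping.keys c \<subseteq> pures M y" and d': "Poly_Mapping.keys d \<subseteq> pures M z"
    using c d by (auto simp: formal_tensors_eq)
  note gc = pure_val_closed[OF M y] and gd = pure_val_closed[OF M z]
  have gcl: "t \<in> Poly_Mapping.keys c \<Longrightarrow> ?gc t \<in> elts (fob F M) y" "s \<in> Poly_Mapping.keys d \<Longrightarrow> ?gd s \<in> elts (fob F M) z" for t s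
    using c' d' gc gd by (auto simp: Pi_iff)
  have pt: "inn (fob E x) y z e (far E x' x (inn M x x' m m') z e') = inn (fob F M) y z (?gc (x, m, e)) (?gd (x', m', e'))"
    if "(x, m, e) \<in> pures M y" "(x', m', e') \<in> pures M z" for x m e x' m' e'
  proof -
    have x: "x \<in> Obj A" "m \<in> elts M x" "e \<in> elts (fob F (yon x)) y"
      and x': "x' \<in> Obj A" "m' \<in> elts M x'" "e' \<in> elts (fob F (yon x')) z"
      using that by (auto simp: pures_def)
    note Y = yon_hmodule[OF x(1)] yon_hmodule[OF x'(1)]
    note th = theta_operators[OF M x(1,2)] and th' = theta_operators[OF M x'(1,2)]
    note FY = F_hmodule[OF Y(1)]
    have adj: "is_adjoint B (fob F (yon x)) (fob F M) (far F (yon x) M (theta M x m)) (far F M (yon x) (theta_adj M x m))"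
      using adjoint_is_adjoint[OF FY F_hmodule[OF M] F_operators[OF Y(1) M th]]
      by (simp add: F_adjoint[OF Y(1) M th, symmetric] adjoint_theta[OF M x(1,2)])
    have f: "?gd (x', m', e') \<in> elts (fob F M) z" using that(2) gd by (auto simp: Pi_iff)
    have "inn (fob F M) y z (?gc (x, m, e)) (?gd (x', m', e'))
        = inn (fob F (yon x)) y z e (far F M (yon x) (theta_adj M x m) z (?gd (x', m', e')))"
      using is_adjointD(2)[OF adj z y x(3) f] by (simp add: pure_val_def)
    also have "far F M (yon x) (theta_adj M x m) z (?gd (x', m', e'))
        = op_comp B (fob F (yon x')) (far F M (yon x) (theta_adj M x m)) (far F (yon x') M (theta M x' m')) z e'"
      using z x' by (simp add: pure_val_def)
    also have "\<dots> = far E x' x (inn M x x' m m') z e'"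
      using F_comp[OF Y(2) M Y(1) th' theta_adj_operators[OF M x(1,2)]]
        theta_adj_theta[OF M x(1,2) x'(1,2)] by simp
    finally show ?thesis by simp
  qed
  show ?thesis
  proof (rule vec_eqI[OF H])
    let ?f = "\<lambda>(t, s). (cnj (Poly_Mapping.lookup c t) * Poly_Mapping.lookup d s) \<odot>\<^bsub>Hom B z y\<^esub> inn (fob F M) y z (?gc t) (?gd s)"
    let ?K = "Poly_Mapping.keys c \<times> Poly_Mapping.keys d"
    interpret H: module complex_field "Hom B z y" by (rule H)
    have fcl: "?f \<in> ?K \<rightarrow> carrier (Hom B z y)"
      using gcl z y by auto
    have fi: "formal_inn B M E y z c d = finsum (Hom B z y) ?f ?K"
      unfolding formal_inn_def
    proof (rule H.finsum_cong'[OF refl fcl], goal_cases)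
      case (1 p)
      obtain x m e x' m' e' where [simp]: "p = ((x, m, e), (x', m', e'))" by (metis prod.collapse)
      have q: "(x, m, e) \<in> pures M y" "(x', m', e') \<in> pures M z" using 1 c' d' by auto
      show ?case
        using pt[OF q] by simp
    qed
    show "formal_inn B M E y z c d \<in> carrier (Hom B z y)"
      unfolding fi by (rule H.finsum_closed[OF fcl])
    note cv = tensor_val_closed[OF M y c] and dv = tensor_val_closed[OF M z d]
    show "inn (fob F M) y z (tensor_val M y c) (tensor_val M z d) \<in> carrier (Hom B z y)"
      using cv dv z y by simp
    fix \<phi> assume \<phi>: "functional_on (Hom B z y) \<phi>"
    have 1: "functional_on (Val (fob F M) z) (\<lambda>f. \<phi> (inn (fob F M) y z (tensor_val M y c) f))"
      using cv z y H \<phi> by (auto simp: functional_on_def[of "Val _ _"] FM.inn_right functional_simps)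
    \<comment> \<open>The inner product is conjugate linear on the left; conjugating its value
      restores linearity, so that \<open>functional_ev\<close> applies.\<close>
    have 2: "functional_on (Val (fob F M) y) (\<lambda>e. cnj (\<phi> (inn (fob F M) y z e (?gd s))))" if "s \<in> Poly_Mapping.keys d" for s
      using gcl(2)[OF that] z y H \<phi> by (auto simp: functional_on_def[of "Val _ _"] FM.inn_left functional_simps)
    have 3: "\<phi> (inn (fob F M) y z (tensor_val M y c) (?gd s)) = (\<Sum>t\<in>Poly_Mapping.keys c. cnj (Poly_Mapping.lookup c t) * \<phi> (inn (fob F M) y z (?gc t) (?gd s)))"
      if "s \<in> Poly_Mapping.keys d" for s
      using arg_cong[OF functional_ev[OF FMz[OF M y] gc 2[OF that] c'], of cnj]
      by (simp add: tensor_val_def)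
    have "\<phi> (formal_inn B M E y z c d) = (\<Sum>(t, s)\<in>?K. cnj (Poly_Mapping.lookup c t) * Poly_Mapping.lookup d s * \<phi> (inn (fob F M) y z (?gc t) (?gd s)))"
      unfolding fi using functional_finsum[OF H \<phi> fcl] gcl z y H \<phi>
      by (auto simp: functional_simps intro!: sum.cong)
    also have "\<dots> = (\<Sum>s\<in>Poly_Mapping.keys d. \<Sum>t\<in>Poly_Mapping.keys c. cnj (Poly_Mapping.lookup c t) * Poly_Mapping.lookup d s * \<phi> (inn (fob F M) y z (?gc t) (?gd s)))"
      unfolding sum.cartesian_product[symmetric] by (rule sum.swap)
    also have "\<dots> = (\<Sum>s\<in>Poly_Mapping.keys d. Poly_Mapping.lookup d s * \<phi> (inn (fob F M) y z (tensor_val M y c) (?gd s)))"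
      by (rule sum.cong) (simp_all add: 3 sum_distrib_left algebra_simps)
    also have "\<dots> = \<phi> (inn (fob F M) y z (tensor_val M y c) (tensor_val M z d))"
      using functional_ev[OF FMz[OF M z] gd 1 d'] by (simp add: tensor_val_def)
    finally show "\<phi> (formal_inn B M E y z c d) = \<phi> (inn (fob F M) y z (tensor_val M y c) (tensor_val M z d))" .
  qed
qed

lemma formal_act_val:
  assumes M: "hmodule A M" and z: "z \<in> Obj B" and y: "y \<in> Obj B" and b: "b \<in> arr B y z"
    and c: "c \<in> formal_tensors A M E z"
  shows "formal_act E y z c b \<in> formal_tensors A M E y"
    and "tensor_val M y (formal_act E y z c b) = act (fob F M) y z (tensor_val M z c) b"
proof -
  interpret FM: hmodule B "fob F M" by (rule F_hmodule[OF M])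
  let ?q = "\<lambda>(x, m, e). (x, m, act (fob F (yon x)) y z e b)"
  have eq: "formal_act E y z c b = formal_map ?q c"
    unfolding formal_act_def formal_map_def by (intro sum.cong) auto
  have q: "?q t \<in> pures M y \<and> pure_val M y (?q t) = act (fob F M) y z (pure_val M z t) b" if "t \<in> pures M z" for t
  proof -
    obtain x m e where [simp]: "t = (x, m, e)" by (metis prod.collapse)
    have x: "x \<in> Obj A" "m \<in> elts M x" "e \<in> elts (fob F (yon x)) z" using that by (auto simp: pures_def)
    interpret FY: hmodule B "fob F (yon x)" by (rule F_hmodule[OF yon_hmodule[OF x(1)]])
    have "act (fob F (yon x)) y z e b \<in> elts (fob F (yon x)) y" using x z y b by simp
    then show ?thesis
      using x natural_transfD(3)[OF F_natural[OF yon_hmodule[OF x(1)] M theta_operators[OF M x(1,2)]] y z x(3) b]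
      by (simp add: pures_def pure_val_def)
  qed
  have c': "Poly_Mapping.keys c \<subseteq> pures M z" using c by (simp add: formal_tensors_eq)
  note e = ev_formal_map[OF FMz[OF M z] FMz[OF M y] pure_val_closed[OF M z] pure_val_closed[OF M y]
      FM.act_linear_left[OF y z b] q c']
  show "formal_act E y z c b \<in> formal_tensors A M E y"
    using e(1) by (simp add: eq formal_tensors_eq)
  show "tensor_val M y (formal_act E y z c b) = act (fob F M) y z (tensor_val M z c) b"
    using e(2) by (simp add: eq tensor_val_def)
qed

definition formal_op :: "('oa \<Rightarrow> 'u \<Rightarrow> 'u) \<Rightarrow> ('oa, 'u, 'v) formal \<Rightarrow> ('oa, 'u, 'v) formal" where
  "formal_op T c = formal_map (\<lambda>(x, m, e). (x, T x m, e)) c"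

text \<open>By \<open>theta_comp\<close>, applying \<open>T\<close> to \<open>m\<close> is composing
  \<open>theta\<close> with \<open>T\<close>, and functoriality does the rest. This is the
  naturality of the final isomorphism before completion.\<close>

lemma formal_op_val:
  assumes M: "hmodule A M" and N: "hmodule A N" and z: "z \<in> Obj B" and T: "T \<in> operators A M N"
    and c: "c \<in> formal_tensors A M E z"
  shows "formal_op T c \<in> formal_tensors A N E z"
    and "tensor_val N z (formal_op T c) = far F M N T z (tensor_val M z c)"
proof -
  let ?q = "\<lambda>(x, m, e). (x, T x m, e)"
  have q: "?q t \<in> pures N z \<and> pure_val N z (?q t) = far F M N T z (pure_val M z t)" if "t \<in> pures M z" for t
  proof -
    obtain x m e where [simp]: "t = (x, m, e)" by (metis prod.collapse)
    have x: "x \<in> Obj A" "m \<in> elts M x" "e \<in> elts (fob F (yon x)) z" using that by (auto simp: pures_def)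
    have Tm: "T x m \<in> elts N x" using natural_transfD(1)[OF operatorsD(1)[OF T]] x by simp
    have "far F (yon x) N (theta N x (T x m)) z e = far F M N T z (far F (yon x) M (theta M x m) z e)"
      using F_comp[OF yon_hmodule[OF x(1)] M N theta_operators[OF M x(1,2)] T] x z
      by (simp add: theta_comp[OF M x(1,2) operatorsD(1)[OF T], symmetric])
    then show ?thesis using x Tm by (simp add: pures_def pure_val_def)
  qed
  have c': "Poly_Mapping.keys c \<subseteq> pures M z" using c by (simp add: formal_tensors_eq)
  note e = ev_formal_map[OF FMz[OF M z] FMz[OF N z] pure_val_closed[OF M z] pure_val_closed[OF N z]
      natural_transfD(2)[OF F_natural[OF M N T] z] q c']
  show "formal_op T c \<in> formal_tensors A N E z"
    using e(1) by (simp add: formal_op_def formal_tensors_eq)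
  show "tensor_val N z (formal_op T c) = far F M N T z (tensor_val M z c)"
    using e(2) by (simp add: formal_op_def tensor_val_def)
qed

end

section \<open>Density of the algebraic tensors\<close>

context strong_setup
begin

text \<open>Phrased as a congruence modulo the range of \<open>tensor_val\<close> so that it can be
  chained along products of operators.\<close>

definition cong_tensors :: "('oa, 'ma, 'u) hmod \<Rightarrow> 'ob \<Rightarrow> 'v \<Rightarrow> 'v \<Rightarrow> bool" where
  "cong_tensors M z f g \<longleftrightarrow>
     (\<exists>c\<in>formal_tensors A M E z. f = g \<oplus>\<^bsub>Val (fob F M) z\<^esub> tensor_val M z c)"

text \<open>
  The contractions \<open>v\<close> such that \<open>1 - F(v)\<close> has range in the algebraic tensors. Strong continuity
  of \<open>F\<close> is applied to a net of these which tends strongly to 0.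
\<close>

definition good :: "('oa, 'ma, 'u) hmod \<Rightarrow> ('oa \<Rightarrow> 'u \<Rightarrow> 'u) \<Rightarrow> bool" where
  "good M v \<longleftrightarrow> v \<in> operators A M M \<and> is_adjoint A M M v v \<and>
     (\<forall>x\<in>Obj A. \<forall>n\<in>elts M x. mnorm A M x (v x n) \<le> mnorm A M x n) \<and>
     (\<forall>z\<in>Obj B. \<forall>f\<in>elts (fob F M) z. cong_tensors M z f (far F M M v z f))"

context
  fixes M :: "('oa, 'ma, 'u) hmod"
  assumes M: "hmodule A M"
begin

interpretation M: hmodule A M by (rule M)
interpretation FM: hmodule B "fob F M" by (rule F_hmodule[OF M])

lemma cong_tensors_refl:
  assumes z: "z \<in> Obj B" and f: "f \<in> elts (fob F M) z"
  shows "cong_tensors M z f f"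
  unfolding cong_tensors_def
proof (rule bexI[of _ 0])
  show "f = f \<oplus>\<^bsub>Val (fob F M) z\<^esub> tensor_val M z 0"
    by (rule vec_eqI[OF FM.val[OF z]])
      (use z f FM.val[OF z] in \<open>auto simp: tensor_val_def ev_zero[OF FM.val pure_val_closed[OF M]] functional_simps\<close>)
qed (rule formal_tensors_closed[OF M z])

lemma cong_tensors_trans:
  assumes z: "z \<in> Obj B" and k: "k \<in> elts (fob F M) z"
    and fg: "cong_tensors M z f g" and gk: "cong_tensors M z g k"
  shows "cong_tensors M z f k"
proof -
  obtain c d where c: "c \<in> formal_tensors A M E z" "f = g \<oplus>\<^bsub>Val (fob F M) z\<^esub> tensor_val M z c"
    and d: "d \<in> formal_tensors A M E z" "g = k \<oplus>\<^bsub>Val (fob F M) z\<^esub> tensor_val M z d"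
    using fg gk unfolding cong_tensors_def by blast
  note t = tensor_val_closed[OF M z]
  have "f = k \<oplus>\<^bsub>Val (fob F M) z\<^esub> tensor_val M z (d + c)"
    unfolding c(2) d(2) tensor_val_add[OF M z d(1) c(1)]
    by (rule vec_eqI[OF FM.val[OF z]]) (use k t c(1) d(1) FM.val[OF z] in \<open>auto simp: functional_simps\<close>)
  then show ?thesis
    using formal_tensors_closed(2)[OF M z d(1) c(1)] unfolding cong_tensors_def by blast
qed

text \<open>F(T) maps the range of the algebraic tensors into itself, through
  \<open>formal_op\<close>.\<close>

lemma cong_tensors_op:
  assumes z: "z \<in> Obj B" and T: "T \<in> operators A M M" and g: "g \<in> elts (fob F M) z"
    and fg: "cong_tensors M z f g"
  shows "cong_tensors M z (far F M M T z f) (far F M M T z g)"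
proof -
  obtain c where c: "c \<in> formal_tensors A M E z" "f = g \<oplus>\<^bsub>Val (fob F M) z\<^esub> tensor_val M z c"
    using fg unfolding cong_tensors_def by blast
  note op = formal_op_val[OF M M z T c(1)]
  have "far F M M T z f = far F M M T z g \<oplus>\<^bsub>Val (fob F M) z\<^esub> tensor_val M z (formal_op T c)"
    unfolding c(2) op(2)
    by (rule natural_transf_linear(1)[OF F_natural[OF M M T] z g tensor_val_closed[OF M z c(1)]])
  then show ?thesis using op(1) unfolding cong_tensors_def by blast
qed

lemma good_id: "good M (op_id A M)"
  using op_id_operators[OF M] by (simp add: good_def F_id[OF M] cong_tensors_refl)

lemma good_single:
  assumes x: "x \<in> Obj A" and m: "m \<in> elts M x" and \<epsilon>: "0 < \<epsilon>"
  obtains v where "good M v" "mnorm A M x (v x m) \<le> \<epsilon>"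
proof -
  \<comment> \<open>Scaling by 1/\<epsilon> turns the bound 1 of \<open>single_contraction\<close>
    into \<epsilon> for the original \<open>m\<close>.\<close>
  let ?m = "complex_of_real (1 / \<epsilon>) \<odot>\<^bsub>Val M x\<^esub> m"
  have m2: "?m \<in> elts M x" using x m by simp
  obtain v m' where m': "m' \<in> elts M x" and v: "v \<in> operators A M M" "is_adjoint A M M v v"
      "\<And>y n. y \<in> Obj A \<Longrightarrow> n \<in> elts M y \<Longrightarrow> mnorm A M y (v y n) \<le> mnorm A M y n"
      "mnorm A M x (v x ?m) \<le> 1"
      and id: "op_id A M = v \<oplus>\<^bsub>operator_space A M M\<^esub> op_comp A M (theta M x m') (theta_adj M x ?m)"
    by (rule single_contraction[OF M x m2], rule that)
  note Y = yon_hmodule[OF x]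
  note th = theta_operators[OF M x m'] theta_adj_operators[OF M x m2]
  have vm: "v x m \<in> elts M x" using natural_transfD(1)[OF operatorsD(1)[OF v(1)] x m] .
  have "cong_tensors M z f (far F M M v z f)"
    if z: "z \<in> Obj B" and f: "f \<in> elts (fob F M) z" for z f
  proof -
    let ?e = "far F M (yon x) (theta_adj M x ?m) z f"
    have e: "?e \<in> elts (fob F (yon x)) z"
      using natural_transfD(1)[OF F_natural[OF M Y th(2)] z f] .
    have "f = far F M M (op_id A M) z f" using F_id[OF M z f] by simp
    also have "\<dots> = far F M M v z f \<oplus>\<^bsub>Val (fob F M) z\<^esub> far F M M (op_comp A M (theta M x m') (theta_adj M x ?m)) z f"
      unfolding id by (rule F_add[OF M M v(1) operators_comp(1)[OF M Y M th(2,1)] z f])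
    also have "far F M M (op_comp A M (theta M x m') (theta_adj M x ?m)) z f = tensor_val M z (pure x m' ?e)"
      using F_comp[OF M Y M th(2,1)] tensor_val_pure[OF M z x m' e] z f by simp
    finally show ?thesis
      using formal_tensors_closed(5)[OF M z x m' e] unfolding cong_tensors_def by blast
  qed
  then have "good M v" using v by (simp add: good_def)
  moreover have "mnorm A M x (v x m) \<le> \<epsilon>"
    using v(4) natural_transf_linear(2)[OF operatorsD(1)[OF v(1)] x m] M.mnorm_smult[OF x vm] \<epsilon>
    by (simp add: norm_divide divide_le_eq)
  ultimately show thesis using that by blast
qed

text \<open>The sandwich v w v, unlike w v, is again self-adjoint. Strong convergence involves
  adjoints too, and self-adjoint nets settle both halves at once.\<close>

lemma good_comp:
  assumes v: "good M v" and w: "good M w"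
  shows "good M (op_comp A M v (op_comp A M w v))"
proof -
  have vo: "v \<in> operators A M M" and va: "is_adjoint A M M v v"
    and wo: "w \<in> operators A M M" and wa: "is_adjoint A M M w w"
    using v w by (auto simp: good_def)
  let ?wv = "op_comp A M w v"
  have wv: "?wv \<in> operators A M M" by (rule operators_comp(1)[OF M M M vo wo])
  have vwv: "op_comp A M v ?wv \<in> operators A M M" by (rule operators_comp(1)[OF M M M wv vo])
  have cl: "x \<in> Obj A \<Longrightarrow> n \<in> elts M x \<Longrightarrow> v x n \<in> elts M x" "x \<in> Obj A \<Longrightarrow> n \<in> elts M x \<Longrightarrow> w x n \<in> elts M x" for x n
    using natural_transfD(1)[OF operatorsD(1)[OF vo]] natural_transfD(1)[OF operatorsD(1)[OF wo]] by auto
  have adj: "is_adjoint A M M (op_comp A M v ?wv) (op_comp A M v ?wv)"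
  proof -
    have "op_comp A M (op_comp A M v w) v = op_comp A M v ?wv"
      using cl by (auto simp: op_comp_def fun_eq_iff restrict_def)
    then show ?thesis
      using is_adjoint_comp[OF M M operatorsD(1)[OF wv] is_adjoint_comp[OF M M operatorsD(1)[OF vo] va operatorsD(1)[OF wo] wa] operatorsD(1)[OF vo] va]
      by simp
  qed
  have "cong_tensors M z f (far F M M (op_comp A M v ?wv) z f)"
    if z: "z \<in> Obj B" and f: "f \<in> elts (fob F M) z" for z f
  proof -
    let ?V = "far F M M v z" and ?W = "far F M M w z"
    have Vcl: "?V g \<in> elts (fob F M) z" and Wcl: "?W g \<in> elts (fob F M) z" if "g \<in> elts (fob F M) z" for g
      using that natural_transfD(1)[OF F_natural[OF M M vo] z] natural_transfD(1)[OF F_natural[OF M M wo] z] by auto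
    have V: "cong_tensors M z g (?V g)" and W: "cong_tensors M z g (?W g)" if "g \<in> elts (fob F M) z" for g
      using v w z that by (auto simp: good_def)
    note cl' = Vcl[OF f] Wcl[OF Vcl[OF f]]
    \<comment> \<open>With ~ for the congruence, the chain is f ~ V f ~ V (V f), followed by V
      applied to V f ~ W (V f).\<close>
    have "cong_tensors M z f (?V (?V f))"
      by (rule cong_tensors_trans[OF z _ V V]) (intro Vcl f)+
    moreover have "cong_tensors M z (?V (?V f)) (?V (?W (?V f)))"
      by (rule cong_tensors_op[OF z vo _ W]) (intro Vcl Wcl f)+
    ultimately have "cong_tensors M z f (?V (?W (?V f)))"
      by (rule cong_tensors_trans[OF z Vcl[OF cl'(2)]])
    then show ?thesis
      using F_comp[OF M M M wv vo] F_comp[OF M M M vo wo] z f by simp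
  qed
  moreover have "mnorm A M x (op_comp A M v ?wv x n) \<le> mnorm A M x n" if x: "x \<in> Obj A" "n \<in> elts M x" for x n
  proof -
    have "mnorm A M x (v x (w x (v x n))) \<le> mnorm A M x (w x (v x n))"
      using v x cl by (simp add: good_def)
    also have "\<dots> \<le> mnorm A M x (v x n)" using w x cl by (simp add: good_def)
    also have "\<dots> \<le> mnorm A M x n" using v x by (simp add: good_def)
    finally show ?thesis using x by simp
  qed
  ultimately show ?thesis using vwv adj by (simp add: good_def)
qed

text \<open>Given \<open>v\<close> for the smaller set and a new element m, choose \<open>w\<close>
  to shrink v m rather than m. Then v w v is small at m because w v m is, and at an old element n
  because neither \<open>w\<close> nor the outer \<open>v\<close> increases |v n|.\<close>

lemma good_finite:
  assumes D: "finite D" "D \<subseteq> {(x, m). x \<in> Obj A \<and> m \<in> elts M x}" and \<epsilon>: "0 < \<epsilon>"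
  shows "\<exists>v. good M v \<and> (\<forall>(x, m)\<in>D. mnorm A M x (v x m) \<le> \<epsilon>)"
  using D
proof (induction D)
  case empty
  then show ?case using good_id by auto
next
  case (insert p D)
  obtain x m where p: "p = (x, m)" by (cases p)
  have x: "x \<in> Obj A" and m: "m \<in> elts M x" using insert.prems p by auto
  obtain v where v: "good M v" "\<forall>(x, m)\<in>D. mnorm A M x (v x m) \<le> \<epsilon>"
    using insert by auto
  have cl: "v y n \<in> elts M y" if "y \<in> Obj A" "n \<in> elts M y" for y n
    using v(1) that natural_transfD(1)[OF operatorsD(1), of v A M M] by (auto simp: good_def)
  obtain w where w: "good M w" "mnorm A M x (w x (v x m)) \<le> \<epsilon>"
    by (rule good_single[OF x cl[OF x m] \<epsilon>])
  have clw: "w y n \<in> elts M y" if "y \<in> Obj A" "n \<in> elts M y" for y n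
    using w(1) that natural_transfD(1)[OF operatorsD(1), of w A M M] by (auto simp: good_def)
  have contr: "mnorm A M y (v y n) \<le> mnorm A M y n" "mnorm A M y (w y n) \<le> mnorm A M y n"
    if "y \<in> Obj A" "n \<in> elts M y" for y n
    using v(1) w(1) that by (auto simp: good_def)
  have "mnorm A M y (op_comp A M v (op_comp A M w v) y n) \<le> \<epsilon>" if "(y, n) \<in> insert p D" for y n
  proof -
    have y: "y \<in> Obj A" "n \<in> elts M y" using that insert.prems by auto
    have 1: "mnorm A M y (v y (w y (v y n))) \<le> mnorm A M y (w y (v y n))"
      using contr(1) y cl clw by simp
    show ?thesis
    proof (cases "(y, n) = p")
      case True
      then show ?thesis using 1 w(2) p y by simp
    next
      case False
      then have "mnorm A M y (v y n) \<le> \<epsilon>" using that v(2) by auto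
      then show ?thesis using 1 contr(2)[OF y(1) cl[OF y]] y by simp
    qed
  qed
  then show ?case using good_comp[OF v(1) w(1)] by blast
qed

lemma tensor_val_dense:
  assumes z: "z \<in> Obj B" and f: "f \<in> elts (fob F M) z" and \<epsilon>: "0 < \<epsilon>"
  shows "\<exists>c\<in>formal_tensors A M E z. mnorm B (fob F M) z (tensor_val M z c \<ominus>\<^bsub>Val (fob F M) z\<^esub> f) < \<epsilon>"
proof -
  define X where "X = {(x, m). x \<in> Obj A \<and> m \<in> elts M x}"
  \<comment> \<open>The index set of the net: finite sets of elements to be shrunk, paired with a
    precision.\<close>
  define G where "G = finite_subsets_at_top X \<times>\<^sub>F (sequentially :: nat filter)"
  \<comment> \<open>For a \<open>D\<close> outside the index set the identity serves as a default,
    which makes \<open>V\<close> total and always good.\<close>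
  have "\<exists>v. good M v \<and> (finite D \<and> D \<subseteq> X \<longrightarrow> (\<forall>(x, m)\<in>D. mnorm A M x (v x m) \<le> 1 / real (Suc n)))" for D n
    using good_finite[of D "1 / real (Suc n)"] good_id by (cases "finite D \<and> D \<subseteq> X") (auto simp: X_def)
  then obtain V where V: "\<And>D n. good M (V D n)"
    "\<And>D n x m. finite D \<Longrightarrow> D \<subseteq> X \<Longrightarrow> (x, m) \<in> D \<Longrightarrow> mnorm A M x (V D n x m) \<le> 1 / real (Suc n)"
    by (metis (no_types, lifting) case_prodD)
  \<comment> \<open>The zero operator, in a form that inherits membership in
    \<open>operators\<close> from \<open>op_id\<close>.\<close>
  define T where "T = 0 \<odot>\<^bsub>operator_space A M M\<^esub> op_id A M"
  have T: "T \<in> operators A M M"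
    unfolding T_def by (rule operators_smult[OF M M op_id_operators(1)[OF M]])
  have T0: "T x m = \<zero>\<^bsub>Val M x\<^esub>" if "x \<in> Obj A" "m \<in> elts M x" for x m
    using that by (simp add: T_def cs_smult)
  have "is_adjoint A M M T T"
    using operatorsD(1)[OF T] by (simp add: is_adjoint_def T0 M.inn_zero)
  then have adjT: "adjoint A M M T = T" by (rule adjoint_eq[OF M M])
  \<comment> \<open>A norm-bounded set that contains both the net and its limit, as the definition
    of a strong functor demands.\<close>
  define K where "K = {S \<in> operators A M M. \<forall>x\<in>Obj A. \<forall>m\<in>elts M x. mnorm A M x (S x m) \<le> mnorm A M x m}"
  have TK: "T \<in> K" using T T0 by (simp add: K_def M.mnorm_nonneg)
  have VK: "V D n \<in> K" for D n using V(1)[of D n] by (simp add: good_def K_def)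
  have Vcl: "V D n x m \<in> elts M x" if "x \<in> Obj A" "m \<in> elts M x" for D n x m
    using VK[of D n] that natural_transfD(1)[OF operatorsD(1)] by (auto simp: K_def)
  have bdd: "opnorm A M M S \<le> 1" if "S \<in> K" for S
    using that by (intro opnorm_le_one[OF M M]) (auto simp: K_def)
  let ?\<Phi> = "filtermap (\<lambda>(D, n). V D n) G"
  have lim: "((\<lambda>(D, n). mnorm A M x (V D n x m)) \<longlongrightarrow> 0) G" if x: "x \<in> Obj A" "m \<in> elts M x" for x m
  proof (rule tendstoI)
    fix e :: real assume e: "0 < e"
    have 1: "eventually (\<lambda>D. finite D \<and> D \<subseteq> X \<and> (x, m) \<in> D) (finite_subsets_at_top X)"
      unfolding eventually_finite_subsets_at_top
      by (rule exI[of _ "{(x, m)}"]) (use x in \<open>auto simp: X_def\<close>)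
    have 2: "eventually (\<lambda>n. 1 / real (Suc n) < e) sequentially"
      using order_tendstoD(2)[OF lim_inverse_n'[THEN LIMSEQ_Suc] e] by simp
    have "eventually (\<lambda>p. (finite (fst p) \<and> fst p \<subseteq> X \<and> (x, m) \<in> fst p) \<and> 1 / real (Suc (snd p)) < e) G"
      unfolding G_def by (rule eventually_prodI[OF 1 2])
    then show "eventually (\<lambda>p. dist (case p of (D, n) \<Rightarrow> mnorm A M x (V D n x m)) 0 < e) G"
    proof (rule eventually_mono)
      fix p assume "(finite (fst p) \<and> fst p \<subseteq> X \<and> (x, m) \<in> fst p) \<and> 1 / real (Suc (snd p)) < e"
      then show "dist (case p of (D, n) \<Rightarrow> mnorm A M x (V D n x m)) 0 < e"
        using V(2)[of "fst p" x m "snd p"] M.mnorm_nonneg[OF x(1) Vcl[OF x]] by (auto simp: case_prod_beta)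
    qed
  qed
  have minus0: "a \<ominus>\<^bsub>Val M x\<^esub> \<zero>\<^bsub>Val M x\<^esub> = a" if "x \<in> Obj A" "a \<in> elts M x" for x a
    using that M.val[OF that(1)] by (intro vec_eqI[OF M.val]) (auto simp: functional_simps)
  have adjV: "adjoint A M M (V D n) = V D n" for D n
    using V(1)[of D n] by (intro adjoint_eq[OF M M]) (simp add: good_def)
  have tendsto: "strong_tendsto A M M (\<lambda>S. S) T ?\<Phi>"
  proof -
    have e: "mnorm A M x ((case p of (D, n) \<Rightarrow> V D n) x m \<ominus>\<^bsub>Val M x\<^esub> T x m) = (case p of (D, n) \<Rightarrow> mnorm A M x (V D n x m))"
      "mnorm A M x (adjoint A M M (case p of (D, n) \<Rightarrow> V D n) x m \<ominus>\<^bsub>Val M x\<^esub> adjoint A M M T x m) = (case p of (D, n) \<Rightarrow> mnorm A M x (V D n x m))"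
      if "x \<in> Obj A" "m \<in> elts M x" for x m p
      using that by (cases p; simp add: T0 minus0 Vcl adjT adjV)+
    show ?thesis
      unfolding strong_tendsto_def filterlim_filtermap using lim by (simp add: e)
  qed
  have "?\<Phi> \<le> principal K"
    unfolding le_principal eventually_filtermap using VK by (simp add: case_prod_beta)
  then have "strong_tendsto B (fob F M) (fob F M) (far F M M) (far F M M T) ?\<Phi>"
  proof -
    assume le: "?\<Phi> \<le> principal K"
    have K: "K \<subseteq> operators A M M \<and> (\<exists>c. \<forall>T\<in>K. opnorm A M M T \<le> c)"
      using bdd by (auto simp: K_def)
    have "\<forall>K. K \<subseteq> operators A M M \<and> (\<exists>c. \<forall>T\<in>K. opnorm A M M T \<le> c) \<longrightarrow>
        (\<forall>T\<in>K. \<forall>\<Phi>. \<Phi> \<le> principal K \<and> strong_tendsto A M M (\<lambda>S. S) T \<Phi> \<longrightarrow>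
           strong_tendsto B (fob F M) (fob F M) (far F M M) (far F M M T) \<Phi>)"
      using F_strong hilbD[OF M] unfolding strong_functor_def by simp
    from this[rule_format, OF K TK conjI[OF le tendsto]] show ?thesis .
  qed
  then have "((\<lambda>S. mnorm B (fob F M) z (far F M M S z f \<ominus>\<^bsub>Val (fob F M) z\<^esub> far F M M T z f)) \<longlongrightarrow> 0) ?\<Phi>"
    using z f by (simp add: strong_tendsto_def)
  then have "eventually (\<lambda>S. mnorm B (fob F M) z (far F M M S z f \<ominus>\<^bsub>Val (fob F M) z\<^esub> far F M M T z f) < \<epsilon>) ?\<Phi>"
    using \<epsilon> order_tendstoD(2) by blast
  then have ev: "eventually (\<lambda>p. mnorm B (fob F M) z (far F M M (V (fst p) (snd p)) z f \<ominus>\<^bsub>Val (fob F M) z\<^esub> far F M M T z f) < \<epsilon>) G"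
    by (simp add: eventually_filtermap case_prod_beta)
  \<comment> \<open>Properness of the filter extracts an actual index from an eventual
    estimate.\<close>
  have "G \<noteq> bot" by (simp add: G_def prod_filter_eq_bot)
  then obtain D n where Dn: "mnorm B (fob F M) z (far F M M (V D n) z f \<ominus>\<^bsub>Val (fob F M) z\<^esub> far F M M T z f) < \<epsilon>"
    using eventually_happens[OF ev] by auto
  have FV: "far F M M (V D n) z f \<in> elts (fob F M) z"
    using natural_transfD(1)[OF F_natural[OF M M] z f, of "V D n"] VK[of D n] by (simp add: K_def)
  have FT: "far F M M T z f = \<zero>\<^bsub>Val (fob F M) z\<^esub>"
    by (rule F_zero[OF M M z f T T0])
  obtain c where c: "c \<in> formal_tensors A M E z" "f = far F M M (V D n) z f \<oplus>\<^bsub>Val (fob F M) z\<^esub> tensor_val M z c"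
    using V(1)[of D n] z f unfolding good_def cong_tensors_def by blast
  note W = FM.val[OF z] and tc = tensor_val_closed[OF M z c(1)]
  have "f \<ominus>\<^bsub>Val (fob F M) z\<^esub> tensor_val M z c = far F M M (V D n) z f \<ominus>\<^bsub>Val (fob F M) z\<^esub> \<zero>\<^bsub>Val (fob F M) z\<^esub>"
  proof (rule vec_eqI[OF W])
    fix \<phi> assume \<phi>: "functional_on (Val (fob F M) z) \<phi>"
    show "\<phi> (f \<ominus>\<^bsub>Val (fob F M) z\<^esub> tensor_val M z c) = \<phi> (far F M M (V D n) z f \<ominus>\<^bsub>Val (fob F M) z\<^esub> \<zero>\<^bsub>Val (fob F M) z\<^esub>)"
      using arg_cong[OF c(2), of \<phi>] functional_simps(1)[OF \<phi> W FV tc] f FV tc W \<phi> by (simp add: functional_simps)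
  qed (use f FV tc W in auto)
  then have "mnorm B (fob F M) z (tensor_val M z c \<ominus>\<^bsub>Val (fob F M) z\<^esub> f) < \<epsilon>"
    using Dn unfolding FT FM.mnorm_minus_commute[OF z tc f] by simp
  then show ?thesis using c(1) by blast
qed

end

end

section \<open>Completions\<close>

lemma null_comparison:
  fixes f g :: "nat \<Rightarrow> real"
  assumes "g \<longlonglongrightarrow> c" "c = 0" "\<And>n. norm (f n) \<le> g n"
  shows "f \<longlonglongrightarrow> 0"
  by (rule Lim_null_comparison[of f g]) (use assms in auto)

text \<open>The inner product of \<open>P\<close> may be degenerate, and its positivity is inherited
  through \<open>h\<close> from a module known to be Hilbert. Density ensures that the completion
  exhausts \<open>N\<close>.\<close>

locale dense_map = N: hmodule B N
  for B :: "('p, 'n) star_cat" and N :: "('p, 'n, 'f) hmod" +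
  fixes P :: "('p, 'n, 'e) hmod" and h :: "'p \<Rightarrow> 'e \<Rightarrow> 'f"
  assumes P_space: "z \<in> Obj B \<Longrightarrow> complex_space (Val P z)"
    and h_linear: "z \<in> Obj B \<Longrightarrow> linear_on (Val P z) (Val N z) (h z)"
    and h_act: "w \<in> Obj B \<Longrightarrow> z \<in> Obj B \<Longrightarrow> u \<in> elts P z \<Longrightarrow> b \<in> arr B w z \<Longrightarrow>
      act P w z u b \<in> elts P w \<and> h w (act P w z u b) = act N w z (h z u) b"
    and h_inn: "y \<in> Obj B \<Longrightarrow> z \<in> Obj B \<Longrightarrow> u \<in> elts P y \<Longrightarrow> v \<in> elts P z \<Longrightarrow>
      inn P y z u v = inn N y z (h y u) (h z v)"
    and h_dense: "z \<in> Obj B \<Longrightarrow> f \<in> elts N z \<Longrightarrow> 0 < \<epsilon> \<Longrightarrow>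
      \<exists>u\<in>elts P z. mnorm B N z (h z u \<ominus>\<^bsub>Val N z\<^esub> f) < \<epsilon>"
begin

text \<open>
  The elements of the completion are the sets \<open>fib z l\<close>: a class of Cauchy sequences is determined by
  the limit \<open>l\<close> of their images under \<open>h\<close>, and every \<open>l\<close> occurs by density.
\<close>

definition fib :: "'p \<Rightarrow> 'f \<Rightarrow> (nat \<Rightarrow> 'e) set" where
  "fib z l = {t. (\<forall>n. t n \<in> elts P z) \<and> (\<lambda>n. mnorm B N z (h z (t n) \<ominus>\<^bsub>Val N z\<^esub> l)) \<longlonglongrightarrow> 0}"

context
  fixes z assumes z: "z \<in> Obj B"
begin

lemma h_closed: "u \<in> elts P z \<Longrightarrow> h z u \<in> elts N z"
  by (rule linear_onD(1)[OF h_linear[OF z]])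

lemma mnorm_P: "u \<in> elts P z \<Longrightarrow> mnorm B P z u = mnorm B N z (h z u)"
  using z by (simp add: mnorm_def h_inn)

lemma mnorm_P_minus: "u \<in> elts P z \<Longrightarrow> v \<in> elts P z \<Longrightarrow>
    mnorm B P z (u \<ominus>\<^bsub>Val P z\<^esub> v) = mnorm B N z (h z u \<ominus>\<^bsub>Val N z\<^esub> h z v)"
  using P_space[OF z] linear_on_minus[OF P_space[OF z] N.val[OF z] h_linear[OF z]] by (simp add: mnorm_P)

lemma fib_cauchy:
  assumes l: "l \<in> elts N z" and s: "s \<in> fib z l"
  shows "cauchy_in (Val P z) (mnorm B P z) s"
  unfolding cauchy_in_def
proof (intro conjI allI impI)
  show sP: "s n \<in> elts P z" for n using s by (simp add: fib_def)
  fix e :: real assume e: "0 < e"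
  have "(\<lambda>n. mnorm B N z (h z (s n) \<ominus>\<^bsub>Val N z\<^esub> l)) \<longlonglongrightarrow> 0" using s by (simp add: fib_def)
  \<comment> \<open>A quarter, because the triangle inequality carries the factor 2 and has two
    summands.\<close>
  then have "eventually (\<lambda>n. mnorm B N z (h z (s n) \<ominus>\<^bsub>Val N z\<^esub> l) < e / 4) sequentially"
    using e by (intro order_tendstoD(2)) auto
  then obtain K where K: "\<And>n. n \<ge> K \<Longrightarrow> mnorm B N z (h z (s n) \<ominus>\<^bsub>Val N z\<^esub> l) < e / 4"
    by (auto simp: eventually_sequentially)
  show "\<exists>K. \<forall>m\<ge>K. \<forall>n\<ge>K. mnorm B P z (s m \<ominus>\<^bsub>Val P z\<^esub> s n) < e"
  proof (intro exI[of _ K] allI impI)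
    fix m n assume "K \<le> m" "K \<le> n"
    then have "mnorm B N z (h z (s m) \<ominus>\<^bsub>Val N z\<^esub> l) < e / 4" "mnorm B N z (l \<ominus>\<^bsub>Val N z\<^esub> h z (s n)) < e / 4"
      using K N.mnorm_minus_commute[OF z l h_closed[OF sP]] by auto
    then show "mnorm B P z (s m \<ominus>\<^bsub>Val P z\<^esub> s n) < e"
      using N.mnorm_triangle[OF z h_closed[OF sP] l h_closed[OF sP], of m n] by (simp add: mnorm_P_minus sP)
  qed
qed

lemma cauchy_fib:
  assumes s: "cauchy_in (Val P z) (mnorm B P z) s"
  obtains l where "l \<in> elts N z" "s \<in> fib z l"
proof -
  have sP: "s n \<in> elts P z" for n using s by (simp add: cauchy_in_def)
  have "cauchy_in (Val N z) (mnorm B N z) (\<lambda>n. h z (s n))"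
    using s by (simp add: cauchy_in_def mnorm_P_minus sP h_closed)
  then show thesis
    using that N.complete[OF z] sP by (auto simp: complete_in_def fib_def)
qed

text \<open>Sequences differ by a null sequence exactly if their images share the limit; each
  direction is one triangle inequality, with the image of \<open>s\<close> or with \<open>l\<close>
  in the middle.\<close>

lemma cclass_fib:
  assumes l: "l \<in> elts N z" and s: "s \<in> fib z l"
  shows "cclass B P z s = fib z l"
proof -
  have sP: "s n \<in> elts P z" for n using s by (simp add: fib_def)
  have s0: "(\<lambda>n. mnorm B N z (h z (s n) \<ominus>\<^bsub>Val N z\<^esub> l)) \<longlonglongrightarrow> 0"
    and s0': "(\<lambda>n. mnorm B N z (l \<ominus>\<^bsub>Val N z\<^esub> h z (s n))) \<longlonglongrightarrow> 0"
    using s N.mnorm_minus_commute[OF z h_closed[OF sP] l] by (simp_all add: fib_def)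
  have "(\<lambda>n. mnorm B P z (t n \<ominus>\<^bsub>Val P z\<^esub> s n)) \<longlonglongrightarrow> 0 \<longleftrightarrow> t \<in> fib z l" if tP: "\<And>n. t n \<in> elts P z" for t
    unfolding mnorm_P_minus[OF tP sP] fib_def
    using N.null_triangle[OF z h_closed[OF tP] h_closed[OF sP] l _ s0]
      N.null_triangle[OF z h_closed[OF tP] l h_closed[OF sP] _ s0'] tP by auto
  moreover have "\<forall>n. t n \<in> elts P z" if "t \<in> fib z l" for t
    using that by (simp add: fib_def)
  ultimately show ?thesis
    using fib_cauchy[OF l] unfolding cclass_def by (auto simp: cauchy_in_def)
qed

lemma fib_nonempty:
  assumes l: "l \<in> elts N z"
  shows "\<exists>s. s \<in> fib z l"
proof -
  have "\<forall>n. \<exists>u. u \<in> elts P z \<and> mnorm B N z (h z u \<ominus>\<^bsub>Val N z\<^esub> l) < 1 / real (Suc n)"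
  proof
    show "\<exists>u. u \<in> elts P z \<and> mnorm B N z (h z u \<ominus>\<^bsub>Val N z\<^esub> l) < 1 / real (Suc n)" for n
      using h_dense[OF z l, of "1 / real (Suc n)"] by auto
  qed
  from choice[OF this] obtain s where s: "\<And>n. s n \<in> elts P z"
    "\<And>n. mnorm B N z (h z (s n) \<ominus>\<^bsub>Val N z\<^esub> l) < 1 / real (Suc n)"
    by auto
  have "(\<lambda>n. mnorm B N z (h z (s n) \<ominus>\<^bsub>Val N z\<^esub> l)) \<longlonglongrightarrow> 0"
  proof (rule Lim_null_comparison)
    show "(\<lambda>n. 1 / real (Suc n)) \<longlonglongrightarrow> 0" by (rule lim_inverse_n'[THEN LIMSEQ_Suc])
    show "eventually (\<lambda>n. norm (mnorm B N z (h z (s n) \<ominus>\<^bsub>Val N z\<^esub> l)) \<le> 1 / real (Suc n)) sequentially"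
      using s N.mnorm_nonneg[OF z cs_closed(3)[OF N.val[OF z] h_closed[OF s(1)] l]] by (simp add: less_imp_le)
  qed
  then show ?thesis using s(1) by (auto simp: fib_def)
qed

lemma rep_fib: "l \<in> elts N z \<Longrightarrow> rep (fib z l) \<in> fib z l"
  unfolding rep_def using fib_nonempty someI_ex[of "\<lambda>s. s \<in> fib z l"] by auto

lemma fib_inj: "inj_on (fib z) (elts N z)"
proof (rule inj_onI)
  fix l l' assume l: "l \<in> elts N z" and l': "l' \<in> elts N z" and eq: "fib z l = fib z l'"
  obtain s where s: "s \<in> fib z l" "s \<in> fib z l'" using fib_nonempty[OF l] eq by auto
  have sP: "s n \<in> elts P z" for n using s by (simp add: fib_def)
  have "(\<lambda>n. mnorm B N z (l \<ominus>\<^bsub>Val N z\<^esub> h z (s n))) \<longlonglongrightarrow> 0"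
    "(\<lambda>n. mnorm B N z (h z (s n) \<ominus>\<^bsub>Val N z\<^esub> l')) \<longlonglongrightarrow> 0"
    using s N.mnorm_minus_commute[OF z l h_closed[OF sP]] by (simp_all add: fib_def)
  then have "(\<lambda>n. mnorm B N z (l \<ominus>\<^bsub>Val N z\<^esub> l')) \<longlonglongrightarrow> 0"
    by (rule N.null_triangle[OF z l h_closed[OF sP] l'])
  then have "mnorm B N z (l \<ominus>\<^bsub>Val N z\<^esub> l') = 0"
    by (simp add: LIMSEQ_const_iff)
  then show "l = l'"
    using N.mnorm_eq_zero[OF z, of "l \<ominus>\<^bsub>Val N z\<^esub> l'"] l l' N.val[OF z] by (simp add: cs_minus_eq_zero)
qed

lemma elts_completion: "elts (completion B P) z = fib z ` elts N z"
proof -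
  have "cclass B P z ` {s. cauchy_in (Val P z) (mnorm B P z) s} = fib z ` elts N z"
  proof (intro equalityI subsetI)
    fix X assume "X \<in> cclass B P z ` {s. cauchy_in (Val P z) (mnorm B P z) s}"
    then obtain s where s: "cauchy_in (Val P z) (mnorm B P z) s" "X = cclass B P z s" by auto
    obtain l where "l \<in> elts N z" "s \<in> fib z l" by (rule cauchy_fib[OF s(1)])
    then show "X \<in> fib z ` elts N z" using cclass_fib s(2) by auto
  next
    fix X assume "X \<in> fib z ` elts N z"
    then obtain l where l: "l \<in> elts N z" "X = fib z l" by auto
    obtain s where "s \<in> fib z l" using fib_nonempty[OF l(1)] by auto
    then show "X \<in> cclass B P z ` {s. cauchy_in (Val P z) (mnorm B P z) s}"
      using fib_cauchy[OF l(1)] cclass_fib[OF l(1)] l(2) by auto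
  qed
  then show ?thesis by (simp add: completion_def)
qed

end

lemma fib_linear:
  assumes z: "z \<in> Obj B" and l: "l \<in> elts N z" and l': "l' \<in> elts N z" and s: "s \<in> fib z l" and s': "s' \<in> fib z l'"
  shows "(\<lambda>n. s n \<oplus>\<^bsub>Val P z\<^esub> s' n) \<in> fib z (l \<oplus>\<^bsub>Val N z\<^esub> l')"
    and "(\<lambda>n. k \<odot>\<^bsub>Val P z\<^esub> s n) \<in> fib z (k \<odot>\<^bsub>Val N z\<^esub> l)"
proof -
  note P = P_space[OF z] and W = N.val[OF z] and lin = linear_onD[OF h_linear[OF z]] and hc = h_closed[OF z]
  have sP: "s n \<in> elts P z" "s' n \<in> elts P z" for n using s s' by (auto simp: fib_def)
  have eq: "h z (s n \<oplus>\<^bsub>Val P z\<^esub> s' n) \<ominus>\<^bsub>Val N z\<^esub> (l \<oplus>\<^bsub>Val N z\<^esub> l')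
      = (h z (s n) \<ominus>\<^bsub>Val N z\<^esub> l) \<oplus>\<^bsub>Val N z\<^esub> (h z (s' n) \<ominus>\<^bsub>Val N z\<^esub> l')" for n
    unfolding lin(2)[OF sP]
    by (rule vec_eqI[OF W]) (use W l l' hc[OF sP(1)] hc[OF sP(2)] in \<open>auto simp: functional_simps\<close>)
  have "(\<lambda>n. 2 * (mnorm B N z (h z (s n) \<ominus>\<^bsub>Val N z\<^esub> l) + mnorm B N z (h z (s' n) \<ominus>\<^bsub>Val N z\<^esub> l'))) \<longlonglongrightarrow> 2 * (0 + 0)"
    using s s' by (intro tendsto_intros) (auto simp: fib_def)
  then have "(\<lambda>n. mnorm B N z (h z (s n \<oplus>\<^bsub>Val P z\<^esub> s' n) \<ominus>\<^bsub>Val N z\<^esub> (l \<oplus>\<^bsub>Val N z\<^esub> l'))) \<longlonglongrightarrow> 0"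
  proof (rule null_comparison)
    show "norm (mnorm B N z (h z (s n \<oplus>\<^bsub>Val P z\<^esub> s' n) \<ominus>\<^bsub>Val N z\<^esub> (l \<oplus>\<^bsub>Val N z\<^esub> l')))
        \<le> 2 * (mnorm B N z (h z (s n) \<ominus>\<^bsub>Val N z\<^esub> l) + mnorm B N z (h z (s' n) \<ominus>\<^bsub>Val N z\<^esub> l'))" for n
      unfolding eq using N.mnorm_add_le[OF z] N.mnorm_nonneg[OF z] W l l' hc[OF sP(1)] hc[OF sP(2)] by simp
  qed simp
  then show "(\<lambda>n. s n \<oplus>\<^bsub>Val P z\<^esub> s' n) \<in> fib z (l \<oplus>\<^bsub>Val N z\<^esub> l')"
    using P sP by (simp add: fib_def)
  have eq: "h z (k \<odot>\<^bsub>Val P z\<^esub> s n) \<ominus>\<^bsub>Val N z\<^esub> k \<odot>\<^bsub>Val N z\<^esub> l = k \<odot>\<^bsub>Val N z\<^esub> (h z (s n) \<ominus>\<^bsub>Val N z\<^esub> l)" for n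
    unfolding lin(3)[OF sP(1)]
    by (rule vec_eqI[OF W]) (use W l hc[OF sP(1)] in \<open>auto simp: functional_simps algebra_simps\<close>)
  have "(\<lambda>n. cmod k * mnorm B N z (h z (s n) \<ominus>\<^bsub>Val N z\<^esub> l)) \<longlonglongrightarrow> cmod k * 0"
    using s by (intro tendsto_intros) (auto simp: fib_def)
  then show "(\<lambda>n. k \<odot>\<^bsub>Val P z\<^esub> s n) \<in> fib z (k \<odot>\<^bsub>Val N z\<^esub> l)"
    using P sP z W l hc[OF sP(1)] by (simp add: fib_def eq N.mnorm_smult)
qed

lemma fib_act:
  assumes w: "w \<in> Obj B" and z: "z \<in> Obj B" and l: "l \<in> elts N z" and s: "s \<in> fib z l" and b: "b \<in> arr B w z"
  shows "(\<lambda>n. act P w z (s n) b) \<in> fib w (act N w z l b)"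
proof -
  note W = N.val[OF z] and hc = h_closed[OF z]
  have sP: "s n \<in> elts P z" for n using s by (auto simp: fib_def)
  have eq: "h w (act P w z (s n) b) \<ominus>\<^bsub>Val N w\<^esub> act N w z l b = act N w z (h z (s n) \<ominus>\<^bsub>Val N z\<^esub> l) b" for n
    using h_act[OF w z sP b] N.act_left(3)[OF w z b hc[OF sP] l] by simp
  have "(\<lambda>n. mnorm B N z (h z (s n) \<ominus>\<^bsub>Val N z\<^esub> l) * nrm (Hom B w z) b) \<longlonglongrightarrow> 0 * nrm (Hom B w z) b"
    using s by (intro tendsto_intros) (auto simp: fib_def)
  then have "(\<lambda>n. mnorm B N w (h w (act P w z (s n) b) \<ominus>\<^bsub>Val N w\<^esub> act N w z l b)) \<longlonglongrightarrow> 0"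
  proof (rule null_comparison)
    show "norm (mnorm B N w (h w (act P w z (s n) b) \<ominus>\<^bsub>Val N w\<^esub> act N w z l b)) \<le> mnorm B N z (h z (s n) \<ominus>\<^bsub>Val N z\<^esub> l) * nrm (Hom B w z) b" for n
      unfolding eq using N.mnorm_act[OF w z _ b] N.mnorm_nonneg[OF w] W w z b l hc[OF sP] by simp
  qed simp
  then show ?thesis using h_act[OF w z sP b] by (simp add: fib_def)
qed

text \<open>Joint continuity: <s,s'> - <l,l'> = <s - l, s' - l'> + <s - l, l'> + <l, s' - l'>, each
  term controlled by Cauchy-Schwarz. As \<open>lim_in\<close> is a definite description, uniqueness
  of the limit has to be shown too.\<close>

lemma lim_in_inn:
  assumes y: "y \<in> Obj B" and z: "z \<in> Obj B" and l: "l \<in> elts N y" and l': "l' \<in> elts N z"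
    and s: "s \<in> fib y l" and s': "s' \<in> fib z l'"
  shows "lim_in (Hom B z y) (\<lambda>n. inn P y z (s n) (s' n)) = inn N y z l l'"
proof -
  let ?H = "Hom B z y"
  note H = N.banach[OF z y]
  note V = banach_cspaceD(1)[OF H]
  have sP: "s n \<in> elts P y" "s' n \<in> elts P z" for n using s s' by (auto simp: fib_def)
  note hc = h_closed[OF y sP(1)] h_closed[OF z sP(2)]
  have icl: "inn P y z (s n) (s' n) \<in> carrier ?H" for n
    using h_inn[OF y z sP] hc y z by simp
  define a where "a = (\<lambda>n. mnorm B N y (h y (s n) \<ominus>\<^bsub>Val N y\<^esub> l))"
  define b where "b = (\<lambda>n. mnorm B N z (h z (s' n) \<ominus>\<^bsub>Val N z\<^esub> l'))"
  have a0: "a \<longlonglongrightarrow> 0" and b0: "b \<longlonglongrightarrow> 0" using s s' by (simp_all add: fib_def a_def b_def)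
  have eq: "inn P y z (s n) (s' n) \<ominus>\<^bsub>?H\<^esub> inn N y z l l' =
      inn N y z (h y (s n) \<ominus>\<^bsub>Val N y\<^esub> l) (h z (s' n) \<ominus>\<^bsub>Val N z\<^esub> l') \<oplus>\<^bsub>?H\<^esub>
      (inn N y z (h y (s n) \<ominus>\<^bsub>Val N y\<^esub> l) l' \<oplus>\<^bsub>?H\<^esub> inn N y z l (h z (s' n) \<ominus>\<^bsub>Val N z\<^esub> l'))" for n
    unfolding h_inn[OF y z sP]
    by (rule vec_eqI[OF V]) (use V y z l l' hc[of n] N.val[OF y] N.val[OF z] in
        \<open>auto simp: functional_simps N.inn_left N.inn_right algebra_simps\<close>)
  have bound: "norm (nrm ?H (inn P y z (s n) (s' n) \<ominus>\<^bsub>?H\<^esub> inn N y z l l'))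
      \<le> 6 * a n * b n + (6 * a n * mnorm B N z l' + 6 * mnorm B N y l * b n)" for n
  proof -
    have cl: "h y (s n) \<ominus>\<^bsub>Val N y\<^esub> l \<in> elts N y" "h z (s' n) \<ominus>\<^bsub>Val N z\<^esub> l' \<in> elts N z"
      using hc[of n] l l' N.val[OF y] N.val[OF z] by auto
    let ?u = "inn N y z (h y (s n) \<ominus>\<^bsub>Val N y\<^esub> l) (h z (s' n) \<ominus>\<^bsub>Val N z\<^esub> l')"
      and ?v = "inn N y z (h y (s n) \<ominus>\<^bsub>Val N y\<^esub> l) l'" and ?w = "inn N y z l (h z (s' n) \<ominus>\<^bsub>Val N z\<^esub> l')"
    have uvw: "?u \<in> carrier ?H" "?v \<in> carrier ?H" "?w \<in> carrier ?H" using cl l l' y z by auto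
    have "nrm ?H (?u \<oplus>\<^bsub>?H\<^esub> (?v \<oplus>\<^bsub>?H\<^esub> ?w)) \<le> nrm ?H ?u + nrm ?H (?v \<oplus>\<^bsub>?H\<^esub> ?w)"
      using uvw V by (intro banach_cspaceD(5)[OF H]) auto
    also have "nrm ?H (?v \<oplus>\<^bsub>?H\<^esub> ?w) \<le> nrm ?H ?v + nrm ?H ?w"
      using uvw by (intro banach_cspaceD(5)[OF H])
    finally show ?thesis
      unfolding eq using N.cauchy_schwarz[OF z y cl] N.cauchy_schwarz[OF z y cl(1) l'] N.cauchy_schwarz[OF z y l cl(2)]
        banach_cspaceD(3)[OF H cs_closed(2)[OF V uvw(1) cs_closed(2)[OF V uvw(2,3)]]]
      by (simp add: a_def b_def)
  qed
  have "(\<lambda>n. 6 * a n * b n + (6 * a n * mnorm B N z l' + 6 * mnorm B N y l * b n)) \<longlonglongrightarrow> 6 * 0 * 0 + (6 * 0 * mnorm B N z l' + 6 * mnorm B N y l * 0)"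
    using a0 b0 by (intro tendsto_intros)
  then have "(\<lambda>n. 6 * a n * b n + (6 * a n * mnorm B N z l' + 6 * mnorm B N y l * b n)) \<longlonglongrightarrow> 0" by simp
  then have lim: "(\<lambda>n. nrm ?H (inn P y z (s n) (s' n) \<ominus>\<^bsub>?H\<^esub> inn N y z l l')) \<longlonglongrightarrow> 0"
    by (rule Lim_null_comparison[rotated]) (use bound in simp)
  have il: "inn N y z l l' \<in> carrier ?H" using l l' y z by simp
  show ?thesis
    unfolding lim_in_def
  proof (rule the_equality)
    show "inn N y z l l' \<in> carrier ?H \<and> (\<lambda>n. nrm ?H (inn P y z (s n) (s' n) \<ominus>\<^bsub>?H\<^esub> inn N y z l l')) \<longlonglongrightarrow> 0"
      using il lim by simp
    fix k assume k: "k \<in> carrier ?H \<and> (\<lambda>n. nrm ?H (inn P y z (s n) (s' n) \<ominus>\<^bsub>?H\<^esub> k)) \<longlonglongrightarrow> 0"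
    have "(\<lambda>n. nrm ?H (inn P y z (s n) (s' n) \<ominus>\<^bsub>?H\<^esub> inn N y z l l') + nrm ?H (inn P y z (s n) (s' n) \<ominus>\<^bsub>?H\<^esub> k)) \<longlonglongrightarrow> 0 + 0"
      using lim k by (intro tendsto_intros) auto
    moreover have "nrm ?H (k \<ominus>\<^bsub>?H\<^esub> inn N y z l l') \<le> nrm ?H (inn P y z (s n) (s' n) \<ominus>\<^bsub>?H\<^esub> inn N y z l l') + nrm ?H (inn P y z (s n) (s' n) \<ominus>\<^bsub>?H\<^esub> k)" for n
    proof -
      have e: "k \<ominus>\<^bsub>?H\<^esub> inn N y z l l' = (inn P y z (s n) (s' n) \<ominus>\<^bsub>?H\<^esub> inn N y z l l') \<ominus>\<^bsub>?H\<^esub> (inn P y z (s n) (s' n) \<ominus>\<^bsub>?H\<^esub> k)"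
        by (rule vec_eqI[OF V]) (use V k il icl[of n] in \<open>auto simp: functional_simps\<close>)
      show ?thesis unfolding e using V k il icl[of n] by (intro nrm_minus_le[OF H]) auto
    qed
    ultimately have "nrm ?H (k \<ominus>\<^bsub>?H\<^esub> inn N y z l l') \<le> 0"
      by (intro LIMSEQ_le_const[of _ 0]) auto
    then have "nrm ?H (k \<ominus>\<^bsub>?H\<^esub> inn N y z l l') = 0"
      using banach_cspaceD(3)[OF H, of "k \<ominus>\<^bsub>?H\<^esub> inn N y z l l'"] k il V by simp
    then show "k = inn N y z l l'"
      using banach_cspaceD(4)[OF H, of "k \<ominus>\<^bsub>?H\<^esub> inn N y z l l'"] k il V by (simp add: cs_minus_eq_zero)
  qed
qed

section \<open>The limit map as an isomorphism from the completion onto \<open>N\<close>\<close>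

definition clim :: "'p \<Rightarrow> (nat \<Rightarrow> 'e) set \<Rightarrow> 'f" where
  "clim z = inv_into (elts N z) (fib z)"

lemma clim_fib: "z \<in> Obj B \<Longrightarrow> l \<in> elts N z \<Longrightarrow> clim z (fib z l) = l"
  unfolding clim_def by (rule inv_into_f_f[OF fib_inj])

lemma clim_bij: "z \<in> Obj B \<Longrightarrow> bij_betw (clim z) (elts (completion B P) z) (elts N z)"
  unfolding clim_def elts_completion by (intro bij_betw_inv_into) (simp add: bij_betw_def fib_inj)

lemma clim_inn:
  assumes "y \<in> Obj B" "z \<in> Obj B" "X \<in> elts (completion B P) y" "Y \<in> elts (completion B P) z"
  shows "inn (completion B P) y z X Y = inn N y z (clim y X) (clim z Y)"
  using assms lim_in_inn[OF assms(1,2)] rep_fib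
  by (auto simp: elts_completion clim_fib) (simp add: completion_def)

lemma clim_add:
  assumes z: "z \<in> Obj B" and X: "X \<in> elts (completion B P) z" and Y: "Y \<in> elts (completion B P) z"
  shows "X \<oplus>\<^bsub>Val (completion B P) z\<^esub> Y \<in> elts (completion B P) z"
    "clim z (X \<oplus>\<^bsub>Val (completion B P) z\<^esub> Y) = clim z X \<oplus>\<^bsub>Val N z\<^esub> clim z Y"
proof -
  obtain l l' where l: "l \<in> elts N z" "X = fib z l" and l': "l' \<in> elts N z" "Y = fib z l'"
    using X Y elts_completion[OF z] by auto
  have s: "l \<oplus>\<^bsub>Val N z\<^esub> l' \<in> elts N z" using l l' z by simp
  have "X \<oplus>\<^bsub>Val (completion B P) z\<^esub> Y = fib z (l \<oplus>\<^bsub>Val N z\<^esub> l')"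
    using cclass_fib[OF z s fib_linear(1)[OF z l(1) l'(1) rep_fib[OF z l(1)] rep_fib[OF z l'(1)]]] l l'
    by (simp add: completion_def)
  then show "X \<oplus>\<^bsub>Val (completion B P) z\<^esub> Y \<in> elts (completion B P) z"
    "clim z (X \<oplus>\<^bsub>Val (completion B P) z\<^esub> Y) = clim z X \<oplus>\<^bsub>Val N z\<^esub> clim z Y"
    using l l' s z by (auto simp: elts_completion clim_fib)
qed

lemma clim_smult:
  assumes z: "z \<in> Obj B" and X: "X \<in> elts (completion B P) z"
  shows "k \<odot>\<^bsub>Val (completion B P) z\<^esub> X \<in> elts (completion B P) z"
    "clim z (k \<odot>\<^bsub>Val (completion B P) z\<^esub> X) = k \<odot>\<^bsub>Val N z\<^esub> clim z X"
proof -
  obtain l where l: "l \<in> elts N z" "X = fib z l"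
    using X elts_completion[OF z] by auto
  have s: "k \<odot>\<^bsub>Val N z\<^esub> l \<in> elts N z" using l z by simp
  have "k \<odot>\<^bsub>Val (completion B P) z\<^esub> X = fib z (k \<odot>\<^bsub>Val N z\<^esub> l)"
    using cclass_fib[OF z s fib_linear(2)[OF z l(1) l(1) rep_fib[OF z l(1)] rep_fib[OF z l(1)]]] l
    by (simp add: completion_def)
  then show "k \<odot>\<^bsub>Val (completion B P) z\<^esub> X \<in> elts (completion B P) z"
    "clim z (k \<odot>\<^bsub>Val (completion B P) z\<^esub> X) = k \<odot>\<^bsub>Val N z\<^esub> clim z X"
    using l s z by (auto simp: elts_completion clim_fib)
qed

lemma clim_zero:
  assumes z: "z \<in> Obj B"
  shows "\<zero>\<^bsub>Val (completion B P) z\<^esub> \<in> elts (completion B P) z"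
    "clim z \<zero>\<^bsub>Val (completion B P) z\<^esub> = \<zero>\<^bsub>Val N z\<^esub>"
proof -
  have 0: "\<zero>\<^bsub>Val N z\<^esub> \<in> elts N z" using z by simp
  have "(\<lambda>n. \<zero>\<^bsub>Val P z\<^esub>) \<in> fib z \<zero>\<^bsub>Val N z\<^esub>"
    using P_space[OF z] N.val[OF z] linear_on_zero[OF P_space[OF z] N.val[OF z] h_linear[OF z]] z
    by (simp add: fib_def cs_minus cs_smult abelian_groupE(5) module_def)
  then have "\<zero>\<^bsub>Val (completion B P) z\<^esub> = fib z \<zero>\<^bsub>Val N z\<^esub>"
    using cclass_fib[OF z 0] by (simp add: completion_def)
  then show "\<zero>\<^bsub>Val (completion B P) z\<^esub> \<in> elts (completion B P) z"
    "clim z \<zero>\<^bsub>Val (completion B P) z\<^esub> = \<zero>\<^bsub>Val N z\<^esub>"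
    using 0 z by (auto simp: elts_completion clim_fib)
qed

lemma clim_act:
  assumes w: "w \<in> Obj B" and z: "z \<in> Obj B" and X: "X \<in> elts (completion B P) z" and b: "b \<in> arr B w z"
  shows "act (completion B P) w z X b \<in> elts (completion B P) w"
    "clim w (act (completion B P) w z X b) = act N w z (clim z X) b"
proof -
  obtain l where l: "l \<in> elts N z" "X = fib z l"
    using X elts_completion[OF z] by auto
  have s: "act N w z l b \<in> elts N w" using l z w b by simp
  have "act (completion B P) w z X b = fib w (act N w z l b)"
    using cclass_fib[OF w s fib_act[OF w z l(1) rep_fib[OF z l(1)] b]] l
    by (simp add: completion_def)
  then show "act (completion B P) w z X b \<in> elts (completion B P) w"
    "clim w (act (completion B P) w z X b) = act N w z (clim z X) b"
    using l s z w by (auto simp: elts_completion clim_fib)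
qed

text \<open>By transport along \<open>clim\<close> the completion is a Hilbert module unitarily
  isomorphic to \<open>N\<close>, with no axiom verified on classes of sequences.\<close>

lemma completion_iso: "hmodule_iso B N (completion B P) clim"
  by (intro hmodule_iso.intro hmodule_iso_axioms.intro N.hmodule_axioms)
    (simp_all add: clim_bij clim_add clim_smult clim_zero clim_act clim_inn)

end

section \<open>The tensor product with the bimodule of a strong functor\<close>

context strong_setup
begin

abbreviation "alg M \<equiv> alg_tensor A B M E"

definition alg_val :: "('oa, 'ma, 'u) hmod \<Rightarrow> 'ob \<Rightarrow> ('oa, 'u, 'v) formal set \<Rightarrow> 'v" where
  "alg_val M z X = tensor_val M z (rep X)"

context
  fixes M :: "('oa, 'ma, 'u) hmod"
  assumes M: "hmodule A M"
begin

interpretation M: hmodule A M by (rule M)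
interpretation FM: hmodule B "fob F M" by (rule F_hmodule[OF M])
interpretation W: vector_space "fscale :: complex \<Rightarrow> ('oa, 'u, 'v) formal \<Rightarrow> _" by (rule vector_space_fscale)

lemma tensor_relations_closed:
  "0 \<in> tensor_relations A M E z"
  "c \<in> tensor_relations A M E z \<Longrightarrow> d \<in> tensor_relations A M E z \<Longrightarrow> c + d \<in> tensor_relations A M E z"
  "c \<in> tensor_relations A M E z \<Longrightarrow> d \<in> tensor_relations A M E z \<Longrightarrow> c - d \<in> tensor_relations A M E z"
  "c \<in> tensor_relations A M E z \<Longrightarrow> fscale k c \<in> tensor_relations A M E z"
  unfolding tensor_relations_span by (simp_all add: W.span_zero W.span_add W.span_diff W.span_scale)

context
  fixes z assumes z: "z \<in> Obj B"
begin

lemma tclass_eqI: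
  assumes "c - d \<in> tensor_relations A M E z"
  shows "tclass A M E z c = tclass A M E z d"
proof -
  have "(e - c \<in> tensor_relations A M E z) = (e - d \<in> tensor_relations A M E z)" for e
    using tensor_relations_closed(2)[of "e - c" z "c - d"] tensor_relations_closed(3)[of "e - d" z "c - d"] assms
    by auto
  then show ?thesis by (simp add: tclass_def)
qed

text \<open>Operations on classes go through an arbitrary representative; that it differs from a
  given one by a relation is what makes them well defined.\<close>

lemma rep_tclass:
  assumes c: "c \<in> formal_tensors A M E z"
  shows "rep (tclass A M E z c) \<in> formal_tensors A M E z"
    and "rep (tclass A M E z c) - c \<in> tensor_relations A M E z"
proof -
  have "c \<in> tclass A M E z c"
    using c tensor_relations_closed(1) by (simp add: tclass_def)
  then have "rep (tclass A M E z c) \<in> tclass A M E z c"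
    unfolding rep_def by (rule someI)
  then show "rep (tclass A M E z c) \<in> formal_tensors A M E z"
    "rep (tclass A M E z c) - c \<in> tensor_relations A M E z"
    by (simp_all add: tclass_def)
qed

lemma alg_simps:
  "elts (alg M) z = tclass A M E z ` formal_tensors A M E z"
  "\<zero>\<^bsub>Val (alg M) z\<^esub> = tclass A M E z 0"
  by (simp_all add: alg_tensor_def)

lemma alg_add:
  assumes "c \<in> formal_tensors A M E z" "d \<in> formal_tensors A M E z"
  shows "tclass A M E z c \<oplus>\<^bsub>Val (alg M) z\<^esub> tclass A M E z d = tclass A M E z (c + d)"
proof -
  have "(rep (tclass A M E z c) - c) + (rep (tclass A M E z d) - d) \<in> tensor_relations A M E z"
    by (rule tensor_relations_closed(2)[OF rep_tclass(2)[OF assms(1)] rep_tclass(2)[OF assms(2)]])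
  then have "(rep (tclass A M E z c) + rep (tclass A M E z d)) - (c + d) \<in> tensor_relations A M E z"
    by (simp add: algebra_simps)
  then show ?thesis by (simp add: alg_tensor_def tclass_eqI)
qed

lemma alg_smult:
  assumes "c \<in> formal_tensors A M E z"
  shows "k \<odot>\<^bsub>Val (alg M) z\<^esub> tclass A M E z c = tclass A M E z (fscale k c)"
  using tensor_relations_closed(4)[OF rep_tclass(2)[OF assms], of k]
  by (simp add: alg_tensor_def tclass_eqI fscale_simps)

lemma alg_space: "complex_space (Val (alg M) z)"
proof -
  note ft = formal_tensors_closed[OF M z]
  note s = alg_simps alg_add alg_smult ft
  have "abelian_group (Val (alg M) z)"
  proof (rule abelian_groupI)
    show "\<exists>Y\<in>elts (alg M) z. Y \<oplus>\<^bsub>Val (alg M) z\<^esub> X = \<zero>\<^bsub>Val (alg M) z\<^esub>" if X: "X \<in> elts (alg M) z" for X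
    proof -
      obtain c where c: "c \<in> formal_tensors A M E z" "X = tclass A M E z c"
        using X by (auto simp: alg_simps)
      then have "tclass A M E z (fscale (-1) c) \<oplus>\<^bsub>Val (alg M) z\<^esub> X = \<zero>\<^bsub>Val (alg M) z\<^esub>"
        using alg_add[OF ft(4)[OF c(1), of "-1"] c(1)] fscale_simps(8)[of c] by (simp add: alg_simps)
      then show ?thesis
        using imageI[OF ft(4)[OF c(1), of "-1"]] by (intro bexI) (simp_all only: alg_simps)
    qed
  qed (auto simp: s ac_simps)
  then show ?thesis
  proof (rule moduleI[OF cring_complex_field])
    fix X assume "X \<in> elts (alg M) z"
    then obtain c where c: "c \<in> formal_tensors A M E z" "X = tclass A M E z c"
      by (auto simp: alg_simps)
    show "k \<odot>\<^bsub>Val (alg M) z\<^esub> X \<in> elts (alg M) z" for k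
      using c ft(4) by (auto simp: alg_smult alg_simps)
    show "(k \<oplus>\<^bsub>complex_field\<^esub> l) \<odot>\<^bsub>Val (alg M) z\<^esub> X = k \<odot>\<^bsub>Val (alg M) z\<^esub> X \<oplus>\<^bsub>Val (alg M) z\<^esub> l \<odot>\<^bsub>Val (alg M) z\<^esub> X" for k l
      by (simp only: complex_field_simps c(2) alg_smult[OF c(1)] alg_add[OF ft(4)[OF c(1)] ft(4)[OF c(1)]] fscale_simps(3))
    show "(k \<otimes>\<^bsub>complex_field\<^esub> l) \<odot>\<^bsub>Val (alg M) z\<^esub> X = k \<odot>\<^bsub>Val (alg M) z\<^esub> (l \<odot>\<^bsub>Val (alg M) z\<^esub> X)" for k l
      by (simp only: complex_field_simps c(2) alg_smult[OF c(1)] alg_smult[OF ft(4)[OF c(1)]] fscale_simps(4))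
    show "\<one>\<^bsub>complex_field\<^esub> \<odot>\<^bsub>Val (alg M) z\<^esub> X = X"
      using c by (simp add: alg_smult fscale_simps(5))
    show "k \<odot>\<^bsub>Val (alg M) z\<^esub> (X \<oplus>\<^bsub>Val (alg M) z\<^esub> Y) = k \<odot>\<^bsub>Val (alg M) z\<^esub> X \<oplus>\<^bsub>Val (alg M) z\<^esub> k \<odot>\<^bsub>Val (alg M) z\<^esub> Y"
      if Y: "Y \<in> elts (alg M) z" for k Y
    proof -
      obtain d where "d \<in> formal_tensors A M E z" "Y = tclass A M E z d"
        using Y by (auto simp: alg_simps)
      then show ?thesis
        using c ft(2,4) by (simp add: alg_smult alg_add fscale_simps(1))
    qed
  qed
qed

lemma alg_val_tclass:
  assumes c: "c \<in> formal_tensors A M E z"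
  shows "alg_val M z (tclass A M E z c) = tensor_val M z c"
proof -
  note r = rep_tclass[OF c]
  have "tensor_val M z (rep (tclass A M E z c)) \<ominus>\<^bsub>Val (fob F M) z\<^esub> tensor_val M z c = \<zero>\<^bsub>Val (fob F M) z\<^esub>"
    using tensor_relations_val(2)[OF M z r(2)] tensor_val_diff[OF M z r(1) c] by simp
  then show ?thesis
    using tensor_val_closed[OF M z] r(1) c by (simp add: alg_val_def cs_minus_eq_zero[OF FMz[OF M z]])
qed

end

text \<open>The point where the two halves of the argument meet: isometry from
  \<open>formal_inn_val\<close>, and density from strong continuity via
  \<open>tensor_val_dense\<close>.\<close>

lemma alg_dense_map: "dense_map B (fob F M) (alg M) (alg_val M)"
proof (intro dense_map.intro F_hmodule[OF M] dense_map_axioms.intro)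
  fix z assume z: "z \<in> Obj B"
  note ft = formal_tensors_closed[OF M z]
  note s = alg_simps[OF z] alg_add[OF z] alg_smult[OF z] ft alg_val_tclass[OF z] tensor_val_closed[OF M z]
    tensor_val_add[OF M z] tensor_val_fscale[OF M z]
  show "linear_on (Val (alg M) z) (Val (fob F M) z) (alg_val M z)"
    unfolding linear_on_def by (auto simp: s)
  show "\<exists>X\<in>elts (alg M) z. mnorm B (fob F M) z (alg_val M z X \<ominus>\<^bsub>Val (fob F M) z\<^esub> f) < \<epsilon>"
    if "f \<in> elts (fob F M) z" "0 < \<epsilon>" for f \<epsilon>
    using tensor_val_dense[OF M z that] by (auto simp: s)
next
  fix w z X b assume w: "w \<in> Obj B" and z: "z \<in> Obj B" and X: "X \<in> elts (alg M) z" and b: "b \<in> arr B w z"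
  have r: "rep X \<in> formal_tensors A M E z" using X rep_tclass(1)[OF z] by (auto simp: alg_simps[OF z])
  show "act (alg M) w z X b \<in> elts (alg M) w \<and> alg_val M w (act (alg M) w z X b) = act (fob F M) w z (alg_val M z X) b"
    using formal_act_val[OF M z w b r] alg_val_tclass[OF w]
    by (auto simp: alg_tensor_def alg_val_def[of _ _ X])
next
  fix y z X Y assume y: "y \<in> Obj B" and z: "z \<in> Obj B" and X: "X \<in> elts (alg M) y" and Y: "Y \<in> elts (alg M) z"
  have r: "rep X \<in> formal_tensors A M E y" "rep Y \<in> formal_tensors A M E z"
    using X Y rep_tclass(1)[OF z] rep_tclass(1)[OF y] by (auto simp: alg_simps[OF z] alg_simps[OF y])
  show "inn (alg M) y z X Y = inn (fob F M) y z (alg_val M y X) (alg_val M z Y)"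
    using formal_inn_val[OF M z y r] by (simp add: alg_tensor_def alg_val_def)
qed (rule alg_space)

lemma tensor_hmodule: "hmodule B (tensor A B M E)"
  unfolding tensor_def by (rule hmodule_iso.hmodule[OF dense_map.completion_iso[OF alg_dense_map]])

end

section \<open>The unitary \<open>psi\<close> and its naturality\<close>

definition psi :: "('oa, 'ma, 'u) hmod \<Rightarrow> 'ob \<Rightarrow> ('oa, 'u, 'v) tensor_elt \<Rightarrow> 'v" where
  "psi M = (\<lambda>z\<in>Obj B. \<lambda>X\<in>elts (tensor A B M E) z. dense_map.clim B (fob F M) (alg M) (alg_val M) z X)"

context
  fixes M :: "('oa, 'ma, 'u) hmod"
  assumes M: "hmodule A M"
begin

interpretation D: dense_map B "fob F M" "alg M" "alg_val M" by (rule alg_dense_map[OF M])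
interpretation T: hmodule B "tensor A B M E" by (rule tensor_hmodule[OF M])

lemma psi_apply: "z \<in> Obj B \<Longrightarrow> X \<in> elts (tensor A B M E) z \<Longrightarrow> psi M z X = D.clim z X"
  by (simp add: psi_def)

lemma psi_unitary: "unitary_op B (tensor A B M E) (fob F M) (psi M)"
  unfolding psi_def tensor_def by (rule hmodule_iso.unitary[OF D.completion_iso])

lemma psi_operators: "psi M \<in> operators B (tensor A B M E) (fob F M)"
  using psi_unitary by (simp add: unitary_op_def)

lemma psi_bij: "z \<in> Obj B \<Longrightarrow> bij_betw (psi M z) (elts (tensor A B M E) z) (elts (fob F M) z)"
  using D.clim_bij[of z] bij_betw_cong[of "elts (tensor A B M E) z" "psi M z" "D.clim z"]
  by (simp add: tensor_def psi_apply)

lemma psi_closed: "z \<in> Obj B \<Longrightarrow> X \<in> elts (tensor A B M E) z \<Longrightarrow> psi M z X \<in> elts (fob F M) z"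
  using psi_bij by (auto simp: bij_betw_def)

lemma psi_eqI:
  "z \<in> Obj B \<Longrightarrow> X \<in> elts (tensor A B M E) z \<Longrightarrow> Y \<in> elts (tensor A B M E) z \<Longrightarrow> psi M z X = psi M z Y \<Longrightarrow> X = Y"
  using psi_bij[of z] by (auto simp: bij_betw_def dest: inj_onD)

lemma psi_inn:
  "y \<in> Obj B \<Longrightarrow> z \<in> Obj B \<Longrightarrow> X \<in> elts (tensor A B M E) y \<Longrightarrow> Y \<in> elts (tensor A B M E) z \<Longrightarrow>
    inn (tensor A B M E) y z X Y = inn (fob F M) y z (psi M y X) (psi M z Y)"
  using D.clim_inn[of y z X Y] by (simp add: psi_apply) (simp add: tensor_def)

end

context
  fixes M N :: "('oa, 'ma, 'u) hmod" and T
  assumes M: "hmodule A M" and N: "hmodule A N" and T: "T \<in> operators A M N"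
begin

interpretation M: dense_map B "fob F M" "alg M" "alg_val M" by (rule alg_dense_map[OF M])
interpretation N: dense_map B "fob F N" "alg N" "alg_val N" by (rule alg_dense_map[OF N])

lemma alg_tensor_op_val:
  assumes z: "z \<in> Obj B" and X: "X \<in> elts (alg M) z"
  shows "alg_tensor_op A N E T z X \<in> elts (alg N) z"
    and "alg_val N z (alg_tensor_op A N E T z X) = far F M N T z (alg_val M z X)"
proof -
  have r: "rep X \<in> formal_tensors A M E z" using X rep_tclass(1)[OF M z] by (auto simp: alg_simps[OF M z])
  have eq: "alg_tensor_op A N E T z X = tclass A N E z (formal_op T (rep X))"
    unfolding alg_tensor_op_def formal_op_def formal_map_def
    by (intro arg_cong[of _ _ "tclass A N E z"] sum.cong) auto
  note f = formal_op_val[OF M N z T r]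
  show "alg_tensor_op A N E T z X \<in> elts (alg N) z"
    using f(1) by (simp add: eq alg_simps[OF N z])
  show "alg_val N z (alg_tensor_op A N E T z X) = far F M N T z (alg_val M z X)"
    using f alg_val_tclass[OF N z f(1)] by (simp add: eq alg_val_def[of M])
qed

text \<open>F(T) is bounded and so commutes with the limit behind \<open>clim\<close>: on
  representatives the equation is \<open>alg_tensor_op_val\<close>, and both sides pass to the
  limit.\<close>

lemma psi_tensor_op:
  assumes z: "z \<in> Obj B" and X: "X \<in> elts (tensor A B M E) z"
  shows "tensor_op A B E M N T z X \<in> elts (tensor A B N E) z"
    and "psi N z (tensor_op A B E M N T z X) = far F M N T z (psi M z X)"
proof -
  obtain l where l: "l \<in> elts (fob F M) z" "X = M.fib z l"
    using X M.elts_completion[OF z] by (auto simp: tensor_def)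
  note FT = F_operators[OF M N T]
  note nat = F_natural[OF M N T]
  have Fl: "far F M N T z l \<in> elts (fob F N) z" by (rule natural_transfD(1)[OF nat z l(1)])
  have r: "rep X n \<in> elts (alg M) z" for n
    using M.rep_fib[OF z l(1)] l(2) by (simp add: M.fib_def)
  have v: "alg_val M z (rep X n) \<in> elts (fob F M) z" for n
    by (rule M.h_closed[OF z r])
  obtain K where K: "0 \<le> K" "\<And>x e. x \<in> Obj B \<Longrightarrow> e \<in> elts (fob F M) x \<Longrightarrow>
      mnorm B (fob F N) x (far F M N T x e) \<le> K * mnorm B (fob F M) x e"
    by (rule operators_bound[OF F_hmodule[OF M] F_hmodule[OF N] FT], rule that)
  have "(\<lambda>n. K * mnorm B (fob F M) z (alg_val M z (rep X n) \<ominus>\<^bsub>Val (fob F M) z\<^esub> l)) \<longlonglongrightarrow> K * 0"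
    using M.rep_fib[OF z l(1)] l(2) by (intro tendsto_intros) (simp add: M.fib_def)
  then have "(\<lambda>n. mnorm B (fob F N) z (far F M N T z (alg_val M z (rep X n)) \<ominus>\<^bsub>Val (fob F N) z\<^esub> far F M N T z l)) \<longlonglongrightarrow> 0"
  proof (rule null_comparison)
    fix n
    have d: "alg_val M z (rep X n) \<ominus>\<^bsub>Val (fob F M) z\<^esub> l \<in> elts (fob F M) z"
      using v l(1) M.N.val[OF z] by simp
    have "far F M N T z (alg_val M z (rep X n)) \<ominus>\<^bsub>Val (fob F N) z\<^esub> far F M N T z l
        = far F M N T z (alg_val M z (rep X n) \<ominus>\<^bsub>Val (fob F M) z\<^esub> l)"
      by (rule natural_transf_minus[OF F_hmodule[OF M] F_hmodule[OF N] nat z v l(1), symmetric])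
    then show "norm (mnorm B (fob F N) z (far F M N T z (alg_val M z (rep X n)) \<ominus>\<^bsub>Val (fob F N) z\<^esub> far F M N T z l))
        \<le> K * mnorm B (fob F M) z (alg_val M z (rep X n) \<ominus>\<^bsub>Val (fob F M) z\<^esub> l)"
      using K(2)[OF z d] N.N.mnorm_nonneg[OF z natural_transfD(1)[OF nat z d]] by simp
  qed simp
  then have "(\<lambda>n. alg_tensor_op A N E T z (rep X n)) \<in> N.fib z (far F M N T z l)"
    by (simp add: N.fib_def alg_tensor_op_val[OF z r])
  from N.cclass_fib[OF z Fl this] have eq: "tensor_op A B E M N T z X = N.fib z (far F M N T z l)"
    using z X by (simp add: tensor_op_def)
  show mem: "tensor_op A B E M N T z X \<in> elts (tensor A B N E) z"
    using Fl by (simp add: eq tensor_def N.elts_completion[OF z])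
  show "psi N z (tensor_op A B E M N T z X) = far F M N T z (psi M z X)"
    unfolding psi_apply[OF N z mem] psi_apply[OF M z X] unfolding eq N.clim_fib[OF z Fl]
    by (simp only: l(2) M.clim_fib[OF z l(1)])
qed

text \<open>Conjugation by the unitaries presents the tensored operator as a composite of operators,
  so its boundedness and adjointability need no estimate on tensors.\<close>

lemma tensor_op_eq:
  "tensor_op A B E M N T = op_comp B (tensor A B M E) (adjoint B (tensor A B N E) (fob F N) (psi N))
     (op_comp B (tensor A B M E) (far F M N T) (psi M))"
proof (intro ext)
  fix z X
  show "tensor_op A B E M N T z X = op_comp B (tensor A B M E) (adjoint B (tensor A B N E) (fob F N) (psi N))
     (op_comp B (tensor A B M E) (far F M N T) (psi M)) z X"
  proof (cases "z \<in> Obj B \<and> X \<in> elts (tensor A B M E) z")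
    case True
    let ?Y = "tensor_op A B E M N T z X"
    have Y: "?Y \<in> elts (tensor A B N E) z" using True by (simp add: psi_tensor_op)
    have "op_comp B (tensor A B N E) (adjoint B (tensor A B N E) (fob F N) (psi N)) (psi N) z ?Y = op_id B (tensor A B N E) z ?Y"
      using psi_unitary[OF N] by (simp add: unitary_op_def)
    then show ?thesis using True Y by (simp add: psi_tensor_op(2))
  next
    case False
    then show ?thesis by (auto simp: tensor_op_def op_comp_def restrict_def)
  qed
qed

lemma tensor_op_operators: "tensor_op A B E M N T \<in> operators B (tensor A B M E) (tensor A B N E)"
  unfolding tensor_op_eq
  using tensor_hmodule[OF M] tensor_hmodule[OF N] F_hmodule[OF M] F_hmodule[OF N] psi_operators[OF M]
    F_operators[OF M N T] adjoint_operators(1)[OF tensor_hmodule[OF N] F_hmodule[OF N] psi_operators[OF N]]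
  by (meson operators_comp(1))

lemma psi_natural:
  "op_comp B (tensor A B M E) (psi N) (tensor_op A B E M N T) = op_comp B (tensor A B M E) (far F M N T) (psi M)"
  by (auto simp: op_comp_def fun_eq_iff restrict_def psi_tensor_op)

end

text \<open>\<open>psi N\<close> is injective, so identities between tensored operators can be
  checked after applying it. The functor laws of the tensor product thus reduce to those of
  \<open>F\<close>.\<close>

lemma tensor_op_eqI:
  assumes M: "hmodule A M" and N: "hmodule A N" and T: "T \<in> operators A M N"
    and S: "natural_transf B (tensor A B M E) (tensor A B N E) S"
    and eq: "\<And>z X. z \<in> Obj B \<Longrightarrow> X \<in> elts (tensor A B M E) z \<Longrightarrow> psi N z (S z X) = far F M N T z (psi M z X)"
  shows "tensor_op A B E M N T = S"
proof (rule natural_transf_eqI[OF operatorsD(1)[OF tensor_op_operators[OF M N T]] S])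
  fix z X assume "z \<in> Obj B" "X \<in> elts (tensor A B M E) z"
  then show "tensor_op A B E M N T z X = S z X"
    by (intro psi_eqI[OF N]) (auto simp: psi_tensor_op[OF M N T] eq natural_transfD(1)[OF S])
qed

lemma tensor_functor_cstar:
  "cstar_functor (Hilb A :: (('oa, 'ma, 'u) hmod, _) star_cat) (Hilb B) (tensor_functor A B E)"
proof -
  have hm: "hmodule A M" if "hilbert_module A M" for M :: "('oa, 'ma, 'u) hmod"
    using that cstar_category_axioms by (simp add: hmodule_def)
  have "linear_on (operator_space A M N) (operator_space B (tensor A B M E) (tensor A B N E)) (tensor_op A B E M N)"
    if M: "hmodule A M" and N: "hmodule A N" for M N :: "('oa, 'ma, 'u) hmod"
    unfolding linear_on_def operator_space_simps(1)
  proof (intro conjI ballI allI)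
    let ?M = "tensor A B M E" and ?N = "tensor A B N E"
    note tM = tensor_hmodule[OF M] and tN = tensor_hmodule[OF N]
    note to = tensor_op_operators[OF M N]
    note pl = natural_transf_linear[OF operatorsD(1)[OF psi_operators[OF N]]]
    show "tensor_op A B E M N \<in> operators A M N \<rightarrow> operators B ?M ?N" using to by auto
    fix S assume S: "S \<in> operators A M N"
    show "tensor_op A B E M N (S \<oplus>\<^bsub>operator_space A M N\<^esub> T)
        = tensor_op A B E M N S \<oplus>\<^bsub>operator_space B ?M ?N\<^esub> tensor_op A B E M N T"
      if T: "T \<in> operators A M N" for T
    proof (rule tensor_op_eqI[OF M N operators_add[OF M N S T] operatorsD(1)[OF operators_add[OF tM tN to[OF S] to[OF T]]]])
      fix z X assume z: "z \<in> Obj B" and X: "X \<in> elts ?M z"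
      show "psi N z ((tensor_op A B E M N S \<oplus>\<^bsub>operator_space B ?M ?N\<^esub> tensor_op A B E M N T) z X)
          = far F M N (S \<oplus>\<^bsub>operator_space A M N\<^esub> T) z (psi M z X)"
        unfolding F_add[OF M N S T z psi_closed[OF M z X]]
        using z X psi_tensor_op[OF M N S z X] psi_tensor_op[OF M N T z X] by (simp add: pl)
    qed
    show "tensor_op A B E M N (k \<odot>\<^bsub>operator_space A M N\<^esub> S) = k \<odot>\<^bsub>operator_space B ?M ?N\<^esub> tensor_op A B E M N S" for k
    proof (rule tensor_op_eqI[OF M N operators_smult[OF M N S] operatorsD(1)[OF operators_smult[OF tM tN to[OF S]]]])
      fix z X assume z: "z \<in> Obj B" and X: "X \<in> elts ?M z"
      show "psi N z ((k \<odot>\<^bsub>operator_space B ?M ?N\<^esub> tensor_op A B E M N S) z X)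
          = far F M N (k \<odot>\<^bsub>operator_space A M N\<^esub> S) z (psi M z X)"
        unfolding F_smult[OF M N S z psi_closed[OF M z X]]
        using z X psi_tensor_op[OF M N S z X] by (simp add: pl)
    qed
  qed
  moreover have "tensor_op A B E M L (op_comp A M S T)
      = op_comp B (tensor A B M E) (tensor_op A B E N L S) (tensor_op A B E M N T)"
    if M: "hmodule A M" and N: "hmodule A N" and L: "hmodule A L"
      and T: "T \<in> operators A M N" and S: "S \<in> operators A N L" for M N L :: "('oa, 'ma, 'u) hmod" and S T
  proof (rule tensor_op_eqI[OF M L operators_comp(1)[OF M N L T S]])
    show "natural_transf B (tensor A B M E) (tensor A B L E)
        (op_comp B (tensor A B M E) (tensor_op A B E N L S) (tensor_op A B E M N T))"
      using tensor_op_operators[OF M N T] tensor_op_operators[OF N L S] tensor_hmodule[OF M] operatorsD(1)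
      by (blast intro: natural_transf_comp)
    fix z X assume z: "z \<in> Obj B" and X: "X \<in> elts (tensor A B M E) z"
    show "psi L z (op_comp B (tensor A B M E) (tensor_op A B E N L S) (tensor_op A B E M N T) z X)
        = far F M L (op_comp A M S T) z (psi M z X)"
      using z X psi_tensor_op[OF M N T z X] psi_tensor_op(2)[OF N L S z psi_tensor_op(1)[OF M N T z X]]
        psi_closed[OF M z X] by (simp add: F_comp[OF M N L T S])
  qed
  moreover have "tensor_op A B E N M (adjoint A M N T) = adjoint B (tensor A B M E) (tensor A B N E) (tensor_op A B E M N T)"
    if M: "hmodule A M" and N: "hmodule A N" and T: "T \<in> operators A M N" for M N :: "('oa, 'ma, 'u) hmod" and T
  proof (rule adjoint_eq[OF tensor_hmodule[OF M] tensor_hmodule[OF N], symmetric])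
    note S = adjoint_operators(1)[OF M N T]
    \<comment> \<open>The adjoint relation is tested inside the values of \<open>F\<close>, to which
      \<open>psi_inn\<close> transfers both inner products.\<close>
    have adj: "is_adjoint B (fob F M) (fob F N) (far F M N T) (far F N M (adjoint A M N T))"
      unfolding F_adjoint[OF M N T]
      by (rule adjoint_is_adjoint[OF F_hmodule[OF M] F_hmodule[OF N] F_operators[OF M N T]])
    show "is_adjoint B (tensor A B M E) (tensor A B N E) (tensor_op A B E M N T) (tensor_op A B E N M (adjoint A M N T))"
      unfolding is_adjoint_def
    proof (intro conjI ballI operatorsD(1)[OF tensor_op_operators[OF N M S]])
      fix x y X Y assume x: "x \<in> Obj B" and y: "y \<in> Obj B"
        and X: "X \<in> elts (tensor A B M E) y" and Y: "Y \<in> elts (tensor A B N E) x"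
      show "inn (tensor A B N E) y x (tensor_op A B E M N T y X) Y
          = inn (tensor A B M E) y x X (tensor_op A B E N M (adjoint A M N T) x Y)"
        using psi_tensor_op[OF M N T y X] psi_tensor_op[OF N M S x Y] x y X Y
          is_adjointD(2)[OF adj x y psi_closed[OF M y X] psi_closed[OF N x Y]]
        by (simp add: psi_inn[OF M] psi_inn[OF N])
    qed
  qed
  moreover have "hilbert_module B (tensor A B M E)" if "hilbert_module A M" for M :: "('oa, 'ma, 'u) hmod"
    using tensor_hmodule[OF hm[OF that]] by (simp add: hmodule_def)
  ultimately show ?thesis
    using hm unfolding cstar_functor_def by (auto simp: tensor_functor_def)
qed

lemma tensor_iso: "natural_unitary_iso (Hilb A) B (tensor_functor A B E) F psi"
proof -
  have hm: "hmodule A M" if "hilbert_module A M" for M :: "('oa, 'ma, 'u) hmod"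
    using that cstar_category_axioms by (simp add: hmodule_def)
  show ?thesis
    unfolding natural_unitary_iso_def
    using tensor_functor_cstar F psi_unitary psi_natural hm by (auto simp: tensor_functor_def)
qed

end

theorem theorem4p17:
  fixes A :: "('oa, 'ma) star_cat"
    and B :: "('ob, 'mb) star_cat"
    and j :: "'ma \<Rightarrow> 'u"
    and F :: "(('oa, 'ma, 'u) hmod, 'oa \<Rightarrow> 'u \<Rightarrow> 'u,
               ('ob, 'mb, 'v) hmod, 'ob \<Rightarrow> 'v \<Rightarrow> 'v) cfunctor"
    and E :: "('oa, 'ma, 'ob, 'mb, 'v) bimodule"
  assumes "cstar_category A"
    and "cstar_category B"
    and "inj j"
    and "cstar_functor (Hilb A) (Hilb B) F"
    and "preserves_identities (Hilb A) (Hilb B) F"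
    and "strong_functor A B F"
    and "E = functor_comp F (yoneda j A)"
  shows "\<exists>\<psi>. natural_unitary_iso (Hilb A) B (tensor_functor A B E) F \<psi>"
proof -
  interpret strong_setup A B j F E
    using assms by (simp add: strong_setup_def strong_setup_axioms_def yoneda_universe_def yoneda_universe_axioms_def)
  show ?thesis using tensor_iso by blast
qed

end
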